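(* (i) Any uniformly integrable set of graphons is relatively complete for the cut metric. (ii) Any semiuniformly integrable set of nonnegative graphons is relatively complete for the cut metric. (iii) If $1<p\le\infty$ and $C<\infty$, the set of nonnegative graphons $W$ with $\|W\|_{L^p}\le C$ is complete for the cut metric; hence any set of nonnegative graphons bounded in $L^p$ is relatively complete for the cut metric. (iv) The set of $[0,1]$-valued graphons is complete for the cut metric. (v) If $1<p\le\infty$ and $C,C_1<\infty$, the set of graphons $W$ with $\|W\|_{L^p}\le C$ and $\|W\|_{L^1}\le C_1$ is complete for the cut metric; hence any set of graphons bounded in both $L^1$ and $L^p$ is relatively complete for the cut metric.
   Context: A graphon $(W,S,\mathcal F,\mu)$ is a symmetric real-valued function $W\in L^1(S\times S,\mu\times\mu)$ where $(S,\mathcal F,\mu)$ is any $\sigma$-finite measure space (graphons in a set may live on different spaces); graphons equal a.e. are identified. Cut norm: $\|F\|_\square:=\sup_{T,U}|\int_{T\times U}F\,d\mu\,d\mu|$ over measurable $T,U$. Pull-back: $W^{\varphi}(x,y)=W(\varphi(x),\varphi(y))$. Coupling: a pair of measure-preserving maps $\varphi_i:S\to S_i$ from a common $\sigma$-finite space. Cut metric: if $\mu_1(S_1)=\mu_2(S_2)$, $\delta_\square(W_1,W_2):=\inf\|W_1^{\varphi_1}-W_2^{\varphi_2}\|_\square$ over couplings; otherwise computed after extending each $W_i$ by zero to a larger measure space so that total masses agree (a well-defined pseudometric). Metric notions (Cauchy, convergence, completeness) are understood in the metric space of equivalence classes $\{\delta_\square=0\}$. A set is relatively complete if every Cauchy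 sequence in it converges to some graphon. A set $\mathcal A$ of graphons is uniformly integrable if $\sup_{W\in\mathcal A}\|W\|_{L^1}<\infty$ and $\sup_{W\in\mathcal A}\int_{|W|>B}|W|\to0$ as $B\to\infty$; semiuniformly integrable if only the second condition holds. *)

theory Defs
  imports "HOL-Analysis.Analysis"
begin

definition graphon :: "'a measure \<Rightarrow> ('a \<Rightarrow> 'a \<Rightarrow> real) \<Rightarrow> bool" where
  "graphon M W \<longleftrightarrow> sigma_finite_measure M
     \<and> integrable (M \<Otimes>\<^sub>M M) (\<lambda>z. W (fst z) (snd z))
     \<and> (\<forall>x\<in>space M. \<forall>y\<in>space M. W x y = W y x)"

definition cut_norm :: "'a measure \<Rightarrow> ('a \<Rightarrow> 'a \<Rightarrow> real) \<Rightarrow> real" where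
  "cut_norm M F = (SUP TU \<in> sets M \<times> sets M.
      \<bar>LINT z : (fst TU \<times> snd TU) | (M \<Otimes>\<^sub>M M). F (fst z) (snd z)\<bar>)"

definition pullback :: "('a \<Rightarrow> 'a \<Rightarrow> real) \<Rightarrow> ('c \<Rightarrow> 'a) \<Rightarrow> ('c \<Rightarrow> 'c \<Rightarrow> real)" where
  "pullback W \<phi> = (\<lambda>x y. W (\<phi> x) (\<phi> y))"

definition measure_preserving :: "'c measure \<Rightarrow> 'a measure \<Rightarrow> ('c \<Rightarrow> 'a) \<Rightarrow> bool" where
  "measure_preserving N M \<phi> \<longleftrightarrow> \<phi> \<in> measurable N M \<and> distr N M \<phi> = M"

definition coupling :: "'c measure \<Rightarrow> 'a measure \<Rightarrow> 'b measure \<Rightarrow> ('c \<Rightarrow> 'a) \<Rightarrow> ('c \<Rightarrow> 'b) \<Rightarrow> bool" where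
  "coupling N M1 M2 \<phi>1 \<phi>2 \<longleftrightarrow> sigma_finite_measure N
     \<and> measure_preserving N M1 \<phi>1 \<and> measure_preserving N M2 \<phi>2"

definition delta_eq :: "'a measure \<Rightarrow> ('a \<Rightarrow> 'a \<Rightarrow> real) \<Rightarrow> 'b measure \<Rightarrow> ('b \<Rightarrow> 'b \<Rightarrow> real) \<Rightarrow> real" where
  "delta_eq M1 W1 M2 W2 = Inf {cut_norm N (\<lambda>x y. pullback W1 \<phi>1 x y - pullback W2 \<phi>2 x y)
       | (N :: ('a \<times> 'b) measure) \<phi>1 \<phi>2. coupling N M1 M2 \<phi>1 \<phi>2}"

text \<open>Extension by zero of a graphon to the disjoint union of its space with
  (the real line with) Lebesgue measure, which has infinite total mass.\<close>

definition ext_measure :: "'a measure \<Rightarrow> ('a + real) measure" where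
  "ext_measure M = measure_of (Inl ` space M \<union> range Inr)
     {A. A \<subseteq> Inl ` space M \<union> range Inr \<and> Inl -` A \<in> sets M \<and> Inr -` A \<in> sets borel}
     (\<lambda>A. emeasure M (Inl -` A) + emeasure lborel (Inr -` A))"

definition ext_fun :: "('a \<Rightarrow> 'a \<Rightarrow> real) \<Rightarrow> ('a + real) \<Rightarrow> ('a + real) \<Rightarrow> real" where
  "ext_fun W u v = (case (u, v) of (Inl x, Inl y) \<Rightarrow> W x y | _ \<Rightarrow> 0)"

text \<open>Cut metric: direct if total masses agree, otherwise after extending both
  graphons by zero so that both total masses become infinite.\<close>

definition delta_cut :: "'a measure \<Rightarrow> ('a \<Rightarrow> 'a \<Rightarrow> real) \<Rightarrow> 'b measure \<Rightarrow> ('b \<Rightarrow> 'b \<Rightarrow> real) \<Rightarrow> real" where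
  "delta_cut M1 W1 M2 W2 =
     (if emeasure M1 (space M1) = emeasure M2 (space M2) then delta_eq M1 W1 M2 W2
      else delta_eq (ext_measure M1) (ext_fun W1) (ext_measure M2) (ext_fun W2))"

definition cut_cauchy :: "(nat \<Rightarrow> 'a measure \<times> ('a \<Rightarrow> 'a \<Rightarrow> real)) \<Rightarrow> bool" where
  "cut_cauchy G \<longleftrightarrow> (\<forall>e>0. \<exists>N. \<forall>m\<ge>N. \<forall>n\<ge>N.
      delta_cut (fst (G m)) (snd (G m)) (fst (G n)) (snd (G n)) < e)"

definition cut_converges :: "(nat \<Rightarrow> 'a measure \<times> ('a \<Rightarrow> 'a \<Rightarrow> real)) \<Rightarrow> 'b measure \<Rightarrow> ('b \<Rightarrow> 'b \<Rightarrow> real) \<Rightarrow> bool" where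
  "cut_converges G M W \<longleftrightarrow> (\<lambda>n. delta_cut (fst (G n)) (snd (G n)) M W) \<longlonglongrightarrow> 0"

definition rel_complete :: "('a measure \<times> ('a \<Rightarrow> 'a \<Rightarrow> real)) set \<Rightarrow> bool" where
  "rel_complete A \<longleftrightarrow> (\<forall>G. (\<forall>n. G n \<in> A) \<and> cut_cauchy G \<longrightarrow>
      (\<exists>(M :: real measure) W. graphon M W \<and> cut_converges G M W))"

text \<open>Completeness of the class of all graphons with property P (P is applied to
  graphons on any type): every Cauchy sequence of graphons with property P converges
  to a graphon with property P.\<close>

definition complete_class ::
  "('a measure \<Rightarrow> ('a \<Rightarrow> 'a \<Rightarrow> real) \<Rightarrow> bool) \<Rightarrow> (real measure \<Rightarrow> (real \<Rightarrow> real \<Rightarrow> real) \<Rightarrow> bool) \<Rightarrow> bool" where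
  "complete_class P P' \<longleftrightarrow> (\<forall>G. (\<forall>n. graphon (fst (G n)) (snd (G n)) \<and> P (fst (G n)) (snd (G n)))
      \<and> cut_cauchy G \<longrightarrow>
      (\<exists>M W. graphon M W \<and> P' M W \<and> cut_converges G M W))"

definition L1_norm :: "'a measure \<Rightarrow> ('a \<Rightarrow> 'a \<Rightarrow> real) \<Rightarrow> real" where
  "L1_norm M W = (LINT z | (M \<Otimes>\<^sub>M M). \<bar>W (fst z) (snd z)\<bar>)"

definition tail_int :: "'a measure \<Rightarrow> ('a \<Rightarrow> 'a \<Rightarrow> real) \<Rightarrow> real \<Rightarrow> real" where
  "tail_int M W B = (LINT z : {z. \<bar>W (fst z) (snd z)\<bar> > B} | (M \<Otimes>\<^sub>M M). \<bar>W (fst z) (snd z)\<bar>)"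

definition semiunif_integrable :: "('a measure \<times> ('a \<Rightarrow> 'a \<Rightarrow> real)) set \<Rightarrow> bool" where
  "semiunif_integrable A \<longleftrightarrow>
     (\<forall>e>0. \<exists>B0. \<forall>B\<ge>B0. \<forall>G\<in>A. tail_int (fst G) (snd G) B \<le> e)"

definition unif_integrable :: "('a measure \<times> ('a \<Rightarrow> 'a \<Rightarrow> real)) set \<Rightarrow> bool" where
  "unif_integrable A \<longleftrightarrow> (\<exists>K. \<forall>G\<in>A. L1_norm (fst G) (snd G) \<le> K) \<and> semiunif_integrable A"

definition Lp_le :: "ereal \<Rightarrow> real \<Rightarrow> 'a measure \<Rightarrow> ('a \<Rightarrow> 'a \<Rightarrow> real) \<Rightarrow> bool" where
  "Lp_le p C M W \<longleftrightarrow>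
    (if p = \<infinity> then (AE z in M \<Otimes>\<^sub>M M. \<bar>W (fst z) (snd z)\<bar> \<le> C)
     else (\<integral>\<^sup>+ z. ennreal (\<bar>W (fst z) (snd z)\<bar> powr real_of_ereal p) \<partial>(M \<Otimes>\<^sub>M M)) < \<infinity>
        \<and> (LINT z | (M \<Otimes>\<^sub>M M). \<bar>W (fst z) (snd z)\<bar> powr real_of_ereal p) powr (1 / real_of_ereal p) \<le> C)"

definition nonneg_graphon :: "'a measure \<Rightarrow> ('a \<Rightarrow> 'a \<Rightarrow> real) \<Rightarrow> bool" where
  "nonneg_graphon M W \<longleftrightarrow> (\<forall>x\<in>space M. \<forall>y\<in>space M. 0 \<le> W x y)"

definition unit_graphon :: "'a measure \<Rightarrow> ('a \<Rightarrow> 'a \<Rightarrow> real) \<Rightarrow> bool" where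
  "unit_graphon M W \<longleftrightarrow> (\<forall>x\<in>space M. \<forall>y\<in>space M. 0 \<le> W x y \<and> W x y \<le> 1)"

end

theory Submission
  imports Defs
begin

text \<open>
  Step functions are dense in \<open>L\<^sup>1\<close>, and the cut norm of a step function depends only on its values
  and the masses of its steps. So a coupling of two graphons may be replaced by the matrix of masses
  that it gives to pairs of steps, and every finite matrix of masses can be realised by splitting
  subsets of the real line. In this way a fast Cauchy subsequence is turned, up to small
  \<open>L\<^sup>1\<close> errors, into step functions \<open>F\<^sub>k\<close> on the line that form a Cauchy sequence in the cut norm itself.
  Being bounded in \<open>L\<^sup>1\<close>, the \<open>F\<^sub>k\<close> have convex combinations of their tails that converge almost
  everywhere to some \<open>w\<close>; by uniform integrability and convexity of the cut norm, \<open>F\<^sub>k\<close> tends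
  to \<open>w\<close> in the cut norm. Bounds on integrals of convex functions of the graphons pass to \<open>w\<close> by
  convexity and Fatou's lemma. For nonnegative graphons the \<open>L\<^sup>1\<close> bound is automatic, since the integral
  is continuous in the cut norm.
\<close>

section \<open>The cut norm and step functions\<close>

text \<open>Couplings of arbitrary sigma-finite spaces need not glue, since disintegration may fail
  there, whereas finite matrices of masses can always be glued on the line. Therefore graphons enter
  only through finite labellings, and no limit of couplings is ever taken. Label 0 is a background
  on which all weights vanish. A realisation does not prescribe its mass, so spaces of finite and of
  infinite mass are treated alike on a line whose background has infinite mass.

  The cut norm is not complete on \<open>L^1\<close>, so a Cauchy sequence for it alone yields no
  limit function. Convex combinations supply a candidate, and uniform integrability identifies its
  integrals over rectangles. It is used through \<open>excess\<close>, the integral of a convex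
  Lipschitz function: such integrals change little under small \<open>L^1\<close> errors and stay
  bounded under convex combinations. The same two properties define the test functions, by which the
  bounds of the classes reach the limit.\<close>

abbreviation sq :: "'a measure \<Rightarrow> ('a \<times> 'a) measure" where
  "sq M \<equiv> M \<Otimes>\<^sub>M M"

abbreviation gintegrable :: "'a measure \<Rightarrow> ('a \<Rightarrow> 'a \<Rightarrow> real) \<Rightarrow> bool" where
  "gintegrable M F \<equiv> integrable (sq M) (\<lambda>z. F (fst z) (snd z))"

abbreviation rect_int :: "'a measure \<Rightarrow> ('a \<Rightarrow> 'a \<Rightarrow> real) \<Rightarrow> 'a set \<Rightarrow> 'a set \<Rightarrow> real" where
  "rect_int M F T U \<equiv> (LINT z : T \<times> U | (sq M). F (fst z) (snd z))"

lemma rect_set_integrable: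
  assumes "gintegrable M F" "T \<in> sets M" "U \<in> sets M"
  shows "set_integrable (sq M) (T \<times> U) (\<lambda>z. F (fst z) (snd z))"
  unfolding set_integrable_def
  by (rule integrable_mult_indicator) (use assms in auto)

lemma rect_int_le_L1:
  assumes "gintegrable M F" "T \<in> sets M" "U \<in> sets M"
  shows "\<bar>rect_int M F T U\<bar> \<le> L1_norm M F"
proof -
  have "\<bar>rect_int M F T U\<bar> \<le> (LINT z|sq M. \<bar>indicator (T \<times> U) z *\<^sub>R F (fst z) (snd z)\<bar>)"
    unfolding set_lebesgue_integral_def by (rule integral_abs_bound)
  also have "\<dots> \<le> L1_norm M F"
    unfolding L1_norm_def
    by (rule integral_mono)
       (use rect_set_integrable[OF assms] assms(1) in
         \<open>auto simp: set_integrable_def indicator_def intro!: integrable_abs\<close>)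
  finally show ?thesis .
qed

lemma cut_norm_upper:
  assumes "gintegrable M F" "T \<in> sets M" "U \<in> sets M"
  shows "\<bar>rect_int M F T U\<bar> \<le> cut_norm M F"
proof -
  have "bdd_above ((\<lambda>TU. \<bar>rect_int M F (fst TU) (snd TU)\<bar>) ` (sets M \<times> sets M))"
    by (rule bdd_aboveI[of _ "L1_norm M F"]) (use rect_int_le_L1[OF assms(1)] in auto)
  from cSUP_upper[OF _ this, of "(T, U)"] assms show ?thesis
    unfolding cut_norm_def by auto
qed

lemma cut_norm_least:
  assumes "\<And>T U. T \<in> sets M \<Longrightarrow> U \<in> sets M \<Longrightarrow> \<bar>rect_int M F T U\<bar> \<le> c"
  shows "cut_norm M F \<le> c"
  unfolding cut_norm_def by (rule cSUP_least) (use assms in auto)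

lemma cut_norm_nonneg: "gintegrable M F \<Longrightarrow> 0 \<le> cut_norm M F"
  using cut_norm_upper[of M F "{}" "{}"] by simp

lemma cut_norm_le_L1: "gintegrable M F \<Longrightarrow> cut_norm M F \<le> L1_norm M F"
  by (rule cut_norm_least) (rule rect_int_le_L1)

lemma rect_int_diff:
  assumes "gintegrable M F" "gintegrable M G" "T \<in> sets M" "U \<in> sets M"
  shows "rect_int M (\<lambda>x y. F x y - G x y) T U = rect_int M F T U - rect_int M G T U"
  by (rule set_integral_diff(2)) (use rect_set_integrable assms in blast)+

lemma cut_norm_triangle:
  assumes "gintegrable M F" "gintegrable M G" "gintegrable M H"
  shows "cut_norm M (\<lambda>x y. F x y - H x y)
    \<le> cut_norm M (\<lambda>x y. F x y - G x y) + cut_norm M (\<lambda>x y. G x y - H x y)"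
proof (rule cut_norm_least)
  fix T U assume TU: "T \<in> sets M" "U \<in> sets M"
  have "\<bar>rect_int M (\<lambda>x y. F x y - G x y) T U\<bar> \<le> cut_norm M (\<lambda>x y. F x y - G x y)"
    "\<bar>rect_int M (\<lambda>x y. G x y - H x y) T U\<bar> \<le> cut_norm M (\<lambda>x y. G x y - H x y)"
    using TU by (intro cut_norm_upper Bochner_Integration.integrable_diff assms; simp)+
  then show "\<bar>rect_int M (\<lambda>x y. F x y - H x y) T U\<bar>
      \<le> cut_norm M (\<lambda>x y. F x y - G x y) + cut_norm M (\<lambda>x y. G x y - H x y)"
    using rect_int_diff[OF assms(1,2) TU] rect_int_diff[OF assms(2,3) TU]
      rect_int_diff[OF assms(1,3) TU] by linarith
qed

lemma cut_norm_commute: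
  "cut_norm M (\<lambda>x y. F x y - G x y) = cut_norm M (\<lambda>x y. G x y - F x y)"
proof -
  have "\<bar>rect_int M (\<lambda>x y. F x y - G x y) T U\<bar> = \<bar>rect_int M (\<lambda>x y. G x y - F x y) T U\<bar>" for T U
  proof -
    have "rect_int M (\<lambda>x y. F x y - G x y) T U = - rect_int M (\<lambda>x y. G x y - F x y) T U"
      unfolding set_lebesgue_integral_def
      by (subst integral_minus[symmetric], rule Bochner_Integration.integral_cong) (auto simp: indicator_def)
    then show ?thesis by simp
  qed
  then show ?thesis unfolding cut_norm_def by simp
qed

lemma cut_norm_cong_AE:
  assumes "(\<lambda>z. F (fst z) (snd z)) \<in> borel_measurable (sq M)"
    and "(\<lambda>z. G (fst z) (snd z)) \<in> borel_measurable (sq M)"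
    and "AE z in sq M. F (fst z) (snd z) = G (fst z) (snd z)"
  shows "cut_norm M F = cut_norm M G"
proof -
  have "rect_int M F T U = rect_int M G T U" if "T \<in> sets M" "U \<in> sets M" for T U
    unfolding set_lebesgue_integral_def
    by (rule integral_cong_AE) (use assms that in auto)
  then show ?thesis unfolding cut_norm_def by (intro SUP_cong) auto
qed

text \<open>The cut norm is 1-Lipschitz for the \<open>L^1\<close> distance; every exchange of a
  kernel for a nearby step function is paid for by this.\<close>

lemma cut_norm_le_add_L1:
  assumes "gintegrable M F" "gintegrable M G"
  shows "cut_norm M F \<le> cut_norm M G + L1_norm M (\<lambda>x y. F x y - G x y)"
proof -
  have "cut_norm M (\<lambda>x y. F x y - 0) \<le> cut_norm M (\<lambda>x y. F x y - G x y) + cut_norm M (\<lambda>x y. G x y - 0)"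
    using assms by (intro cut_norm_triangle) auto
  moreover have "cut_norm M (\<lambda>x y. F x y - G x y) \<le> L1_norm M (\<lambda>x y. F x y - G x y)"
    using assms by (intro cut_norm_le_L1) auto
  ultimately show ?thesis by simp
qed

section \<open>Step functions along a labelling, with labels of any type\<close>

abbreviation fiber :: "'a measure \<Rightarrow> ('a \<Rightarrow> 'l) \<Rightarrow> 'l \<Rightarrow> 'a set" where
  "fiber M \<sigma> i \<equiv> \<sigma> -` {i} \<inter> space M"

abbreviation (input) step_fun :: "('l \<Rightarrow> 'l \<Rightarrow> real) \<Rightarrow> ('a \<Rightarrow> 'l) \<Rightarrow> 'a \<Rightarrow> 'a \<Rightarrow> real" where
  "step_fun u \<sigma> \<equiv> \<lambda>x y. u (\<sigma> x) (\<sigma> y)"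

text \<open>Only labels in \<open>J\<close> need fibers of finite mass, because \<open>u\<close>
  vanishes off \<open>J\<close>. This leaves room for a background label of infinite mass, and
  \<open>J\<close> may consist of pairs when two labellings are compared.\<close>

lemma
  fixes u :: "'l \<Rightarrow> 'l \<Rightarrow> real"
  assumes M: "sigma_finite_measure M" and \<sigma>: "\<sigma> \<in> measurable M (count_space UNIV)"
    and J: "finite J" "\<And>i. i \<in> J \<Longrightarrow> emeasure M (fiber M \<sigma> i) < \<infinity>"
    and u: "\<And>i j. u i j \<noteq> 0 \<Longrightarrow> i \<in> J \<and> j \<in> J"
  shows step_fun_integrable: "gintegrable M (step_fun u \<sigma>)"
    and rect_int_step_fun: "\<And>T U. T \<in> sets M \<Longrightarrow> U \<in> sets M \<Longrightarrow> rect_int M (step_fun u \<sigma>) T U =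
      (\<Sum>i\<in>J. \<Sum>j\<in>J. u i j * measure M (T \<inter> fiber M \<sigma> i) * measure M (U \<inter> fiber M \<sigma> j))"
proof -
  interpret sigma_finite_measure M by (rule M)
  have fm: "fiber M \<sigma> i \<in> sets M" for i
    using \<sigma> by (rule measurable_sets) simp
  have fin: "emeasure M (T \<inter> fiber M \<sigma> i) < \<infinity>" if "i \<in> J" "T \<in> sets M" for i T
    using J(2)[OF that(1)] emeasure_mono[of "T \<inter> fiber M \<sigma> i" "fiber M \<sigma> i" M] fm
    by (meson Int_lower2 le_less_trans)
  have emr: "emeasure (sq M) ((T \<inter> fiber M \<sigma> i) \<times> (U \<inter> fiber M \<sigma> j)) =
     emeasure M (T \<inter> fiber M \<sigma> i) * emeasure M (U \<inter> fiber M \<sigma> j)"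
    if "T \<in> sets M" "U \<in> sets M" for T U i j
    using that fm by (intro emeasure_pair_measure_Times) auto
  have rint: "integrable (sq M) (indicat_real ((T \<inter> fiber M \<sigma> i) \<times> (U \<inter> fiber M \<sigma> j)))"
    if "i \<in> J" "j \<in> J" "T \<in> sets M" "U \<in> sets M" for T U i j
    using that fm fin[of i T] fin[of j U]
    by (intro integrable_real_indicator) (auto simp: emr ennreal_mult_less_top)
  \<comment> \<open>At a point \<open>z\<close> at most one term of the double sum survives, the one
    for the labels of its two coordinates; if one of these is outside \<open>J\<close>, both sides
    vanish.\<close>
  have eq: "indicator (T \<times> U) z *\<^sub>R step_fun u \<sigma> (fst z) (snd z) =
     (\<Sum>i\<in>J. \<Sum>j\<in>J. u i j * indicator ((T \<inter> fiber M \<sigma> i) \<times> (U \<inter> fiber M \<sigma> j)) z)"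
    if z: "z \<in> space (sq M)" for z T U
  proof (cases "\<sigma> (fst z) \<in> J \<and> \<sigma> (snd z) \<in> J")
    case True
    have "(\<Sum>i\<in>J. \<Sum>j\<in>J. u i j * indicator ((T \<inter> fiber M \<sigma> i) \<times> (U \<inter> fiber M \<sigma> j)) z)
      = (\<Sum>i\<in>J. if i = \<sigma> (fst z) then (\<Sum>j\<in>J. if j = \<sigma> (snd z) then indicator (T \<times> U) z * u i j else 0) else 0)"
      using z by (intro sum.cong) (auto simp: indicator_def space_pair_measure mem_Times_iff intro!: sum.neutral sum.cong)
    then show ?thesis using True J(1) by simp
  next
    case False
    then have "u (\<sigma> (fst z)) (\<sigma> (snd z)) = 0" using u by blast
    moreover have "(\<Sum>i\<in>J. \<Sum>j\<in>J. u i j * indicator ((T \<inter> fiber M \<sigma> i) \<times> (U \<inter> fiber M \<sigma> j)) z) = 0"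
      using False by (intro sum.neutral ballI) (auto simp: indicator_def mem_Times_iff)
    ultimately show ?thesis by simp
  qed
  have rhs: "integrable (sq M) (\<lambda>z. \<Sum>i\<in>J. \<Sum>j\<in>J. u i j * indicator ((T \<inter> fiber M \<sigma> i) \<times> (U \<inter> fiber M \<sigma> j)) z)"
    if "T \<in> sets M" "U \<in> sets M" for T U
    using rint that by (intro Bochner_Integration.integrable_sum integrable_mult_right) auto
  show "gintegrable M (step_fun u \<sigma>)"
    using rhs[of "space M" "space M"]
    by (rule Bochner_Integration.integrable_cong[THEN iffD1, rotated -1])
       (simp_all add: eq[of _ "space M" "space M", symmetric] space_pair_measure[symmetric])
  fix T U assume TU: "T \<in> sets M" "U \<in> sets M"
  have "rect_int M (step_fun u \<sigma>) T U =
      (integral\<^sup>L (sq M) (\<lambda>z. \<Sum>i\<in>J. \<Sum>j\<in>J. u i j * indicator ((T \<inter> fiber M \<sigma> i) \<times> (U \<inter> fiber M \<sigma> j)) z))"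
    unfolding set_lebesgue_integral_def by (rule Bochner_Integration.integral_cong[OF refl eq])
  also have "\<dots> = (\<Sum>i\<in>J. \<Sum>j\<in>J. u i j * measure (sq M) ((T \<inter> fiber M \<sigma> i) \<times> (U \<inter> fiber M \<sigma> j)))"
  proof (subst Bochner_Integration.integral_sum)
    show "integrable (sq M) (\<lambda>z. \<Sum>j\<in>J. u i j * indicator ((T \<inter> fiber M \<sigma> i) \<times> (U \<inter> fiber M \<sigma> j)) z)"
      if "i \<in> J" for i
      using rint that TU by (intro Bochner_Integration.integrable_sum integrable_mult_right) auto
    show "(\<Sum>i\<in>J. (integral\<^sup>L (sq M) (\<lambda>z. \<Sum>j\<in>J. u i j * indicator ((T \<inter> fiber M \<sigma> i) \<times> (U \<inter> fiber M \<sigma> j)) z)))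
      = (\<Sum>i\<in>J. \<Sum>j\<in>J. u i j * measure (sq M) ((T \<inter> fiber M \<sigma> i) \<times> (U \<inter> fiber M \<sigma> j)))"
    proof (intro sum.cong refl)
      fix i assume i: "i \<in> J"
      have one: "(LINT z|sq M. u i j * indicator ((T \<inter> fiber M \<sigma> i) \<times> (U \<inter> fiber M \<sigma> j)) z)
        = u i j * measure (sq M) ((T \<inter> fiber M \<sigma> i) \<times> (U \<inter> fiber M \<sigma> j))" for j
      proof -
        have "(T \<inter> fiber M \<sigma> i) \<times> (U \<inter> fiber M \<sigma> j) \<subseteq> space (sq M)"
          by (auto simp: space_pair_measure)
        then show ?thesis by (simp add: inf_absorb1)
      qed
      then show "(integral\<^sup>L (sq M) (\<lambda>z. \<Sum>j\<in>J. u i j * indicator ((T \<inter> fiber M \<sigma> i) \<times> (U \<inter> fiber M \<sigma> j)) z))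
        = (\<Sum>j\<in>J. u i j * measure (sq M) ((T \<inter> fiber M \<sigma> i) \<times> (U \<inter> fiber M \<sigma> j)))"
        using rint[OF i _ TU] by (subst Bochner_Integration.integral_sum) (auto simp only: one intro!: integrable_mult_right)
    qed
  qed
  also have "\<dots> = (\<Sum>i\<in>J. \<Sum>j\<in>J. u i j * measure M (T \<inter> fiber M \<sigma> i) * measure M (U \<inter> fiber M \<sigma> j))"
    by (simp add: measure_def emr TU enn2real_mult mult.assoc)
  finally show "rect_int M (step_fun u \<sigma>) T U =
      (\<Sum>i\<in>J. \<Sum>j\<in>J. u i j * measure M (T \<inter> fiber M \<sigma> i) * measure M (U \<inter> fiber M \<sigma> j))" .
qed

lemma integral_step_fun:
  fixes u :: "'l \<Rightarrow> 'l \<Rightarrow> real"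
  assumes M: "sigma_finite_measure M" and \<sigma>: "\<sigma> \<in> measurable M (count_space UNIV)"
    and J: "finite J" "\<And>i. i \<in> J \<Longrightarrow> emeasure M (fiber M \<sigma> i) < \<infinity>"
    and u: "\<And>i j. u i j \<noteq> 0 \<Longrightarrow> i \<in> J \<and> j \<in> J"
  shows "(LINT z|sq M. step_fun u \<sigma> (fst z) (snd z)) =
     (\<Sum>i\<in>J. \<Sum>j\<in>J. u i j * measure M (fiber M \<sigma> i) * measure M (fiber M \<sigma> j))"
proof -
  have "(LINT z|sq M. step_fun u \<sigma> (fst z) (snd z)) = rect_int M (step_fun u \<sigma>) (space M) (space M)"
    unfolding space_pair_measure[symmetric]
    by (rule set_integral_space[symmetric]) (rule step_fun_integrable[OF assms])
  also have "\<dots> = (\<Sum>i\<in>J. \<Sum>j\<in>J. u i j * measure M (fiber M \<sigma> i) * measure M (fiber M \<sigma> j))"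
    by (subst rect_int_step_fun[OF assms]) (auto intro!: sum.cong arg_cong2[where f="(*)"] arg_cong[where f="measure M"])
  finally show ?thesis .
qed

text \<open>A bilinear form is affine in each argument, so over a product of boxes it is largest at
  a pair of vertices. With \<open>b\<close> held fixed, \<open>a\<close> is moved to the vertex that
  keeps the labels with positive coefficient, and then \<open>b\<close> is moved in the same
  way.\<close>

lemma bilinear_vertex_bound:
  fixes u :: "'l \<Rightarrow> 'l \<Rightarrow> real"
  assumes "finite J" "\<And>i. i \<in> J \<Longrightarrow> 0 \<le> a i \<and> a i \<le> m i" "\<And>i. i \<in> J \<Longrightarrow> 0 \<le> b i \<and> b i \<le> m i"
  shows "\<exists>K\<subseteq>J. \<exists>L\<subseteq>J. (\<Sum>i\<in>J. \<Sum>j\<in>J. u i j * a i * b j) \<le> (\<Sum>i\<in>K. \<Sum>j\<in>L. u i j * m i * m j)"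
proof -
  have vert: "\<exists>K\<subseteq>J. (\<Sum>i\<in>J. c i * a' i) \<le> (\<Sum>i\<in>K. c i * m i)"
    if "\<And>i. i \<in> J \<Longrightarrow> 0 \<le> a' i \<and> a' i \<le> m i" for c a' :: "'l \<Rightarrow> real"
  proof (intro exI conjI)
    show "{i\<in>J. c i > 0} \<subseteq> J" by auto
    have "(\<Sum>i\<in>J. c i * a' i) \<le> (\<Sum>i\<in>J. if c i > 0 then c i * m i else 0)"
    proof (rule sum_mono)
      fix i assume "i \<in> J"
      then show "c i * a' i \<le> (if c i > 0 then c i * m i else 0)"
        using that[of i] by (cases "c i > 0") (simp_all add: mult_left_mono mult_nonpos_nonneg)
    qed
    also have "\<dots> = (\<Sum>i\<in>{i\<in>J. c i > 0}. c i * m i)"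
      using assms(1) by (simp add: sum.inter_filter)
    finally show "(\<Sum>i\<in>J. c i * a' i) \<le> (\<Sum>i\<in>{i\<in>J. c i > 0}. c i * m i)" .
  qed
  obtain K where K: "K \<subseteq> J" "(\<Sum>i\<in>J. (\<Sum>j\<in>J. u i j * b j) * a i) \<le> (\<Sum>i\<in>K. (\<Sum>j\<in>J. u i j * b j) * m i)"
    using vert[where a'=a and c="\<lambda>i. \<Sum>j\<in>J. u i j * b j"] assms(2) by auto
  obtain L where L: "L \<subseteq> J" "(\<Sum>j\<in>J. (\<Sum>i\<in>K. u i j * m i) * b j) \<le> (\<Sum>j\<in>L. (\<Sum>i\<in>K. u i j * m i) * m j)"
    using vert[where a'=b and c="\<lambda>j. \<Sum>i\<in>K. u i j * m i"] assms(3) by auto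
  have "(\<Sum>i\<in>J. \<Sum>j\<in>J. u i j * a i * b j) = (\<Sum>i\<in>J. (\<Sum>j\<in>J. u i j * b j) * a i)"
    by (simp add: sum_distrib_right sum_distrib_left mult_ac)
  also have "\<dots> \<le> (\<Sum>i\<in>K. (\<Sum>j\<in>J. u i j * b j) * m i)" by (rule K)
  also have "\<dots> = (\<Sum>j\<in>J. (\<Sum>i\<in>K. u i j * m i) * b j)"
    unfolding sum_distrib_right by (subst sum.swap) (simp add: mult_ac)
  also have "\<dots> \<le> (\<Sum>j\<in>L. (\<Sum>i\<in>K. u i j * m i) * m j)" by (rule L)
  also have "\<dots> = (\<Sum>i\<in>K. \<Sum>j\<in>L. u i j * m i * m j)"
    unfolding sum_distrib_right by (subst sum.swap) simp
  finally show ?thesis using K(1) L(1) by blast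
qed

text \<open>The cut norm of a step function is attained on unions of fibers, so it depends on the
  masses of the fibers only.\<close>

lemma cut_norm_step_fun_le:
  fixes u :: "'l \<Rightarrow> 'l \<Rightarrow> real"
  assumes M: "sigma_finite_measure M" and \<sigma>: "\<sigma> \<in> measurable M (count_space UNIV)"
    and M': "sigma_finite_measure M'" and \<tau>: "\<tau> \<in> measurable M' (count_space UNIV)"
    and J: "finite J" "\<And>i. i \<in> J \<Longrightarrow> emeasure M (fiber M \<sigma> i) < \<infinity>"
    and eq: "\<And>i. i \<in> J \<Longrightarrow> emeasure M (fiber M \<sigma> i) = emeasure M' (fiber M' \<tau> i)"
    and u: "\<And>i j. u i j \<noteq> 0 \<Longrightarrow> i \<in> J \<and> j \<in> J"
  shows "cut_norm M (step_fun u \<sigma>) \<le> cut_norm M' (step_fun u \<tau>)"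
proof (rule cut_norm_least)
  fix T U assume TU: "T \<in> sets M" "U \<in> sets M"
  define m where "m i = measure M (fiber M \<sigma> i)" for i
  have fm: "fiber M \<sigma> i \<in> sets M" for i
    using \<sigma> by (rule measurable_sets) simp
  have fm': "fiber M' \<tau> i \<in> sets M'" for i
    using \<tau> by (rule measurable_sets) simp
  have m': "measure M' (fiber M' \<tau> i) = m i" if "i \<in> J" for i
    using eq[OF that] by (simp add: m_def measure_def)
  have J': "emeasure M' (fiber M' \<tau> i) < \<infinity>" if "i \<in> J" for i
    using J(2)[OF that] eq[OF that] by simp
  have box: "0 \<le> measure M (T \<inter> fiber M \<sigma> i) \<and> measure M (T \<inter> fiber M \<sigma> i) \<le> m i" if "i \<in> J" "T \<in> sets M" for i T
    unfolding m_def using that fm J(2)[OF that(1)]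
    by (auto intro!: measure_mono_fmeasurable fmeasurableI)
  \<comment> \<open>Over unions of fibers the rectangle integral on \<open>M'\<close> is exactly the
    value of the form at a vertex, so the cut norm on \<open>M'\<close> bounds all vertex values;
    \<open>m'\<close> rewrites the masses of \<open>M'\<close> as those of \<open>M\<close>.\<close>
  have vertex: "\<bar>\<Sum>i\<in>K. \<Sum>j\<in>L. u i j * m i * m j\<bar> \<le> cut_norm M' (step_fun u \<tau>)" if "K \<subseteq> J" "L \<subseteq> J" for K L
  proof -
    have "\<bar>rect_int M' (step_fun u \<tau>) (\<tau> -` K \<inter> space M') (\<tau> -` L \<inter> space M')\<bar> \<le> cut_norm M' (step_fun u \<tau>)"
      using \<tau> by (intro cut_norm_upper step_fun_integrable[OF M' \<tau> J(1) J' u]) (auto intro: measurable_sets)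
    moreover have "rect_int M' (step_fun u \<tau>) (\<tau> -` K \<inter> space M') (\<tau> -` L \<inter> space M')
      = (\<Sum>i\<in>J. \<Sum>j\<in>J. u i j * measure M' ((\<tau> -` K \<inter> space M') \<inter> fiber M' \<tau> i) * measure M' ((\<tau> -` L \<inter> space M') \<inter> fiber M' \<tau> j))"
      using \<tau> by (intro rect_int_step_fun[OF M' \<tau> J(1) J' u]) (auto intro: measurable_sets)
    moreover have int: "(\<tau> -` K \<inter> space M') \<inter> fiber M' \<tau> i = (if i \<in> K then fiber M' \<tau> i else {})" for i K
      by auto
    moreover have "(\<Sum>i\<in>J. \<Sum>j\<in>J. u i j * measure M' ((\<tau> -` K \<inter> space M') \<inter> fiber M' \<tau> i) * measure M' ((\<tau> -` L \<inter> space M') \<inter> fiber M' \<tau> j))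
      = (\<Sum>i\<in>J. if i \<in> K then (\<Sum>j\<in>J. if j \<in> L then u i j * m i * m j else 0) else 0)"
      unfolding int by (intro sum.cong refl) (auto simp: m' intro!: sum.cong)
    moreover have "\<dots> = (\<Sum>i\<in>K. \<Sum>j\<in>L. u i j * m i * m j)"
      using that J(1) by (simp add: sum.inter_restrict[symmetric] inf_absorb2)
    ultimately show ?thesis by simp
  qed
  let ?S = "\<lambda>u. \<Sum>i\<in>J. \<Sum>j\<in>J. u i j * measure M (T \<inter> fiber M \<sigma> i) * measure M (U \<inter> fiber M \<sigma> j)"
  obtain K L where KL: "K \<subseteq> J" "L \<subseteq> J" "?S u \<le> (\<Sum>i\<in>K. \<Sum>j\<in>L. u i j * m i * m j)"
    using bilinear_vertex_bound[OF J(1), where a="\<lambda>i. measure M (T \<inter> fiber M \<sigma> i)" and b="\<lambda>i. measure M (U \<inter> fiber M \<sigma> i)" and m=m and u=u] box TU by blast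
  \<comment> \<open>The lower bound on the integral is the upper bound for the weights
    \<open>- u\<close>.\<close>
  obtain K' L' where KL': "K' \<subseteq> J" "L' \<subseteq> J"
    "?S (\<lambda>i j. - u i j) \<le> (\<Sum>i\<in>K'. \<Sum>j\<in>L'. - u i j * m i * m j)"
    using bilinear_vertex_bound[OF J(1), where a="\<lambda>i. measure M (T \<inter> fiber M \<sigma> i)" and b="\<lambda>i. measure M (U \<inter> fiber M \<sigma> i)" and m=m and u="\<lambda>i j. - u i j"] box TU by blast
  have "?S u \<le> cut_norm M' (step_fun u \<tau>)"
    using vertex[OF KL(1,2)] KL(3) by linarith
  moreover have "- ?S u \<le> cut_norm M' (step_fun u \<tau>)"
    using vertex[OF KL'(1,2)] KL'(3) by (simp add: sum_negf)
  ultimately show "\<bar>rect_int M (step_fun u \<sigma>) T U\<bar> \<le> cut_norm M' (step_fun u \<tau>)"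
    by (subst rect_int_step_fun[OF M \<sigma> J u TU]) (simp_all add: abs_le_iff)
qed

section \<open>Density of step functions\<close>

text \<open>Lists turn sums of such functions into concatenations, and allow the rectangles to be
  absorbed into a labelling one at a time.\<close>

definition rect_sum :: "(real \<times> 'a set \<times> 'a set) list \<Rightarrow> 'a \<times> 'a \<Rightarrow> real" where
  "rect_sum L z = (\<Sum>(c, A, B)\<leftarrow>L. c * indicator (A \<times> B) z)"

definition finite_rects :: "'a measure \<Rightarrow> (real \<times> 'a set \<times> 'a set) list \<Rightarrow> bool" where
  "finite_rects M L \<longleftrightarrow> (\<forall>(c, A, B)\<in>set L.
     A \<in> sets M \<and> B \<in> sets M \<and> emeasure M A < \<infinity> \<and> emeasure M B < \<infinity>)"

text \<open>The \<open>L^1\<close> closure of the linear combinations of rectangles with sides of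
  finite mass; it turns out to be all of \<open>L^1\<close>.\<close>

definition rect_approx :: "'a measure \<Rightarrow> ('a \<times> 'a \<Rightarrow> real) \<Rightarrow> bool" where
  "rect_approx M f \<longleftrightarrow> integrable (sq M) f \<and>
     (\<forall>e>0. \<exists>L. finite_rects M L \<and> (LINT z|sq M. \<bar>f z - rect_sum L z\<bar>) \<le> e)"

lemma rect_sum_simps [simp]:
  "rect_sum [] z = 0" "rect_sum ((c, A, B) # L) z = c * indicator (A \<times> B) z + rect_sum L z"
  by (simp_all add: rect_sum_def)

lemma rect_sum_Nil [simp]: "rect_sum [] = (\<lambda>z. 0)"
  by (simp add: fun_eq_iff)

lemma rect_sum_append: "rect_sum (L @ L') z = rect_sum L z + rect_sum L' z"
  by (simp add: rect_sum_def)

lemma rect_sum_scale: "rect_sum (map (\<lambda>(c, A, B). (a * c, A, B)) L) z = a * rect_sum L z"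
  by (induction L) (auto simp: algebra_simps)

context
  fixes M :: "'a measure"
  assumes M: "sigma_finite_measure M"
begin

interpretation sigma_finite_measure M by (rule M)

lemma finite_rect_integrable:
  assumes "A \<in> sets M" "B \<in> sets M" "emeasure M A < \<infinity>" "emeasure M B < \<infinity>"
  shows "integrable (sq M) (indicat_real (A \<times> B))"
  using assms by (intro integrable_real_indicator) (auto simp: emeasure_pair_measure_Times ennreal_mult_less_top)

lemma rect_sum_integrable: "finite_rects M L \<Longrightarrow> integrable (sq M) (rect_sum L)"
proof (induction L)
  case (Cons a L)
  obtain c A B where a: "a = (c, A, B)" by (cases a)
  have "integrable (sq M) (\<lambda>z. c * indicator (A \<times> B) z + rect_sum L z)"
    using Cons unfolding a finite_rects_def
    by (intro Bochner_Integration.integrable_add integrable_mult_right finite_rect_integrable) auto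
  then show ?case by (simp add: a)
qed simp

lemma rect_approx_add:
  assumes "rect_approx M f" "rect_approx M g"
  shows "rect_approx M (\<lambda>z. f z + g z)"
  unfolding rect_approx_def
proof (intro conjI allI impI)
  have int: "integrable (sq M) f" "integrable (sq M) g"
    using assms by (auto simp: rect_approx_def)
  then show "integrable (sq M) (\<lambda>z. f z + g z)" by simp
  fix e :: real assume "e > 0"
  then have e: "e / 2 > 0" by simp
  obtain L L' where L: "finite_rects M L" "finite_rects M L'"
    "(LINT z|sq M. \<bar>f z - rect_sum L z\<bar>) \<le> e / 2" "(LINT z|sq M. \<bar>g z - rect_sum L' z\<bar>) \<le> e / 2"
    using assms e unfolding rect_approx_def by meson
  have "(LINT z|sq M. \<bar>f z + g z - rect_sum (L @ L') z\<bar>)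
    \<le> (LINT z|sq M. \<bar>f z - rect_sum L z\<bar> + \<bar>g z - rect_sum L' z\<bar>)"
    by (rule integral_mono)
       (use int rect_sum_integrable[OF L(1)] rect_sum_integrable[OF L(2)] in \<open>auto simp: rect_sum_append\<close>)
  also have "\<dots> = (LINT z|sq M. \<bar>f z - rect_sum L z\<bar>) + (LINT z|sq M. \<bar>g z - rect_sum L' z\<bar>)"
    using int L(1,2) by (intro Bochner_Integration.integral_add) (auto intro!: rect_sum_integrable)
  finally have "(LINT z|sq M. \<bar>f z + g z - rect_sum (L @ L') z\<bar>) \<le> e" using L(3,4) by simp
  moreover have "finite_rects M (L @ L')" using L by (auto simp: finite_rects_def)
  ultimately show "\<exists>L. finite_rects M L \<and> (LINT z|sq M. \<bar>f z + g z - rect_sum L z\<bar>) \<le> e" by blast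
qed

lemma rect_approx_scale:
  assumes "rect_approx M f"
  shows "rect_approx M (\<lambda>z. a * f z)"
  unfolding rect_approx_def
proof (intro conjI allI impI)
  show "integrable (sq M) (\<lambda>z. a * f z)" using assms by (simp add: rect_approx_def)
  fix e :: real assume "e > 0"
  then have "e / (\<bar>a\<bar> + 1) > 0" by simp
  then obtain L where L: "finite_rects M L" "(LINT z|sq M. \<bar>f z - rect_sum L z\<bar>) \<le> e / (\<bar>a\<bar> + 1)"
    using assms unfolding rect_approx_def by meson
  let ?L = "map (\<lambda>(c, A, B). (a * c, A, B)) L"
  have "(LINT z|sq M. \<bar>a * f z - rect_sum ?L z\<bar>) = (LINT z|sq M. \<bar>a\<bar> * \<bar>f z - rect_sum L z\<bar>)"
    by (simp only: rect_sum_scale abs_mult[symmetric] right_diff_distrib)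
  also have "\<dots> = \<bar>a\<bar> * (LINT z|sq M. \<bar>f z - rect_sum L z\<bar>)" by simp
  also have "\<dots> \<le> \<bar>a\<bar> * (e / (\<bar>a\<bar> + 1))" using L(2) by (intro mult_left_mono) auto
  also have "\<dots> \<le> e" using \<open>e > 0\<close> by (simp add: field_simps)
  finally have "(LINT z|sq M. \<bar>a * f z - rect_sum ?L z\<bar>) \<le> e" .
  moreover have "finite_rects M ?L" using L(1) by (fastforce simp: finite_rects_def)
  ultimately show "\<exists>L. finite_rects M L \<and> (LINT z|sq M. \<bar>a * f z - rect_sum L z\<bar>) \<le> e" by blast
qed

lemma rect_approx_diff: "rect_approx M f \<Longrightarrow> rect_approx M g \<Longrightarrow> rect_approx M (\<lambda>z. f z - g z)"
  using rect_approx_add[OF _ rect_approx_scale[of g "-1"], of f] by simp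

lemma rect_approx_sum:
  "(\<And>i. i \<in> I \<Longrightarrow> rect_approx M (f i)) \<Longrightarrow> rect_approx M (\<lambda>z. \<Sum>i\<in>I. f i z)"
proof (induction I rule: infinite_finite_induct)
  case (insert i I)
  then show ?case using rect_approx_add[of "f i" "\<lambda>z. \<Sum>i\<in>I. f i z"] by simp
qed (auto simp: rect_approx_def finite_rects_def intro!: exI[of _ "[]"])

text \<open>Dominated convergence makes the class closed under dominated pointwise limits. This one
  closure property serves countable disjoint unions, exhaustion by sets of finite mass, and limits
  of simple functions.\<close>

lemma rect_approx_lim:
  assumes s: "\<And>i. rect_approx M (s i)"
    and lim: "\<And>z. z \<in> space (sq M) \<Longrightarrow> (\<lambda>i. s i z) \<longlonglongrightarrow> f z"
    and dom: "\<And>i z. z \<in> space (sq M) \<Longrightarrow> \<bar>s i z\<bar> \<le> g z" and g: "integrable (sq M) g"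
  shows "rect_approx M f"
  unfolding rect_approx_def
proof (intro conjI allI impI)
  have sm: "s i \<in> borel_measurable (sq M)" for i
    using s[of i] by (auto simp: rect_approx_def)
  have fm: "f \<in> borel_measurable (sq M)"
    by (rule borel_measurable_LIMSEQ_real[OF lim sm])
  have fd: "\<bar>f z\<bar> \<le> g z" if "z \<in> space (sq M)" for z
    using that by (intro LIMSEQ_le_const2[OF tendsto_rabs[OF lim]]) (auto intro: dom)
  show fi: "integrable (sq M) f"
    using fd by (intro Bochner_Integration.integrable_bound[OF g fm]) (auto intro!: AE_I2 order_trans[OF fd])
  have "(\<lambda>i. LINT z|sq M. \<bar>f z - s i z\<bar>) \<longlonglongrightarrow> (LINT z|sq M. 0)"
  proof (rule integral_dominated_convergence[where w="\<lambda>z. 2 * g z"])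
    show "AE z in sq M. (\<lambda>i. \<bar>f z - s i z\<bar>) \<longlonglongrightarrow> 0"
    proof (rule AE_I2)
      fix z assume "z \<in> space (sq M)"
      from tendsto_rabs[OF tendsto_diff[OF tendsto_const lim[OF this], of "f z"]]
      show "(\<lambda>i. \<bar>f z - s i z\<bar>) \<longlonglongrightarrow> 0" by simp
    qed
    show "AE z in sq M. norm \<bar>f z - s i z\<bar> \<le> 2 * g z" for i
    proof (rule AE_I2)
      fix z assume "z \<in> space (sq M)"
      from fd[OF this] dom[OF this, of i] show "norm \<bar>f z - s i z\<bar> \<le> 2 * g z" by simp
    qed
  qed (use fm sm g in auto)
  then have lim0: "(\<lambda>i. LINT z|sq M. \<bar>f z - s i z\<bar>) \<longlonglongrightarrow> 0" by simp
  fix e :: real assume "e > 0"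
  then have e: "e / 2 > 0" by simp
  obtain i where i: "(LINT z|sq M. \<bar>f z - s i z\<bar>) < e / 2"
    using order_tendstoD(2)[OF lim0 e] eventually_happens'[OF sequentially_bot] by blast
  obtain L where L: "finite_rects M L" "(LINT z|sq M. \<bar>s i z - rect_sum L z\<bar>) \<le> e / 2"
    using s[of i] e unfolding rect_approx_def by meson
  have si: "integrable (sq M) (s i)" using s[of i] by (simp add: rect_approx_def)
  have "(LINT z|sq M. \<bar>f z - rect_sum L z\<bar>)
    \<le> (LINT z|sq M. \<bar>f z - s i z\<bar> + \<bar>s i z - rect_sum L z\<bar>)"
    by (rule integral_mono) (use fi si rect_sum_integrable[OF L(1)] in auto)
  also have "\<dots> = (LINT z|sq M. \<bar>f z - s i z\<bar>) + (LINT z|sq M. \<bar>s i z - rect_sum L z\<bar>)"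
    by (rule Bochner_Integration.integral_add) (use fi si rect_sum_integrable[OF L(1)] in auto)
  finally show "\<exists>L. finite_rects M L \<and> (LINT z|sq M. \<bar>f z - rect_sum L z\<bar>) \<le> e"
    using L i by (intro exI[of _ L]) auto
qed

lemma rect_approx_finite_rect:
  assumes "A \<in> sets M" "B \<in> sets M" "emeasure M A < \<infinity>" "emeasure M B < \<infinity>"
  shows "rect_approx M (indicator (A \<times> B))"
  unfolding rect_approx_def
  by (intro conjI finite_rect_integrable allI impI exI[of _ "[(1, A, B)]"])
     (use assms in \<open>auto simp: finite_rects_def\<close>)

text \<open>Dynkin's pi-lambda argument, starting from the rectangles. Complements are formed inside
  \<open>D \<times> D\<close>, whose finite mass keeps their indicators integrable.\<close>

lemma rect_approx_indicator_box:
  assumes D: "D \<in> sets M" "emeasure M D < \<infinity>" and E: "E \<in> sets (sq M)"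
  shows "rect_approx M (indicator (E \<inter> D \<times> D))"
proof -
  have DD: "rect_approx M (indicator (D \<times> D))" by (rule rect_approx_finite_rect) (use D in auto)
  have E': "E \<in> sigma_sets (space M \<times> space M) {a \<times> b |a b. a \<in> sets M \<and> b \<in> sets M}"
    using E by (simp add: sets_pair_measure)
  show ?thesis
  proof (rule sigma_sets_induct_disjoint[OF Int_stable_pair_measure_generator pair_measure_closed E'])
    show "rect_approx M (indicator (A \<inter> D \<times> D))" if A: "A \<in> {a \<times> b |a b. a \<in> sets M \<and> b \<in> sets M}" for A
    proof -
      obtain a b where ab: "A = a \<times> b" "a \<in> sets M" "b \<in> sets M" using A by blast
      have "A \<inter> D \<times> D = (a \<inter> D) \<times> (b \<inter> D)" using ab by auto
      moreover have "emeasure M (a \<inter> D) < \<infinity>" "emeasure M (b \<inter> D) < \<infinity>"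
        using D emeasure_mono[of "a \<inter> D" D M] emeasure_mono[of "b \<inter> D" D M] by (auto intro: le_less_trans)
      ultimately show ?thesis using rect_approx_finite_rect[of "a \<inter> D" "b \<inter> D"] ab D by simp
    qed
    show "rect_approx M (indicator ({} \<inter> D \<times> D))"
      using rect_approx_sum[of "{}"] by (simp add: indicator_def[abs_def])
    show "rect_approx M (indicator ((space M \<times> space M - A) \<inter> D \<times> D))"
      if "rect_approx M (indicator (A \<inter> D \<times> D))" for A
    proof -
      have "(\<lambda>z. indicator (D \<times> D) z - indicator (A \<inter> D \<times> D) z) =
         indicat_real ((space M \<times> space M - A) \<inter> D \<times> D)"
        using sets.sets_into_space[OF D(1)] by (auto simp: indicator_def fun_eq_iff)
      then show ?thesis using rect_approx_diff[OF DD that] by simp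
    qed
    show "rect_approx M (indicator (\<Union>(range A) \<inter> D \<times> D))"
      if disj: "disjoint_family A" and A: "\<And>i. rect_approx M (indicator (A i \<inter> D \<times> D))" for A :: "nat \<Rightarrow> ('a \<times> 'a) set"
    proof -
      define F where "F i = A i \<inter> D \<times> D" for i
      have F: "disjoint_family F" using disj by (auto simp: disjoint_family_on_def F_def)
      have "(\<lambda>n. \<Sum>i<n. indicat_real (F i) z) \<longlonglongrightarrow> indicator (\<Union>(range F)) z" for z
        using indicator_sums[of F z] F unfolding sums_def disjoint_family_on_def by blast
      \<comment> \<open>The partial sums are indicators of finite disjoint unions, hence dominated
        by the indicator of the box.\<close>
      moreover have bound: "\<bar>\<Sum>i<n. indicat_real (F i) z\<bar> \<le> indicator (D \<times> D) z" for z n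
      proof -
        have "(\<Sum>i<n. indicat_real (F i) z) = indicator (\<Union>i<n. F i) z"
          using F by (intro indicator_UN_disjoint[symmetric]) (auto simp: disjoint_family_on_def)
        then show ?thesis by (auto simp: indicator_def F_def)
      qed
      ultimately have lim: "(\<lambda>n. \<Sum>i<n. indicat_real (F i) z) \<longlonglongrightarrow> indicator (\<Union>(range F)) z"
        and bound: "\<bar>\<Sum>i<n. indicat_real (F i) z\<bar> \<le> indicator (D \<times> D) z" for n z by blast+
      have sums: "rect_approx M (\<lambda>z. \<Sum>i<n. indicat_real (F i) z)" for n
        by (rule rect_approx_sum) (use A in \<open>simp add: F_def\<close>)
      have "integrable (sq M) (indicat_real (D \<times> D))" using DD by (simp add: rect_approx_def)
      from rect_approx_lim[OF sums lim bound this]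
      have "rect_approx M (indicator (\<Union>(range F)))" .
      moreover have "\<Union>(range F) = \<Union>(range A) \<inter> D \<times> D" by (auto simp: F_def)
      ultimately show ?thesis by simp
    qed
  qed
qed

lemma rect_approx_indicator:
  assumes E: "E \<in> sets (sq M)" "emeasure (sq M) E < \<infinity>"
  shows "rect_approx M (indicator E)"
proof -
  obtain D :: "nat \<Rightarrow> 'a set" where D: "range D \<subseteq> sets M" "(\<Union>i. D i) = space M" "\<And>i. emeasure M (D i) \<noteq> \<infinity>" "incseq D"
    using sigma_finite_incseq by blast
  show ?thesis
  proof (rule rect_approx_lim[where s="\<lambda>i. indicator (E \<inter> D i \<times> D i)" and g="indicator E"])
    show "rect_approx M (indicator (E \<inter> D i \<times> D i))" for i
      using D E by (intro rect_approx_indicator_box) (auto simp: top.not_eq_extremum)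
    show "integrable (sq M) (indicat_real E)" using E by (intro integrable_real_indicator)
    show "\<bar>indicator (E \<inter> D i \<times> D i) z\<bar> \<le> indicat_real E z" for i z by (auto simp: indicator_def)
    fix z assume "z \<in> space (sq M)"
    then have "fst z \<in> (\<Union>i. D i)" "snd z \<in> (\<Union>i. D i)"
      using D(2) by (auto simp: space_pair_measure)
    then obtain i j where ij: "fst z \<in> D i" "snd z \<in> D j" by blast
    have "eventually (\<lambda>n. indicat_real (E \<inter> D n \<times> D n) z = indicator E z) sequentially"
      unfolding eventually_sequentially
      by (rule exI[of _ "max i j"])
         (use ij incseqD[OF D(4), of i] incseqD[OF D(4), of j] in \<open>auto simp: indicator_def mem_Times_iff subset_iff\<close>)
    then show "(\<lambda>n. indicat_real (E \<inter> D n \<times> D n) z) \<longlonglongrightarrow> indicator E z" by (rule tendsto_eventually)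
  qed
qed

lemma integrable_rect_approx:
  assumes "integrable (sq M) f"
  shows "rect_approx M f"
  using assms
proof (induction rule: integrable_induct)
  case (base A c)
  then show ?case using rect_approx_scale[OF rect_approx_indicator, of A c] by (simp add: mult.commute)
next
  case (add f g) then show ?case by (intro rect_approx_add)
next
  case (lim f s)
  show ?case
  proof (rule rect_approx_lim[OF lim.IH lim.hyps(2)])
    show "integrable (sq M) (\<lambda>z. 2 * \<bar>f z\<bar>)" using lim.hyps(4) by simp
    show "\<bar>s i z\<bar> \<le> 2 * \<bar>f z\<bar>" if "z \<in> space (sq M)" for i z
      using lim.hyps(3)[OF that, of i] by simp
  qed
qed

end

text \<open>Label 0 is the background and may have infinite mass; all other labels together have
  finite mass. The weights in \<open>label_weights\<close> vanish on the background, which makes the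
  step function integrable.\<close>

definition finite_labelling :: "'a measure \<Rightarrow> ('a \<Rightarrow> nat) \<Rightarrow> nat \<Rightarrow> bool" where
  "finite_labelling M \<sigma> K \<longleftrightarrow> \<sigma> \<in> measurable M (count_space UNIV) \<and> (\<forall>x\<in>space M. \<sigma> x \<le> K)
     \<and> emeasure M {x \<in> space M. \<sigma> x \<noteq> 0} < \<infinity>"

definition label_weights :: "nat \<Rightarrow> (nat \<Rightarrow> nat \<Rightarrow> real) \<Rightarrow> bool" where
  "label_weights K u \<longleftrightarrow> (\<forall>i j. u i j \<noteq> 0 \<longrightarrow> i \<in> {1..K} \<and> j \<in> {1..K})"

lemma finite_labelling_fiber:
  assumes "finite_labelling M \<sigma> K" "i \<noteq> 0"
  shows "emeasure M (fiber M \<sigma> i) < \<infinity>"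
proof -
  have "{x \<in> space M. \<sigma> x \<noteq> 0} = \<sigma> -` (- {0}) \<inter> space M" by auto
  then have "{x \<in> space M. \<sigma> x \<noteq> 0} \<in> sets M"
    using assms by (auto simp: finite_labelling_def intro: measurable_sets)
  then have "emeasure M (fiber M \<sigma> i) \<le> emeasure M {x \<in> space M. \<sigma> x \<noteq> 0}"
    using assms(2) by (intro emeasure_mono) auto
  then show ?thesis using assms(1) by (auto simp: finite_labelling_def)
qed

text \<open>Each rectangle is absorbed by splitting every label in four, according to membership in
  its two sides. Label 0 stays reserved for points outside all sides, so the other labels cover a
  set of finite mass.\<close>

lemma rect_sum_labelling:
  assumes "finite_rects M L"
  shows "\<exists>\<sigma> K u. finite_labelling M \<sigma> K \<and> (\<forall>i. u i 0 = 0 \<and> u 0 i = 0) \<and> rect_sum L = (\<lambda>z. u (\<sigma> (fst z)) (\<sigma> (snd z)))"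
  using assms
proof (induction L)
  case Nil
  show ?case
    by (rule exI[of _ "\<lambda>_. 0"], rule exI[of _ 0], rule exI[of _ "\<lambda>_ _. 0"]) (auto simp: finite_labelling_def)
next
  case (Cons a L)
  obtain c A B where a: "a = (c, A, B)" by (cases a)
  have AB: "A \<in> sets M" "B \<in> sets M" "emeasure M A < \<infinity>" "emeasure M B < \<infinity>" "finite_rects M L"
    using Cons.prems by (auto simp: finite_rects_def a)
  obtain \<sigma> K u where \<sigma>: "finite_labelling M \<sigma> K" and u: "\<And>i. u i 0 = 0" "\<And>i. u 0 i = 0"
    and eq: "rect_sum L = (\<lambda>z. u (\<sigma> (fst z)) (\<sigma> (snd z)))"
    using Cons.IH[OF AB(5)] by blast
  \<comment> \<open>Two binary digits are appended to the old label: the digit of weight 2 records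
    membership in \<open>A\<close>, the last one membership in \<open>B\<close>. \<open>v\<close>
    reads the old label as the quotient by 4 and the digits as parities.\<close>
  define \<tau> where "\<tau> x = 4 * \<sigma> x + (if x \<in> A then 2 else 0) + (if x \<in> B then 1 else 0)" for x
  define v where "v i j = u (i div 4) (j div 4) + (if odd (i div 2) \<and> odd j then c else 0)" for i j
  have m\<sigma>: "\<sigma> \<in> measurable M (count_space UNIV)" using \<sigma> by (simp add: finite_labelling_def)
  have "(\<lambda>x. (\<lambda>n. 4 * n + k) (\<sigma> x)) \<in> measurable M (count_space UNIV)" for k :: nat
    by (rule measurable_compose[OF m\<sigma>]) simp
  note [measurable] = this[simplified] AB(1,2)
  have "\<tau> = (\<lambda>x. if x \<in> A then if x \<in> B then 4 * \<sigma> x + 3 else 4 * \<sigma> x + 2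
      else if x \<in> B then 4 * \<sigma> x + 1 else 4 * \<sigma> x + 0)"
    by (auto simp: \<tau>_def fun_eq_iff)
  then have m\<tau>: "\<tau> \<in> measurable M (count_space UNIV)" by (simp only:) measurable
  have "{x \<in> space M. \<tau> x \<noteq> 0} = {x \<in> space M. \<sigma> x \<noteq> 0} \<union> A \<union> B"
    using sets.sets_into_space[OF AB(1)] sets.sets_into_space[OF AB(2)] by (auto simp: \<tau>_def)
  moreover have "{x \<in> space M. \<sigma> x \<noteq> 0} \<in> sets M"
  proof -
    have "{x \<in> space M. \<sigma> x \<noteq> 0} = \<sigma> -` (- {0}) \<inter> space M" by auto
    then show ?thesis using m\<sigma> by (auto intro: measurable_sets)
  qed
  moreover have "emeasure M {x \<in> space M. \<sigma> x \<noteq> 0} < \<infinity>" using \<sigma> by (simp add: finite_labelling_def)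
  ultimately have "emeasure M {x \<in> space M. \<tau> x \<noteq> 0} \<le> emeasure M {x \<in> space M. \<sigma> x \<noteq> 0} + emeasure M A + emeasure M B"
    using AB emeasure_subadditive[of "{x \<in> space M. \<sigma> x \<noteq> 0} \<union> A" M B] emeasure_subadditive[of "{x \<in> space M. \<sigma> x \<noteq> 0}" M A]
    by (auto intro: order_trans add_right_mono)
  also have "\<dots> < \<infinity>" using AB \<sigma> by (simp add: finite_labelling_def)
  finally have fin: "emeasure M {x \<in> space M. \<tau> x \<noteq> 0} < \<infinity>" .
  have bd: "\<tau> x \<le> 4 * K + 3" if "x \<in> space M" for x
  proof -
    have "\<sigma> x \<le> K" using \<sigma> that by (auto simp: finite_labelling_def)
    then show ?thesis by (simp add: \<tau>_def)
  qed
  have d: "\<tau> x div 4 = \<sigma> x" "odd (\<tau> x div 2) \<longleftrightarrow> x \<in> A" "odd (\<tau> x) \<longleftrightarrow> x \<in> B" for x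
    unfolding \<tau>_def by auto
  have "rect_sum (a # L) z = v (\<tau> (fst z)) (\<tau> (snd z))" for z
    by (simp add: a eq v_def d indicator_def mem_Times_iff)
  then have "rect_sum (a # L) = (\<lambda>z. v (\<tau> (fst z)) (\<tau> (snd z)))" ..
  moreover have "\<forall>i. v i 0 = 0 \<and> v 0 i = 0" by (simp add: v_def u)
  moreover have "finite_labelling M \<tau> (4 * K + 3)" using m\<tau> bd fin by (simp add: finite_labelling_def)
  ultimately show ?case by blast
qed

lemma step_fun_approx:
  assumes M: "sigma_finite_measure M" and W: "gintegrable M W" and e: "e > 0"
  obtains \<sigma> K u where "finite_labelling M \<sigma> K" "label_weights K u"
    "L1_norm M (\<lambda>x y. W x y - u (\<sigma> x) (\<sigma> y)) \<le> e"
proof -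
  obtain L where L: "finite_rects M L" "(LINT z|sq M. \<bar>W (fst z) (snd z) - rect_sum L z\<bar>) \<le> e"
    using integrable_rect_approx[OF M W] e unfolding rect_approx_def by blast
  obtain \<sigma> K u where \<sigma>: "finite_labelling M \<sigma> K" and u: "\<And>i. u i 0 = 0" "\<And>i. u 0 i = 0"
    and eq: "rect_sum L = (\<lambda>z. u (\<sigma> (fst z)) (\<sigma> (snd z)))"
    using rect_sum_labelling[OF L(1)] by blast
  \<comment> \<open>No point of \<open>M\<close> has a label above \<open>K\<close>, so cutting the
    weights off there does not change the step function.\<close>
  define v where "v i j = (if i \<le> K \<and> j \<le> K then u i j else 0)" for i j
  have "label_weights K v"
    unfolding label_weights_def v_def using u by (metis atLeastAtMost_iff less_one not_less)
  moreover have "L1_norm M (\<lambda>x y. W x y - v (\<sigma> x) (\<sigma> y)) = (LINT z|sq M. \<bar>W (fst z) (snd z) - rect_sum L z\<bar>)"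
    unfolding L1_norm_def
    by (rule Bochner_Integration.integral_cong) (use \<sigma> in \<open>auto simp: eq v_def finite_labelling_def space_pair_measure\<close>)
  ultimately show ?thesis using that[OF \<sigma>, of v] L(2) by simp
qed

lemma label_weights_integrable:
  assumes M: "sigma_finite_measure M" and \<sigma>: "finite_labelling M \<sigma> K" and u: "label_weights K' u"
  shows "gintegrable M (step_fun u \<sigma>)"
  by (rule step_fun_integrable[OF M, of _ "{1..K'}"])
     (use \<sigma> u finite_labelling_fiber[OF \<sigma>] in \<open>auto simp: finite_labelling_def label_weights_def\<close>)

section \<open>Almost sure limits of convex combinations\<close>

text \<open>\<open>sqrt (1 + x\<^sup>2)\<close> is the length of the vector \<open>(1, x)\<close>, and the gap in the triangle inequality
  for two such vectors bounds the distance of their directions.\<close>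

definition slope :: "real \<Rightarrow> real" where
  "slope x = x / sqrt (1 + x\<^sup>2)"

lemma slope_gap:
  "(slope x - slope y)\<^sup>2 \<le> 8 * ((sqrt (1 + x\<^sup>2) + sqrt (1 + y\<^sup>2)) / 2 - sqrt (1 + ((x + y) / 2)\<^sup>2))"
proof -
  \<comment> \<open>\<open>A\<close> and \<open>B\<close> are the lengths of \<open>(1, x)\<close>
    and \<open>(1, y)\<close>, \<open>C\<close> is that of their sum, and \<open>1 + x * y\<close>
    is their inner product; \<open>dot\<close> is the Cauchy-Schwarz inequality.\<close>
  define A B C where "A = sqrt (1 + x\<^sup>2)" and "B = sqrt (1 + y\<^sup>2)" and "C = sqrt (4 + (x + y)\<^sup>2)"
  have sq: "A\<^sup>2 = 1 + x\<^sup>2" "B\<^sup>2 = 1 + y\<^sup>2" "C\<^sup>2 = 4 + (x + y)\<^sup>2"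
    by (auto simp: A_def B_def C_def intro!: real_sqrt_pow2 add_nonneg_nonneg)
  have ge: "1 \<le> A" "1 \<le> B" "0 \<le> C" by (auto simp: A_def B_def C_def)
  have dot: "(1 + x * y)\<^sup>2 \<le> (A * B)\<^sup>2"
  proof -
    have "(A * B)\<^sup>2 - (1 + x * y)\<^sup>2 = (x - y)\<^sup>2"
      unfolding power_mult_distrib sq by (simp add: power2_eq_square algebra_simps)
    then show ?thesis by (metis diff_ge_0_iff_ge zero_le_power2)
  qed
  have dot': "1 + x * y \<le> A * B"
    by (rule power2_le_imp_le[OF dot]) (use ge in simp)
  have gap: "(A + B)\<^sup>2 - C\<^sup>2 = 2 * (A * B - (1 + x * y))"
    by (simp add: sq power2_sum) (simp add: power2_eq_square algebra_simps)?
  have CAB: "C \<le> A + B"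
  proof (rule power2_le_imp_le)
    have "0 \<le> (A + B)\<^sup>2 - C\<^sup>2" unfolding gap using dot' by simp
    then show "C\<^sup>2 \<le> (A + B)\<^sup>2" by simp
  qed (use ge in simp)
  have "A * B * (slope x - slope y)\<^sup>2 \<le> 2 * (A * B - (1 + x * y))"
  proof -
    have "(slope x - slope y)\<^sup>2 = x\<^sup>2 / A\<^sup>2 + y\<^sup>2 / B\<^sup>2 - 2 * (x * y) / (A * B)"
      unfolding slope_def A_def[symmetric] B_def[symmetric]
      by (simp add: power2_diff power_divide)
    also have "\<dots> = 2 - (1 / A\<^sup>2 + 1 / B\<^sup>2 + 2 * (x * y) / (A * B))"
    proof -
      have "x\<^sup>2 / A\<^sup>2 = 1 - 1 / A\<^sup>2" "y\<^sup>2 / B\<^sup>2 = 1 - 1 / B\<^sup>2"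
      proof -
        have "x\<^sup>2 = A\<^sup>2 - 1" "y\<^sup>2 = B\<^sup>2 - 1" using sq by auto
        then show "x\<^sup>2 / A\<^sup>2 = 1 - 1 / A\<^sup>2" "y\<^sup>2 / B\<^sup>2 = 1 - 1 / B\<^sup>2"
          using ge by (simp_all add: diff_divide_distrib)
      qed
      then show ?thesis by simp
    qed
    also have "\<dots> \<le> 2 - (2 / (A * B) + 2 * (x * y) / (A * B))"
    proof -
      have "0 \<le> (1 / A - 1 / B)\<^sup>2" by simp
      then show ?thesis by (simp add: power2_diff power_divide)
    qed
    finally have "A * B * (slope x - slope y)\<^sup>2 \<le> A * B * (2 - (2 / (A * B) + 2 * (x * y) / (A * B)))"
      using ge by (intro mult_left_mono) auto
    also have "\<dots> = 2 * (A * B - (1 + x * y))" using ge by (simp add: field_simps)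
    finally show ?thesis .
  qed
  also have "\<dots> = (A + B - C) * (A + B + C)" unfolding gap[symmetric] by (simp add: power2_eq_square algebra_simps)
  also have "\<dots> \<le> (A + B - C) * (2 * (A + B))" using CAB by (intro mult_left_mono) auto
  \<comment> \<open>Lengths of at least 1 give \<open>A + B \<le> 2 * (A * B)\<close>, so that
    \<open>A * B\<close> can be cancelled. What remains is four times \<open>A + B - C\<close>,
    which is eight times the convexity gap at the midpoint.\<close>
  also have "\<dots> \<le> (A + B - C) * (4 * (A * B))"
  proof (intro mult_left_mono)
    have "0 \<le> A * (B - 1) + B * (A - 1)" using ge by (intro add_nonneg_nonneg mult_nonneg_nonneg) auto
    then show "2 * (A + B) \<le> 4 * (A * B)" by (simp add: algebra_simps)
  qed (use CAB in auto)
  finally have "A * B * (slope x - slope y)\<^sup>2 \<le> A * B * (4 * (A + B - C))" by (simp add: algebra_simps)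
  then have "(slope x - slope y)\<^sup>2 \<le> 4 * (A + B - C)"
    using ge by (subst (asm) mult_le_cancel_left_pos) auto
  moreover have "sqrt (1 + ((x + y) / 2)\<^sup>2) = C / 2"
  proof -
    have "1 + ((x + y) / 2)\<^sup>2 = (4 + (x + y)\<^sup>2) / 2\<^sup>2" by (simp add: power_divide)
    then show ?thesis unfolding C_def by (simp only: real_sqrt_divide) simp
  qed
  moreover have "8 * ((A + B) / 2 - C / 2) = 4 * (A + B - C)" by (simp add: field_simps)
  ultimately show ?thesis unfolding A_def[symmetric] B_def[symmetric] by (simp only:)
qed

lemma slope_bound: "\<bar>slope x\<bar> < 1"
proof -
  have "\<bar>x\<bar> < sqrt (1 + x\<^sup>2)" by (rule real_less_rsqrt) simp
  then show ?thesis by (simp add: slope_def abs_divide add_pos_nonneg)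
qed

lemma slope_inverse: "x = slope x / sqrt (1 - (slope x)\<^sup>2)"
proof -
  have p: "0 < 1 + x\<^sup>2" by (simp add: add_pos_nonneg)
  have "1 - (slope x)\<^sup>2 = 1 / (1 + x\<^sup>2)"
    using p by (simp add: slope_def power_divide field_simps)
  then have "sqrt (1 - (slope x)\<^sup>2) = 1 / sqrt (1 + x\<^sup>2)" by (simp add: real_sqrt_divide)
  then show ?thesis using p by (simp add: slope_def)
qed

lemma slope_mono: "slope x \<le> slope y" if "x \<le> y"
proof (cases "0 \<le> x")
  case True
  have "x * sqrt (1 + y\<^sup>2) \<le> y * sqrt (1 + x\<^sup>2)"
  proof (rule power2_le_imp_le)
    have "x\<^sup>2 \<le> y\<^sup>2" using True that by (simp add: power_mono)
    then show "(x * sqrt (1 + y\<^sup>2))\<^sup>2 \<le> (y * sqrt (1 + x\<^sup>2))\<^sup>2"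
      by (simp add: power_mult_distrib algebra_simps)
  qed (use True that in auto)
  then show ?thesis by (simp add: slope_def field_simps add_pos_nonneg)
next
  case False
  show ?thesis
  proof (cases "y \<le> 0")
    case True
    have "(- y) * sqrt (1 + x\<^sup>2) \<le> (- x) * sqrt (1 + y\<^sup>2)"
    proof (rule power2_le_imp_le)
      have "y\<^sup>2 \<le> x\<^sup>2" using True that by (metis abs_le_square_iff abs_minus_cancel abs_of_nonneg neg_0_le_iff_le neg_le_iff_le order_trans)
      then show "((- y) * sqrt (1 + x\<^sup>2))\<^sup>2 \<le> ((- x) * sqrt (1 + y\<^sup>2))\<^sup>2"
        by (simp add: power_mult_distrib algebra_simps)
    qed (use True that in \<open>auto simp: mult_nonpos_nonneg\<close>)
    then show ?thesis by (simp add: slope_def field_simps add_pos_nonneg)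
  next
    case False
    have "slope x \<le> 0" "0 \<le> slope y" using \<open>\<not> 0 \<le> x\<close> False
      by (auto simp: slope_def divide_nonpos_nonneg)
    then show ?thesis by simp
  qed
qed

text \<open>\<open>slope\<close> maps the line homeomorphically onto the open interval from -1 to 1,
  so the slopes converge to a point of the closed interval. Infinitely many values bounded by
  \<open>B\<close> keep that point away from the ends, and \<open>slope_inverse\<close> carries the
  convergence back.\<close>

lemma convergent_of_slope:
  assumes c: "convergent (\<lambda>n. slope (g n))" and b: "frequently (\<lambda>n. \<bar>g n\<bar> \<le> B) sequentially"
  shows "convergent g"
proof -
  obtain l where l: "(\<lambda>n. slope (g n)) \<longlonglongrightarrow> l" using c by (auto simp: convergent_def)
  have B0: "0 \<le> B" using frequently_ex[OF b] by (auto intro: order_trans[OF abs_ge_zero])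
  have neg: "slope (- x) = - slope x" for x by (simp add: slope_def)
  have sb: "\<bar>slope x\<bar> \<le> slope B" if "\<bar>x\<bar> \<le> B" for x
    using slope_mono[of x B] slope_mono[of "-B" x] that by (auto simp: neg abs_le_iff)
  have "\<bar>l\<bar> \<le> slope B"
  proof (rule ccontr)
    assume "\<not> ?thesis"
    then have "eventually (\<lambda>n. \<bar>slope (g n)\<bar> > slope B) sequentially"
      using order_tendstoD(1)[OF tendsto_rabs[OF l]] by auto
    then have "eventually (\<lambda>n. \<not> \<bar>g n\<bar> \<le> B) sequentially"
      by eventually_elim (use sb in force)
    with b show False by (simp add: frequently_def)
  qed
  then have "\<bar>l\<bar> < 1" using slope_bound[of B] by simp
  then have "l\<^sup>2 < 1" by (simp add: abs_square_less_1)
  then have "(\<lambda>n. slope (g n) / sqrt (1 - (slope (g n))\<^sup>2)) \<longlonglongrightarrow> l / sqrt (1 - l\<^sup>2)"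
    by (intro tendsto_intros l) auto
  then show ?thesis unfolding slope_inverse[symmetric] by (auto simp: convergent_def)
qed

text \<open>Midpoints generate enough convex combinations, and induction over the hull then asks
  only for midpoint convexity.\<close>

inductive_set midhull :: "('a \<Rightarrow> real) set \<Rightarrow> ('a \<Rightarrow> real) set" for S where
  base: "f \<in> S \<Longrightarrow> f \<in> midhull S"
| mid: "f \<in> midhull S \<Longrightarrow> g \<in> midhull S \<Longrightarrow> (\<lambda>x. (f x + g x) / 2) \<in> midhull S"

lemma midhull_mono: "S \<subseteq> S' \<Longrightarrow> midhull S \<subseteq> midhull S'"
proof
  fix f assume "f \<in> midhull S" "S \<subseteq> S'"
  then show "f \<in> midhull S'" by induction (auto intro: midhull.intros)
qed

text \<open>Komlos-type compactness: midpoint convex combinations of the tails that almost minimise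
  \<open>\<integral>sqrt (1 + g\<^sup>2) h\<close> have slopes that are Cauchy in \<open>L\<^sup>2(h)\<close>.\<close>

lemma komlos_midhull:
  fixes f :: "nat \<Rightarrow> 'a \<Rightarrow> real"
  assumes M: "sigma_finite_measure M" and f: "\<And>n. integrable M (f n)"
    and K: "\<And>n. (LINT x|M. \<bar>f n x\<bar>) \<le> K"
  shows "\<exists>g. (\<forall>k. g k \<in> midhull (f ` {k..})) \<and> (AE x in M. convergent (\<lambda>k. g k x))"
proof -
  interpret sigma_finite_measure M by (rule M)
  have hull_int: "integrable M g \<and> (LINT x|M. \<bar>g x\<bar>) \<le> K" if "g \<in> midhull (range f)" for g
    using that
  proof induction
    case (mid g g')
    have "(LINT x|M. \<bar>(g x + g' x) / 2\<bar>) \<le> (LINT x|M. \<bar>g x\<bar> / 2 + \<bar>g' x\<bar> / 2)"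
      by (rule integral_mono) (use mid in auto)
    also have "\<dots> = (LINT x|M. \<bar>g x\<bar>) / 2 + (LINT x|M. \<bar>g' x\<bar>) / 2"
      using mid by (subst Bochner_Integration.integral_add) auto
    finally show ?case using mid by auto
  qed (use f K in auto)
  \<comment> \<open>A positive integrable weight makes
    \<open>\<integral>sqrt (1 + g\<^sup>2) h\<close> finite even when the space has infinite mass.
    Capping the weight at 1 makes \<open>h x + \<bar>g x\<bar>\<close> a dominating
    function.\<close>
  obtain h0 :: "'a \<Rightarrow> ennreal" where h0: "h0 \<in> borel_measurable M" "integral\<^sup>N M h0 \<noteq> \<infinity>"
    "\<And>x. x \<in> space M \<Longrightarrow> 0 < h0 x \<and> h0 x < \<infinity>"
    using Ex_finite_integrable_function by blast
  define h where "h x = min 1 (enn2real (h0 x))" for x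
  have hm: "h \<in> borel_measurable M" unfolding h_def using h0(1) by measurable
  have hpos: "0 < h x" if "x \<in> space M" for x
    using h0(3)[OF that] by (simp add: h_def enn2real_positive_iff)
  have hb: "0 \<le> h x" "h x \<le> 1" for x by (auto simp: h_def)
  have h_le: "ennreal (h x) \<le> h0 x" if "x \<in> space M" for x
  proof -
    have "ennreal (h x) \<le> ennreal (enn2real (h0 x))" by (rule ennreal_leI) (simp add: h_def)
    then show ?thesis using h0(3)[OF that] by (simp only: ennreal_enn2real infinity_ennreal_def)
  qed
  have hint: "integrable M h"
  proof (rule integrableI_bounded[OF hm])
    have "(\<integral>\<^sup>+ x. ennreal (norm (h x)) \<partial>M) \<le> integral\<^sup>N M h0"
      by (rule nn_integral_mono) (use h0(3) hb h_le in auto)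
    then show "(\<integral>\<^sup>+ x. ennreal (norm (h x)) \<partial>M) < \<infinity>" using h0(2) by (auto simp: top.not_eq_extremum intro: le_less_trans)
  qed
  define phi where "phi x = sqrt (1 + x\<^sup>2)" for x :: real
  have phim [measurable]: "phi \<in> borel_measurable borel" unfolding phi_def by measurable
  have phib: "0 \<le> phi x" "phi x \<le> 1 + \<bar>x\<bar>" for x
    unfolding phi_def using sqrt_add_le_add_sqrt[of 1 "x\<^sup>2"] by auto
  have hphi: "integrable M (\<lambda>x. phi (g x) * h x)" if "integrable M g" for g
  proof (rule Bochner_Integration.integrable_bound)
    show "integrable M (\<lambda>x. h x + \<bar>g x\<bar>)" using hint that by auto
    show "(\<lambda>x. phi (g x) * h x) \<in> borel_measurable M" using that hm by measurable
    have "phi y * c \<le> c + \<bar>y\<bar>" if "0 \<le> c" "c \<le> 1" for y c :: real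
    proof -
      have "phi y * c \<le> (1 + \<bar>y\<bar>) * c" using phib that by (intro mult_right_mono) auto
      moreover have "\<bar>y\<bar> * c \<le> \<bar>y\<bar>" using that by (simp add: mult_left_le)
      ultimately show ?thesis by (simp add: algebra_simps)
    qed
    then show "AE x in M. norm (phi (g x) * h x) \<le> norm (h x + \<bar>g x\<bar>)"
      using hb phib by (intro AE_I2) (auto simp: abs_mult)
  qed
  define I where "I g = (LINT x|M. phi (g x) * h x)" for g
  define S where "S k = I ` midhull (f ` {k..})" for k
  have sub: "midhull (f ` {k..}) \<subseteq> midhull (range f)" for k by (rule midhull_mono) auto
  have I0: "0 \<le> I g" for g unfolding I_def using hb phib by (intro integral_nonneg_AE AE_I2) auto
  have bddS: "bdd_below (S k)" for k unfolding S_def using I0 by (intro bdd_belowI[of _ 0]) auto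
  have fk: "f k \<in> midhull (f ` {k..})" for k by (rule midhull.base) auto
  have neS: "S k \<noteq> {}" for k unfolding S_def using fk by auto
  \<comment> \<open>The hulls shrink with \<open>k\<close>, so the infima increase; the
    \<open>L^1\<close> bound \<open>K\<close> keeps them bounded.\<close>
  define m where "m k = Inf (S k)" for k
  have minc: "incseq m"
  proof (rule incseq_SucI)
    fix k show "m k \<le> m (Suc k)"
      unfolding m_def by (rule cInf_superset_mono[OF neS bddS]) (auto simp: S_def intro!: image_mono midhull_mono)
  qed
  have mbd: "m k \<le> (LINT x|M. h x) + K" for k
  proof -
    have "m k \<le> I (f k)" unfolding m_def by (rule cInf_lower[OF _ bddS]) (use fk in \<open>auto simp: S_def\<close>)
    also have "\<dots> \<le> (LINT x|M. h x + \<bar>f k x\<bar>)"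
      unfolding I_def
    proof (rule integral_mono)
      fix x assume "x \<in> space M"
      have "phi (f k x) * h x \<le> (1 + \<bar>f k x\<bar>) * h x" using phib hb by (intro mult_right_mono) auto
      moreover have "\<bar>f k x\<bar> * h x \<le> \<bar>f k x\<bar>" using hb by (simp add: mult_left_le)
      ultimately show "phi (f k x) * h x \<le> h x + \<bar>f k x\<bar>" by (simp add: algebra_simps)
    qed (use hphi f hint in auto)
    also have "\<dots> = (LINT x|M. h x) + (LINT x|M. \<bar>f k x\<bar>)" using f hint by simp
    finally show ?thesis using K[of k] by simp
  qed
  have "\<exists>l. m \<longlonglongrightarrow> l"
    using incseq_convergent[OF minc, of "(LINT x|M. h x) + K"] mbd by metis
  then obtain l where l: "m \<longlonglongrightarrow> l" by blast
  have mle: "m k \<le> l" for k using incseq_le[OF minc l] by blast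
  have "\<exists>r. r \<ge> k \<and> l - m r < (1/4)^k" for k
  proof -
    have "eventually (\<lambda>r. m r > l - (1/4)^k) sequentially" using l by (rule order_tendstoD) simp
    then have "eventually (\<lambda>r. r \<ge> k \<and> m r > l - (1/4)^k) sequentially"
      using eventually_ge_at_top[of k] by eventually_elim auto
    then show ?thesis using eventually_happens'[OF sequentially_bot] by (force simp: algebra_simps)
  qed
  then obtain r where r: "\<And>k. r k \<ge> k" "\<And>k. l - m (r k) < (1/4)^k" by metis
  text \<open>Taking the indices \<open>r 0 + \<dots> + r k\<close> makes them monotone.\<close>
  define q where "q k = (\<Sum>j\<le>k. r j)" for k
  have qmono: "q k \<le> q (Suc k)" for k by (simp add: q_def)
  have rq: "r k \<le> q k" for k unfolding q_def by (rule member_le_sum) auto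
  have qm: "l - m (q k) < (1/4)^k" for k using r(2)[of k] incseqD[OF minc rq[of k]] by linarith
  have "\<exists>g\<in>midhull (f ` {q k..}). I g < m (q k) + (1/4)^k" for k
    using cInf_lessD[OF neS[of "q k"], of "m (q k) + (1/4)^k"] by (auto simp: m_def S_def)
  then obtain g where g: "\<And>k. g k \<in> midhull (f ` {q k..})" "\<And>k. I (g k) < m (q k) + (1/4)^k" by metis
  have gi: "integrable M (g k)" "(LINT x|M. \<bar>g k x\<bar>) \<le> K" for k using hull_int g(1) sub by blast+
  have [measurable]: "g k \<in> borel_measurable M" for k using gi by auto
  have [measurable]: "h \<in> borel_measurable M" by (rule hm)
  have [measurable]: "slope \<in> borel_measurable borel" unfolding slope_def by measurable
  define D where "D k x = (slope (g k x) - slope (g (Suc k) x))\<^sup>2 * h x" for k x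
  have [measurable]: "D k \<in> borel_measurable M" for k unfolding D_def by measurable
  \<comment> \<open>Both \<open>g k\<close> and \<open>g (Suc k)\<close> lie in the hull of the tail
    from \<open>q k\<close>, and so does their midpoint, at which \<open>I\<close> is therefore at
    least \<open>m (q k)\<close>. Near-minimality of the two leaves a convexity gap of order
    \<open>(1/4)^k\<close>; the estimates add up to 9 of these, rounded up to 16.\<close>
  have Dbound: "(\<integral>\<^sup>+x. ennreal (D k x) \<partial>M) \<le> ennreal (16 * (1/4)^k)" for k
  proof -
    let ?G = "\<lambda>x. (g k x + g (Suc k) x) / 2"
    have gS: "g (Suc k) \<in> midhull (f ` {q k..})"
      using g(1)[of "Suc k"] midhull_mono[of "f ` {q (Suc k)..}" "f ` {q k..}"] qmono[of k] by force
    have "?G \<in> midhull (f ` {q k..})" by (rule midhull.mid[OF g(1) gS])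
    then have mG: "m (q k) \<le> I ?G" unfolding m_def by (intro cInf_lower[OF _ bddS]) (auto simp: S_def)
    have Gi: "integrable M ?G" using gi by auto
    let ?R = "\<lambda>x. 4 * (phi (g k x) * h x) + 4 * (phi (g (Suc k) x) * h x) - 8 * (phi (?G x) * h x)"
    have Ri: "integrable M ?R" using hphi gi(1) Gi by (intro Bochner_Integration.integrable_add Bochner_Integration.integrable_diff integrable_mult_right) auto
    have DR: "D k x \<le> ?R x" for x
    proof -
      have "D k x \<le> (8 * ((phi (g k x) + phi (g (Suc k) x)) / 2 - phi (?G x))) * h x"
        unfolding D_def phi_def using hb slope_gap by (intro mult_right_mono) auto
      then show ?thesis by (simp add: algebra_simps)
    qed
    have D0: "0 \<le> D k x" for x unfolding D_def using hb by simp
    have "(\<integral>\<^sup>+x. ennreal (D k x) \<partial>M) \<le> (\<integral>\<^sup>+x. ennreal (?R x) \<partial>M)"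
      using DR by (intro nn_integral_mono ennreal_leI)
    also have "\<dots> = ennreal (LINT x|M. ?R x)"
      by (rule nn_integral_eq_integral[OF Ri AE_I2]) (rule order_trans[OF D0 DR])
    also have "(LINT x|M. ?R x) = 4 * I (g k) + 4 * I (g (Suc k)) - 8 * I ?G"
      unfolding I_def using hphi gi(1) Gi by simp
    also have "\<dots> \<le> 16 * (1/4)^k"
    proof -
      have "I (g k) < m (q k) + (1/4)^k" "I (g (Suc k)) < m (q (Suc k)) + (1/4)^Suc k" by (rule g(2))+
      moreover have "m (q (Suc k)) \<le> l" "l - m (q k) < (1/4)^k" by (rule mle, rule qm)
      moreover have "(1/4::real)^Suc k = (1/4)^k / 4" "(0::real) < (1/4)^k" by auto
      ultimately show ?thesis using mG by linarith
    qed
    finally show ?thesis by (simp add: ennreal_leI)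
  qed
  \<comment> \<open>The weight \<open>2^k\<close> still leaves a convergent geometric series. So at
    almost every point the squared jumps of the slopes are at most a constant times
    \<open>(1/2)^k\<close>, and the jumps themselves are summable.\<close>
  have "AE x in M. (\<Sum>k. ennreal (2^k * D k x)) \<noteq> \<infinity>"
  proof (rule nn_integral_PInf_AE)
    have "(\<integral>\<^sup>+x. (\<Sum>k. ennreal (2^k * D k x)) \<partial>M) = (\<Sum>k. (\<integral>\<^sup>+x. ennreal (2^k * D k x) \<partial>M))"
      by (rule nn_integral_suminf) measurable
    also have "\<dots> \<le> (\<Sum>k. ennreal (16 * (1/2)^k))"
    proof (rule suminf_le)
      fix k
      have "(\<integral>\<^sup>+x. ennreal (2^k * D k x) \<partial>M) = ennreal (2^k) * (\<integral>\<^sup>+x. ennreal (D k x) \<partial>M)"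
        by (subst nn_integral_cmult[symmetric]) (auto simp: ennreal_mult' )
      also have "\<dots> \<le> ennreal (2^k) * ennreal (16 * (1/4)^k)" by (intro mult_left_mono Dbound) auto
      also have "\<dots> = ennreal (2^k * (16 * (1/4)^k))" by (rule ennreal_mult[symmetric]) auto
      also have "(2::real)^k * (16 * (1/4)^k) = 16 * (1/2)^k" by (simp add: power_mult_distrib[symmetric])
      finally show "(\<integral>\<^sup>+x. ennreal (2^k * D k x) \<partial>M) \<le> ennreal (16 * (1/2)^k)" .
    qed auto
    also have "\<dots> = ennreal (\<Sum>k. 16 * (1/2)^k)"
      by (rule suminf_ennreal2) (auto intro!: summable_mult summable_geometric)
    finally show "(\<integral>\<^sup>+x. (\<Sum>k. ennreal (2^k * D k x)) \<partial>M) \<noteq> \<infinity>" by (auto simp: top_unique)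
  qed measurable
  \<comment> \<open>By Fatou's lemma and the bound \<open>K\<close>, some subsequence of
    \<open>g k x\<close> stays bounded at almost every point; without this the slopes could tend to
    1 or -1.\<close>
  moreover have "AE x in M. liminf (\<lambda>k. ennreal \<bar>g k x\<bar>) \<noteq> \<infinity>"
  proof (rule nn_integral_PInf_AE)
    have "(\<integral>\<^sup>+x. liminf (\<lambda>k. ennreal \<bar>g k x\<bar>) \<partial>M) \<le> liminf (\<lambda>k. (\<integral>\<^sup>+x. ennreal \<bar>g k x\<bar> \<partial>M))"
      by (rule nn_integral_liminf) measurable
    also have "\<dots> \<le> liminf (\<lambda>k::nat. ennreal K)"
    proof (rule Liminf_mono, rule always_eventually, rule allI)
      fix k
      have "(\<integral>\<^sup>+x. ennreal \<bar>g k x\<bar> \<partial>M) = ennreal (LINT x|M. \<bar>g k x\<bar>)" by (rule nn_integral_eq_integral) (use gi in auto)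
      then show "(\<integral>\<^sup>+x. ennreal \<bar>g k x\<bar> \<partial>M) \<le> ennreal K" using gi(2) by (simp add: ennreal_leI)
    qed
    also have "\<dots> = ennreal K" by (rule Liminf_const) simp
    finally show "(\<integral>\<^sup>+x. liminf (\<lambda>k. ennreal \<bar>g k x\<bar>) \<partial>M) \<noteq> \<infinity>" by (auto simp: top_unique)
  qed measurable
  moreover have "AE x in M. x \<in> space M" by (rule AE_space)
  ultimately have "AE x in M. convergent (\<lambda>k. g k x)"
  proof eventually_elim
    case (elim x)
    define c where "c = enn2real (\<Sum>k. ennreal (2^k * D k x))"
    have Dc: "2^k * D k x \<le> c" for k
    proof -
      have "ennreal (2^k * D k x) \<le> (\<Sum>k. ennreal (2^k * D k x))"
        using sum_le_suminf[of "\<lambda>k. ennreal (2^k * D k x)" "{k}"] by simp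
      also have "\<dots> = ennreal c" using elim(1) by (simp add: c_def less_top)
      finally show ?thesis by (simp add: c_def)
    qed
    have hx: "0 < h x" using elim(3) by (rule hpos)
    let ?s = "\<lambda>k. slope (g k x)"
    have diff: "norm (?s (Suc k) - ?s k) \<le> sqrt (c / h x) * (sqrt (1/2))^k" for k
    proof -
      have "(?s k - ?s (Suc k))\<^sup>2 \<le> (c / h x) * (1/2)^k"
        using Dc[of k] hx by (simp add: D_def field_simps power_divide)
      then have "sqrt ((?s k - ?s (Suc k))\<^sup>2) \<le> sqrt ((c / h x) * (1/2)^k)" by (rule real_sqrt_le_mono)
      moreover have "sqrt ((c / h x) * (1/2)^k) = sqrt (c / h x) * (sqrt (1/2))^k"
        by (simp only: real_sqrt_mult real_sqrt_power)
      moreover have "sqrt ((?s k - ?s (Suc k))\<^sup>2) = norm (?s (Suc k) - ?s k)"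
        by (simp only: real_sqrt_abs real_norm_def abs_minus_commute)
      ultimately show ?thesis by simp
    qed
    have "summable (\<lambda>k. ?s (Suc k) - ?s k)"
    proof (rule summable_comparison_test'[where N=0])
      show "summable (\<lambda>k. sqrt (c / h x) * (sqrt (1/2))^k)"
        by (intro summable_mult summable_geometric) (simp add: real_sqrt_lt_1_iff)
    qed (use diff in auto)
    then have "convergent (\<lambda>n. \<Sum>k<n. ?s (Suc k) - ?s k)" by (simp add: summable_iff_convergent)
    moreover have "(\<lambda>n. \<Sum>k<n. ?s (Suc k) - ?s k) = (\<lambda>n. ?s n - ?s 0)"
      by (rule ext, rule sum_lessThan_telescope)
    ultimately have "convergent (\<lambda>n. ?s n - ?s 0)" by simp
    then have conv: "convergent ?s" using convergent_diff_const_right_iff[of ?s "?s 0"] by simp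
    obtain b where b: "0 \<le> b" "liminf (\<lambda>k. ennreal \<bar>g k x\<bar>) = ennreal b"
      using elim(2) by (cases "liminf (\<lambda>k. ennreal \<bar>g k x\<bar>)") auto
    have "frequently (\<lambda>k. \<bar>g k x\<bar> \<le> b + 1) sequentially"
    proof (rule ccontr)
      assume "\<not> ?thesis"
      then have "eventually (\<lambda>k. ennreal (b + 1) \<le> ennreal \<bar>g k x\<bar>) sequentially"
        unfolding not_frequently by eventually_elim (auto intro: ennreal_leI)
      then have "ennreal (b + 1) \<le> ennreal b" unfolding b(2)[symmetric] by (rule Liminf_bounded)
      then show False using b(1) by simp
    qed
    with conv show ?case by (rule convergent_of_slope)
  qed
  moreover have "g k \<in> midhull (f ` {k..})" for k
    using g(1)[of k] midhull_mono[of "f ` {q k..}" "f ` {k..}"] rq[of k] r(1)[of k] by force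
  ultimately show ?thesis by blast
qed

section \<open>Couplings that respect labels\<close>

lemma ennreal_divide_mult_cancel:
  assumes "0 < b"
  shows "x / (a * ennreal b) * ennreal b = x / a"
proof -
  have "x / (a * ennreal b) * ennreal b = x * ennreal b / (a * ennreal b)"
    by (metis ennreal_times_divide mult.commute)
  also have "\<dots> = x / a" using assms by (intro divide_mult_eq) auto
  finally show ?thesis .
qed

lemma nn_integral_countable_fiber:
  fixes \<sigma> :: "'a \<Rightarrow> 'l::countable"
  assumes "\<sigma> \<in> measurable M (count_space UNIV)"
  shows "(\<integral>\<^sup>+x. F (\<sigma> x) \<partial>M) = (\<integral>\<^sup>+i. F i * emeasure M (fiber M \<sigma> i) \<partial>count_space UNIV)"
proof -
  have "(\<integral>\<^sup>+x. F (\<sigma> x) \<partial>M) = (\<integral>\<^sup>+x. (\<integral>\<^sup>+i. F i * indicator {\<sigma> x} i \<partial>count_space UNIV) \<partial>M)"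
    by (intro nn_integral_cong) simp
  also have "\<dots> = (\<integral>\<^sup>+x. (\<integral>\<^sup>+i. F i * indicator (fiber M \<sigma> i) x \<partial>count_space UNIV) \<partial>M)"
    by (intro nn_integral_cong) (auto simp: indicator_def)
  also have "\<dots> = (\<integral>\<^sup>+i. (\<integral>\<^sup>+x. F i * indicator (fiber M \<sigma> i) x \<partial>M) \<partial>count_space UNIV)"
    using measurable_sets[OF assms]
    by (intro nn_integral_fst_count_space[symmetric, THEN trans] nn_integral_count_space_nn_integral) auto
  also have "\<dots> = (\<integral>\<^sup>+i. F i * emeasure M (fiber M \<sigma> i) \<partial>count_space UNIV)"
    using measurable_sets[OF assms] by (intro nn_integral_cong nn_integral_cmult_indicator) auto
  finally show ?thesis .
qed

text \<open>Place the pieces of either partition side by side as intervals of the half line.\<close>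

lemma north_west_corner:
  fixes a b :: "nat \<Rightarrow> real"
  assumes a: "\<And>k. 0 \<le> a k" and b: "\<And>k. 0 \<le> b k"
    and eq: "(\<Sum>k. ennreal (a k)) = (\<Sum>k. ennreal (b k))"
  obtains c :: "nat \<Rightarrow> nat \<Rightarrow> ennreal" where
    "\<And>k. (\<Sum>l. c k l) = ennreal (a k)" "\<And>l. (\<Sum>k. c k l) = ennreal (b l)"
proof -
  define P where "P a k = {(\<Sum>i<k. a i)..<(\<Sum>i<Suc k. a i)}" for a :: "nat \<Rightarrow> real" and k
  have Pdisj: "disjoint_family (P a)" if a: "\<And>k. 0 \<le> a k" for a
  proof -
    have mono: "(\<Sum>i<k. a i) \<le> (\<Sum>i<l. a i)" if "k \<le> l" for k l
      using a that by (intro sum_mono2) auto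
    have "P a k \<inter> P a l = {}" if "k < l" for k l
      using mono[of "Suc k" l] that unfolding P_def by force
    then show ?thesis unfolding disjoint_family_on_def by (metis inf_commute linorder_neqE_nat)
  qed
  have Pun: "(\<Union>k. P a k) = {x. 0 \<le> x \<and> ennreal x < (\<Sum>k. ennreal (a k))}" if a: "\<And>k. 0 \<le> a k" for a
  proof -
    have part: "(\<Sum>i<k. ennreal (a i)) = ennreal (\<Sum>i<k. a i)" for k using a by (simp add: sum_ennreal)
    have "(\<exists>k. x \<in> P a k) \<longleftrightarrow> 0 \<le> x \<and> ennreal x < (\<Sum>k. ennreal (a k))" for x
    proof
      assume "\<exists>k. x \<in> P a k"
      then obtain k where k: "(\<Sum>i<k. a i) \<le> x" "x < (\<Sum>i<Suc k. a i)" by (auto simp: P_def)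
      have "0 \<le> x" using k(1) sum_nonneg[of "{..<k}" a] a by force
      moreover have "ennreal x < ennreal (\<Sum>i<Suc k. a i)" using k(2) \<open>0 \<le> x\<close> by (intro ennreal_lessI) auto
      moreover have "\<dots> \<le> (\<Sum>k. ennreal (a k))" unfolding part[symmetric] by (rule sum_le_suminf) auto
      ultimately show "0 \<le> x \<and> ennreal x < (\<Sum>k. ennreal (a k))" by (auto intro: less_le_trans)
    next
      assume x: "0 \<le> x \<and> ennreal x < (\<Sum>k. ennreal (a k))"
      have "(\<lambda>n. \<Sum>i<n. ennreal (a i)) \<longlonglongrightarrow> (\<Sum>k. ennreal (a k))"
        by (rule summable_LIMSEQ) auto
      from order_tendstoD(1)[OF this, of "ennreal x"] x obtain n where "ennreal x < (\<Sum>i<n. ennreal (a i))"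
        using eventually_happens'[OF sequentially_bot] by blast
      then have ex: "x < (\<Sum>i<n. a i)" unfolding part using x by (simp add: ennreal_less_iff)
      \<comment> \<open>\<open>x\<close> lies in the interval that ends at the first partial sum
        above it. That sum is not the empty one, as \<open>x\<close> is nonnegative, hence the
        predecessor \<open>k'\<close>.\<close>
      define k where "k = (LEAST n. x < (\<Sum>i<n. a i))"
      have k1: "x < (\<Sum>i<k. a i)" unfolding k_def using ex by (rule LeastI)
      then have "k \<noteq> 0" using x by (auto intro: ccontr)
      then obtain k' where k': "k = Suc k'" by (cases k) auto
      have "\<not> x < (\<Sum>i<k'. a i)" using not_less_Least[of k' "\<lambda>n. x < (\<Sum>i<n. a i)"] k' by (simp add: k_def)
      then show "\<exists>k. x \<in> P a k" using k1 k' by (auto simp: P_def intro!: exI[of _ k'])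
    qed
    then show ?thesis by blast
  qed
  have Pm: "P a k \<in> sets lborel" for a k by (simp add: P_def)
  have Pe: "emeasure lborel (P a k) = ennreal (a k)" if "\<And>k. 0 \<le> a k" for a k
    using that[of k] by (simp add: P_def)
  have same: "(\<Union>k. P a k) = (\<Union>k. P b k)" by (simp only: Pun[OF a] Pun[OF b] eq)
  define c where "c k l = emeasure lborel (P a k \<inter> P b l)" for k l
  have "(\<Sum>l. c k l) = ennreal (a k)" for k
  proof -
    have "(\<Sum>l. c k l) = emeasure lborel (\<Union>l. P a k \<inter> P b l)"
      unfolding c_def
    proof (rule suminf_emeasure)
      show "disjoint_family (\<lambda>l. P a k \<inter> P b l)" using Pdisj[of b] b unfolding disjoint_family_on_def by blast
    qed (use Pm in auto)
    also have "(\<Union>l. P a k \<inter> P b l) = P a k" using same by blast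
    finally show ?thesis using Pe a by simp
  qed
  moreover have "(\<Sum>k. c k l) = ennreal (b l)" for l
  proof -
    have "(\<Sum>k. c k l) = emeasure lborel (\<Union>k. P a k \<inter> P b l)"
      unfolding c_def
    proof (rule suminf_emeasure)
      show "disjoint_family (\<lambda>k. P a k \<inter> P b l)" using Pdisj[of a] a unfolding disjoint_family_on_def by blast
    qed (use Pm in auto)
    also have "(\<Union>k. P a k \<inter> P b l) = P b l" using same by blast
    finally show ?thesis using Pe b by simp
  qed
  ultimately show ?thesis using that by blast
qed

text \<open>Normalisation of the conditional density given a piece of mass \<open>a\<close>: the
  mass \<open>c l\<close> is spread evenly over the piece with index \<open>l\<close>, and the
  \<open>c l\<close> add up to \<open>a\<close>. A piece with \<open>b l = 0\<close> has
  \<open>c l = 0\<close>. By symmetry of the density this serves both marginals.\<close>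

lemma kernel_integral:
  fixes \<tau> :: "'a \<Rightarrow> nat \<times> nat"
  assumes \<tau>: "\<tau> \<in> measurable M (count_space UNIV)"
    and b: "\<And>l. emeasure M (fiber M \<tau> (i, l)) = ennreal (b l)" "\<And>l. 0 \<le> b l"
    and c: "\<And>l. c l \<le> ennreal (b l)" "(\<Sum>l. c l) = ennreal a" and a: "0 < a"
  shows "(\<integral>\<^sup>+y. (if fst (\<tau> y) = i then c (snd (\<tau> y)) / (ennreal a * ennreal (b (snd (\<tau> y)))) else 0) \<partial>M) = 1"
proof -
  let ?w = "\<lambda>q. if fst q = i then c (snd q) / (ennreal a * ennreal (b (snd q))) else 0"
  have "(\<integral>\<^sup>+y. ?w (\<tau> y) \<partial>M) = (\<integral>\<^sup>+q. ?w q * emeasure M (fiber M \<tau> q) \<partial>count_space UNIV)"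
    by (rule nn_integral_countable_fiber[OF \<tau>])
  also have "\<dots> = (\<integral>\<^sup>+q. c (snd q) / ennreal a * indicator ({i} \<times> UNIV) q \<partial>count_space UNIV)"
  proof (rule nn_integral_cong)
    fix q :: "nat \<times> nat"
    obtain j l where q: "q = (j, l)" by (cases q)
    show "?w q * emeasure M (fiber M \<tau> q) = c (snd q) / ennreal a * indicator ({i} \<times> UNIV) q"
    proof (cases "j = i")
      case True
      show ?thesis
      proof (cases "b l = 0")
        case True
        then show ?thesis using c(1)[of l] \<open>j = i\<close> by (simp add: q b(1))
      next
        case False
        then have "c l / (ennreal a * ennreal (b l)) * ennreal (b l) = c l / ennreal a"
          using b(2)[of l] by (intro ennreal_divide_mult_cancel) simp
        then show ?thesis using \<open>j = i\<close> by (simp add: q b(1))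
      qed
    qed (simp add: q)
  qed
  also have "\<dots> = (\<integral>\<^sup>+q. c (snd q) / ennreal a \<partial>count_space ({i} \<times> UNIV))"
    by (simp add: nn_integral_count_space_indicator)
  also have "\<dots> = (\<integral>\<^sup>+l. c l / ennreal a \<partial>count_space UNIV)"
    by (subst nn_integral_bij_count_space[symmetric, where g="\<lambda>l. (i, l)" and A=UNIV])
       (auto simp: bij_betw_def inj_on_def)
  also have "\<dots> = (\<Sum>l. c l) / ennreal a" by (simp add: nn_integral_count_space_nat)
  also have "\<dots> = 1" using a by (simp add: c(2) ennreal_divide_self)
  finally show ?thesis .
qed

text \<open>On every product of a piece of \<open>M1\<close> with a piece of \<open>M2\<close> the coupling is a multiple of the
  product measure.\<close>

lemma coupling_of_labels:
  fixes M1 :: "'a measure" and M2 :: "'b measure" and \<sigma>1 :: "'a \<Rightarrow> nat" and \<sigma>2 :: "'b \<Rightarrow> nat"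
  assumes M1: "sigma_finite_measure M1" and M2: "sigma_finite_measure M2"
    and \<sigma>1: "\<sigma>1 \<in> measurable M1 (count_space UNIV)" and \<sigma>2: "\<sigma>2 \<in> measurable M2 (count_space UNIV)"
    and eq: "\<And>i. emeasure M1 (fiber M1 \<sigma>1 i) = emeasure M2 (fiber M2 \<sigma>2 i)"
  obtains N :: "('a \<times> 'b) measure" where "coupling N M1 M2 fst snd"
    "AE z in N. \<sigma>1 (fst z) = \<sigma>2 (snd z)"
proof -
  interpret M1: sigma_finite_measure M1 by (rule M1)
  interpret M2: sigma_finite_measure M2 by (rule M2)
  interpret pair_sigma_finite M1 M2 ..
  \<comment> \<open>A fiber of \<open>\<sigma>1\<close> or \<open>\<sigma>2\<close> may have
    infinite mass. A second label cuts the space into countably many parts of finite mass, by whose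
    masses one can divide.\<close>
  have index: "\<exists>\<kappa>. \<kappa> \<in> measurable M (count_space UNIV) \<and> (\<forall>k::nat. emeasure M (fiber M \<kappa> k) < \<infinity>)"
    if "sigma_finite_measure M" for M :: "'c measure"
  proof -
    interpret sigma_finite_measure M by fact
    obtain D :: "nat \<Rightarrow> 'c set" where D: "range D \<subseteq> sets M" "(\<Union>i. D i) = space M" "\<And>i. emeasure M (D i) \<noteq> \<infinity>"
      using sigma_finite by blast
    define \<kappa> where "\<kappa> x = (LEAST n. x \<in> D n)" for x
    have m: "\<kappa> \<in> measurable M (count_space UNIV)"
      unfolding \<kappa>_def by (rule measurable_Least) (use D(1) in auto)
    have "fiber M \<kappa> k \<subseteq> D k" for k
    proof
      fix x assume x: "x \<in> fiber M \<kappa> k"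
      then obtain n where "x \<in> D n" using D(2) by blast
      then have "x \<in> D (\<kappa> x)" unfolding \<kappa>_def by (rule LeastI)
      then show "x \<in> D k" using x by simp
    qed
    then have "emeasure M (fiber M \<kappa> k) \<le> emeasure M (D k)" for k
      using D(1) by (intro emeasure_mono) auto
    then show ?thesis using m D(3) by (auto simp: less_top intro: le_less_trans)
  qed
  obtain \<kappa>1 :: "'a \<Rightarrow> nat" where \<kappa>1: "\<kappa>1 \<in> measurable M1 (count_space UNIV)" "\<And>k. emeasure M1 (fiber M1 \<kappa>1 k) < \<infinity>"
    using index[OF M1] by blast
  obtain \<kappa>2 :: "'b \<Rightarrow> nat" where \<kappa>2: "\<kappa>2 \<in> measurable M2 (count_space UNIV)" "\<And>k. emeasure M2 (fiber M2 \<kappa>2 k) < \<infinity>"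
    using index[OF M2] by blast
  define \<tau>1 where "\<tau>1 x = (\<sigma>1 x, \<kappa>1 x)" for x
  define \<tau>2 where "\<tau>2 x = (\<sigma>2 x, \<kappa>2 x)" for x
  have pairm: "(\<lambda>x. (f x, g x)) \<in> measurable M (count_space (UNIV :: (nat \<times> nat) set))"
    if "f \<in> measurable M (count_space UNIV)" "g \<in> measurable M (count_space UNIV)" for f g and M :: "'c measure"
    using measurable_Pair[OF that] by (simp add: pair_measure_countable)
  have \<tau>1: "\<tau>1 \<in> measurable M1 (count_space UNIV)" unfolding \<tau>1_def by (rule pairm[OF \<sigma>1 \<kappa>1(1)])
  have \<tau>2: "\<tau>2 \<in> measurable M2 (count_space UNIV)" unfolding \<tau>2_def by (rule pairm[OF \<sigma>2 \<kappa>2(1)])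
  have fm1: "fiber M1 \<sigma>1 i \<in> sets M1" "fiber M1 \<kappa>1 i \<in> sets M1" for i
    using \<sigma>1 \<kappa>1(1) by (auto intro: measurable_sets)
  have fm2: "fiber M2 \<sigma>2 i \<in> sets M2" "fiber M2 \<kappa>2 i \<in> sets M2" for i
    using \<sigma>2 \<kappa>2(1) by (auto intro: measurable_sets)
  have f1: "fiber M1 \<tau>1 (i, k) = fiber M1 \<sigma>1 i \<inter> fiber M1 \<kappa>1 k" for i k by (auto simp: \<tau>1_def)
  have f2: "fiber M2 \<tau>2 (i, k) = fiber M2 \<sigma>2 i \<inter> fiber M2 \<kappa>2 k" for i k by (auto simp: \<tau>2_def)
  have fin1: "emeasure M1 (fiber M1 \<tau>1 (i, k)) < \<infinity>" for i k
    unfolding f1 using fm1 by (intro le_less_trans[OF emeasure_mono \<kappa>1(2)[of k]]) auto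
  have fin2: "emeasure M2 (fiber M2 \<tau>2 (i, k)) < \<infinity>" for i k
    unfolding f2 using fm2 by (intro le_less_trans[OF emeasure_mono \<kappa>2(2)[of k]]) auto
  define a where "a i k = measure M1 (fiber M1 \<tau>1 (i, k))" for i k
  define b where "b i k = measure M2 (fiber M2 \<tau>2 (i, k))" for i k
  have ea: "emeasure M1 (fiber M1 \<tau>1 (i, k)) = ennreal (a i k)" for i k
    unfolding a_def using fin1[of i k] by (intro emeasure_eq_ennreal_measure) auto
  have eb: "emeasure M2 (fiber M2 \<tau>2 (i, k)) = ennreal (b i k)" for i k
    unfolding b_def using fin2[of i k] by (intro emeasure_eq_ennreal_measure) auto
  have ab0: "0 \<le> a i k" "0 \<le> b i k" for i k by (auto simp: a_def b_def)
  have "(\<Sum>k. ennreal (a i k)) = emeasure M1 (\<Union>k. fiber M1 \<tau>1 (i, k))" for i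
    unfolding ea[symmetric] f1 using fm1 by (intro suminf_emeasure) (auto simp: disjoint_family_on_def)
  moreover have "(\<Union>k. fiber M1 \<tau>1 (i, k)) = fiber M1 \<sigma>1 i" for i by (auto simp: f1)
  moreover have "(\<Sum>k. ennreal (b i k)) = emeasure M2 (\<Union>k. fiber M2 \<tau>2 (i, k))" for i
    unfolding eb[symmetric] f2 using fm2 by (intro suminf_emeasure) (auto simp: disjoint_family_on_def)
  moreover have "(\<Union>k. fiber M2 \<tau>2 (i, k)) = fiber M2 \<sigma>2 i" for i by (auto simp: f2)
  ultimately have "(\<Sum>k. ennreal (a i k)) = (\<Sum>k. ennreal (b i k))" for i using eq by simp
  \<comment> \<open>Inside label \<open>i\<close> the pieces of the two spaces have the same total
    mass, possibly infinite, so one transport matrix has both families of piece masses as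
    margins.\<close>
  then have "\<exists>c. (\<forall>k. (\<Sum>l. c k l) = ennreal (a i k)) \<and> (\<forall>l. (\<Sum>k. c k l) = ennreal (b i l))" for i
    using north_west_corner[of "a i" "b i"] ab0 by metis
  then obtain c where c: "\<And>i k. (\<Sum>l. c i k l) = ennreal (a i k)" "\<And>i l. (\<Sum>k. c i k l) = ennreal (b i l)"
    by metis
  have ca: "c i k l \<le> ennreal (a i k)" for i k l
    unfolding c(1)[symmetric] using sum_le_suminf[of "c i k" "{l}"] by simp
  have cb: "c i k l \<le> ennreal (b i l)" for i k l
    unfolding c(2)[symmetric] using sum_le_suminf[of "\<lambda>k. c i k l" "{k}"] by simp
  \<comment> \<open>Pieces with different labels receive density 0, which puts the coupling on pairs
    of equal labels.\<close>
  define w where "w p q = (if fst p = fst q then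
      c (fst p) (snd p) (snd q) / (ennreal (a (fst p) (snd p)) * ennreal (b (fst q) (snd q))) else 0)" for p q
  define d where "d z = w (\<tau>1 (fst z)) (\<tau>2 (snd z))" for z
  have dm: "d \<in> borel_measurable (M1 \<Otimes>\<^sub>M M2)"
  proof -
    have "(\<lambda>z. (\<tau>1 (fst z), \<tau>2 (snd z))) \<in> measurable (M1 \<Otimes>\<^sub>M M2) (count_space UNIV)"
      using measurable_Pair[OF measurable_compose[OF measurable_fst \<tau>1] measurable_compose[OF measurable_snd \<tau>2]]
      by (simp add: pair_measure_countable)
    from measurable_compose[OF this, of "\<lambda>(p, q). w p q" borel] show ?thesis by (simp add: d_def[abs_def])
  qed
  note [measurable] = dm
  have inner2: "(\<integral>\<^sup>+y. w (\<tau>1 x) (\<tau>2 y) \<partial>M2) = 1" if pos: "a (\<sigma>1 x) (\<kappa>1 x) > 0" for x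
  proof -
    let ?i = "\<sigma>1 x" and ?k = "\<kappa>1 x"
    have "w (\<tau>1 x) q = (if fst q = ?i then c ?i ?k (snd q) / (ennreal (a ?i ?k) * ennreal (b ?i (snd q))) else 0)" for q
      by (auto simp: w_def \<tau>1_def)
    then show ?thesis using kernel_integral[OF \<tau>2 eb ab0(2) cb c(1) pos] by simp
  qed
  have inner1: "(\<integral>\<^sup>+x. w (\<tau>1 x) (\<tau>2 y) \<partial>M1) = 1" if pos: "b (\<sigma>2 y) (\<kappa>2 y) > 0" for y
  proof -
    let ?i = "\<sigma>2 y" and ?l = "\<kappa>2 y"
    have "w q (\<tau>2 y) = (if fst q = ?i then c ?i (snd q) ?l / (ennreal (b ?i ?l) * ennreal (a ?i (snd q))) else 0)" for q
      by (auto simp: w_def \<tau>2_def mult.commute)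
    then show ?thesis using kernel_integral[OF \<tau>1 ea ab0(1) ca c(2) pos] by simp
  qed
  \<comment> \<open>The marginal density is shown to be 1 only at points of pieces with positive
    mass; the other pieces are countably many null sets.\<close>
  have AEpos: "AE x in M. 0 < measure M (fiber M \<tau> (\<tau> x))"
    if \<tau>: "\<tau> \<in> measurable M (count_space UNIV)" and fin: "\<And>q. emeasure M (fiber M \<tau> q) < \<infinity>"
    for M :: "'c measure" and \<tau> :: "'c \<Rightarrow> nat \<times> nat"
  proof -
    have "AE x in M. \<forall>q. \<tau> x = q \<longrightarrow> 0 < measure M (fiber M \<tau> q)"
    proof (subst AE_all_countable, rule allI)
      fix q
      show "AE x in M. \<tau> x = q \<longrightarrow> 0 < measure M (fiber M \<tau> q)"
      proof (cases "measure M (fiber M \<tau> q) = 0")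
        case True
        then have "emeasure M (fiber M \<tau> q) = 0"
          using fin[of q] by (auto simp: measure_def enn2real_eq_0_iff)
        then show ?thesis
          using measurable_sets[OF \<tau>, of "{q}"] by (intro AE_I[where N="fiber M \<tau> q"]) auto
      qed (simp add: zero_less_measure_iff)
    qed
    then show ?thesis by eventually_elim auto
  qed
  define N where "N = density (M1 \<Otimes>\<^sub>M M2) d"
  have sets_N: "sets N = sets (M1 \<Otimes>\<^sub>M M2)" and space_N: "space N = space M1 \<times> space M2"
    by (auto simp: N_def space_pair_measure)
  have fst_N: "distr N M1 fst = M1"
  proof (rule measure_eqI)
    fix E assume E: "E \<in> sets (distr N M1 fst)"
    then have E': "E \<in> sets M1" by simp
    have "emeasure (distr N M1 fst) E = emeasure N (E \<times> space M2)"
      using E' sets.sets_into_space[OF E']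
      by (subst emeasure_distr) (auto simp: N_def space_pair_measure intro!: arg_cong2[where f=emeasure])
    also have "\<dots> = (\<integral>\<^sup>+z. d z * indicator (E \<times> space M2) z \<partial>(M1 \<Otimes>\<^sub>M M2))"
      unfolding N_def using E' by (intro emeasure_density) auto
    also have "\<dots> = (\<integral>\<^sup>+x. (\<integral>\<^sup>+y. d (x, y) * indicator (E \<times> space M2) (x, y) \<partial>M2) \<partial>M1)"
      using E' by (intro M2.nn_integral_fst[symmetric]) auto
    also have "\<dots> = (\<integral>\<^sup>+x. indicator E x \<partial>M1)"
    proof (rule nn_integral_cong_AE)
      have "AE x in M1. 0 < measure M1 (fiber M1 \<tau>1 (\<tau>1 x))" by (rule AEpos[OF \<tau>1]) (use fin1 in auto)
      then show "AE x in M1. (\<integral>\<^sup>+y. d (x, y) * indicator (E \<times> space M2) (x, y) \<partial>M2) = indicator E x"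
      proof eventually_elim
        case (elim x)
        then have pos: "a (\<sigma>1 x) (\<kappa>1 x) > 0" by (simp add: a_def \<tau>1_def)
        have "(\<integral>\<^sup>+y. d (x, y) * indicator (E \<times> space M2) (x, y) \<partial>M2) = (\<integral>\<^sup>+y. w (\<tau>1 x) (\<tau>2 y) * indicator E x \<partial>M2)"
          by (intro nn_integral_cong) (auto simp: d_def indicator_def)
        also have "\<dots> = (\<integral>\<^sup>+y. w (\<tau>1 x) (\<tau>2 y) \<partial>M2) * indicator E x" by (cases "x \<in> E") auto
        finally show ?case using inner2[OF pos] by simp
      qed
    qed
    also have "\<dots> = emeasure M1 E" using E' by simp
    finally show "emeasure (distr N M1 fst) E = emeasure M1 E" .
  qed simp
  have snd_N: "distr N M2 snd = M2"
  proof (rule measure_eqI)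
    fix E assume E: "E \<in> sets (distr N M2 snd)"
    then have E': "E \<in> sets M2" by simp
    have "emeasure (distr N M2 snd) E = emeasure N (space M1 \<times> E)"
      using E' sets.sets_into_space[OF E']
      by (subst emeasure_distr) (auto simp: N_def space_pair_measure intro!: arg_cong2[where f=emeasure])
    also have "\<dots> = (\<integral>\<^sup>+z. d z * indicator (space M1 \<times> E) z \<partial>(M1 \<Otimes>\<^sub>M M2))"
      unfolding N_def using E' by (intro emeasure_density) auto
    also have "\<dots> = (\<integral>\<^sup>+y. (\<integral>\<^sup>+x. d (x, y) * indicator (space M1 \<times> E) (x, y) \<partial>M1) \<partial>M2)"
      using E' by (intro nn_integral_snd[symmetric]) auto
    also have "\<dots> = (\<integral>\<^sup>+y. indicator E y \<partial>M2)"
    proof (rule nn_integral_cong_AE)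
      have "AE y in M2. 0 < measure M2 (fiber M2 \<tau>2 (\<tau>2 y))" by (rule AEpos[OF \<tau>2]) (use fin2 in auto)
      then show "AE y in M2. (\<integral>\<^sup>+x. d (x, y) * indicator (space M1 \<times> E) (x, y) \<partial>M1) = indicator E y"
      proof eventually_elim
        case (elim y)
        then have pos: "b (\<sigma>2 y) (\<kappa>2 y) > 0" by (simp add: b_def \<tau>2_def)
        have "(\<integral>\<^sup>+x. d (x, y) * indicator (space M1 \<times> E) (x, y) \<partial>M1) = (\<integral>\<^sup>+x. w (\<tau>1 x) (\<tau>2 y) * indicator E y \<partial>M1)"
          by (intro nn_integral_cong) (auto simp: d_def indicator_def)
        also have "\<dots> = (\<integral>\<^sup>+x. w (\<tau>1 x) (\<tau>2 y) \<partial>M1) * indicator E y" by (cases "y \<in> E") auto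
        finally show ?case using inner1[OF pos] by simp
      qed
    qed
    also have "\<dots> = emeasure M2 E" using E' by simp
    finally show "emeasure (distr N M2 snd) E = emeasure M2 E" .
  qed simp
  \<comment> \<open>The first marginal is \<open>M1\<close>, so cylinders over parts of finite mass
    have finite mass.\<close>
  have "sigma_finite_measure N"
  proof
    have cyl: "emeasure N (fiber M1 \<kappa>1 k \<times> space M2) = emeasure M1 (fiber M1 \<kappa>1 k)" for k
    proof -
      have "emeasure N (fiber M1 \<kappa>1 k \<times> space M2) = emeasure (distr N M1 fst) (fiber M1 \<kappa>1 k)"
        using fm1(2)[of k] by (subst emeasure_distr) (auto simp: N_def space_pair_measure intro!: arg_cong2[where f=emeasure])
      then show ?thesis by (simp add: fst_N)
    qed
    show "\<exists>A. countable A \<and> A \<subseteq> sets N \<and> \<Union>A = space N \<and> (\<forall>a\<in>A. emeasure N a \<noteq> \<infinity>)"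
    proof (intro exI conjI ballI)
      show "countable (range (\<lambda>k. fiber M1 \<kappa>1 k \<times> space M2))" by simp
      show "range (\<lambda>k. fiber M1 \<kappa>1 k \<times> space M2) \<subseteq> sets N" using fm1(2) by (auto simp: sets_N)
      show "\<Union>(range (\<lambda>k. fiber M1 \<kappa>1 k \<times> space M2)) = space N" by (auto simp: space_N)
      fix A assume "A \<in> range (\<lambda>k. fiber M1 \<kappa>1 k \<times> space M2)"
      then obtain k where "A = fiber M1 \<kappa>1 k \<times> space M2" by blast
      then show "emeasure N A \<noteq> \<infinity>" using cyl[of k] \<kappa>1(2)[of k] by auto
    qed
  qed
  then have "coupling N M1 M2 fst snd"
    using fst_N snd_N by (auto simp: coupling_def measure_preserving_def N_def)
  moreover have "AE z in N. \<sigma>1 (fst z) = \<sigma>2 (snd z)"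
  proof -
    have "AE z in M1 \<Otimes>\<^sub>M M2. 0 < d z \<longrightarrow> \<sigma>1 (fst z) = \<sigma>2 (snd z)"
      by (rule AE_I2) (auto simp: d_def w_def \<tau>1_def \<tau>2_def split: if_splits)
    then show ?thesis unfolding N_def by (simp add: AE_density)
  qed
  ultimately show ?thesis by (rule that)
qed

section \<open>Pull-backs and extensions by zero\<close>

lemma measure_preserving_pair:
  assumes "measure_preserving N M \<phi>" "sigma_finite_measure M"
  shows "(\<lambda>z. (\<phi> (fst z), \<phi> (snd z))) \<in> measurable (sq N) (sq M)"
    and "distr (sq N) (sq M) (\<lambda>z. (\<phi> (fst z), \<phi> (snd z))) = sq M"
proof -
  have \<phi> [measurable]: "\<phi> \<in> measurable N M" and d: "distr N M \<phi> = M"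
    using assms(1) by (auto simp: measure_preserving_def)
  show "(\<lambda>z. (\<phi> (fst z), \<phi> (snd z))) \<in> measurable (sq N) (sq M)" by measurable
  have "sigma_finite_measure (distr N M \<phi>)" using assms(2) d by simp
  from pair_measure_distr[OF \<phi> \<phi> this] show
    "distr (sq N) (sq M) (\<lambda>z. (\<phi> (fst z), \<phi> (snd z))) = sq M"
    by (simp add: d case_prod_beta')
qed

lemma
  assumes "measure_preserving N M \<phi>" "sigma_finite_measure M" "gintegrable M F"
  shows pullback_integrable: "gintegrable N (pullback F \<phi>)"
    and pullback_L1_norm: "L1_norm N (pullback F \<phi>) = L1_norm M F"
proof -
  note P = measure_preserving_pair[OF assms(1,2)]
  have "integrable (distr (sq N) (sq M) (\<lambda>z. (\<phi> (fst z), \<phi> (snd z)))) (\<lambda>z. F (fst z) (snd z))"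
    using P(2) assms(3) by simp
  from integrable_distr[OF P(1) this] show "gintegrable N (pullback F \<phi>)" by (simp add: pullback_def)
  have "L1_norm M F = (LINT z|distr (sq N) (sq M) (\<lambda>z. (\<phi> (fst z), \<phi> (snd z))). \<bar>F (fst z) (snd z)\<bar>)"
    by (simp add: P(2) L1_norm_def)
  also have "\<dots> = L1_norm N (pullback F \<phi>)"
    using P(1) assms(3) by (subst integral_distr) (auto simp: L1_norm_def pullback_def)
  finally show "L1_norm N (pullback F \<phi>) = L1_norm M F" ..
qed

lemma measure_preserving_fiber:
  assumes "measure_preserving N M \<phi>" "\<sigma> \<in> measurable M (count_space UNIV)"
  shows "emeasure N (fiber N (\<lambda>x. \<sigma> (\<phi> x)) i) = emeasure M (fiber M \<sigma> i)"
proof -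
  have \<phi>: "\<phi> \<in> measurable N M" and d: "distr N M \<phi> = M"
    using assms(1) by (auto simp: measure_preserving_def)
  have "emeasure (distr N M \<phi>) (fiber M \<sigma> i) = emeasure N (fiber N (\<lambda>x. \<sigma> (\<phi> x)) i)"
    using \<phi> measurable_sets[OF assms(2), of "{i}"] measurable_space[OF \<phi>]
    by (subst emeasure_distr) (auto intro!: arg_cong2[where f=emeasure])
  then show ?thesis by (simp add: d)
qed

lemma finite_labelling_pullback:
  assumes "measure_preserving N M \<phi>" "finite_labelling M \<sigma> K"
  shows "finite_labelling N (\<lambda>x. \<sigma> (\<phi> x)) K"
proof -
  have \<phi>: "\<phi> \<in> measurable N M" and d: "distr N M \<phi> = M"
    using assms(1) by (auto simp: measure_preserving_def)
  have \<sigma>: "\<sigma> \<in> measurable M (count_space UNIV)" using assms(2) by (simp add: finite_labelling_def)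
  have "{x \<in> space M. \<sigma> x \<noteq> 0} = \<sigma> -` (- {0}) \<inter> space M" by auto
  then have m: "{x \<in> space M. \<sigma> x \<noteq> 0} \<in> sets M" using \<sigma> by (auto intro: measurable_sets)
  have "emeasure (distr N M \<phi>) {x \<in> space M. \<sigma> x \<noteq> 0} = emeasure N {x \<in> space N. \<sigma> (\<phi> x) \<noteq> 0}"
    using \<phi> m measurable_space[OF \<phi>] by (subst emeasure_distr) (auto intro!: arg_cong2[where f=emeasure])
  then show ?thesis
    using assms(2) measurable_space[OF \<phi>] measurable_compose[OF \<phi> \<sigma>] by (auto simp: finite_labelling_def d)
qed

text \<open>For step functions this holds because the fibers keep their masses; they are dense in \<open>L\<^sup>1\<close>.\<close>

lemma cut_norm_pullback_le:
  assumes \<phi>: "measure_preserving N M \<phi>" and N: "sigma_finite_measure N" and M: "sigma_finite_measure M"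
    and F: "gintegrable M F"
  shows "cut_norm N (pullback F \<phi>) \<le> cut_norm M F"
proof (rule field_le_epsilon)
  fix e :: real assume "0 < e"
  then have e: "0 < e / 2" by simp
  obtain \<sigma> K u where \<sigma>: "finite_labelling M \<sigma> K" and u: "label_weights K u"
    and err: "L1_norm M (\<lambda>x y. F x y - u (\<sigma> x) (\<sigma> y)) \<le> e / 2"
    using step_fun_approx[OF M F e] .
  have \<sigma>m: "\<sigma> \<in> measurable M (count_space UNIV)" using \<sigma> by (simp add: finite_labelling_def)
  have S: "gintegrable M (step_fun u \<sigma>)" by (rule label_weights_integrable[OF M \<sigma> u])
  have S': "gintegrable N (step_fun u (\<lambda>x. \<sigma> (\<phi> x)))"
    by (rule label_weights_integrable[OF N finite_labelling_pullback[OF \<phi> \<sigma>] u])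
  have "cut_norm N (pullback F \<phi>) \<le> cut_norm N (step_fun u (\<lambda>x. \<sigma> (\<phi> x)))
      + L1_norm N (\<lambda>x y. pullback F \<phi> x y - u (\<sigma> (\<phi> x)) (\<sigma> (\<phi> y)))"
    by (rule cut_norm_le_add_L1[OF pullback_integrable[OF \<phi> M F] S'])
  also have "L1_norm N (\<lambda>x y. pullback F \<phi> x y - u (\<sigma> (\<phi> x)) (\<sigma> (\<phi> y)))
    = L1_norm M (\<lambda>x y. F x y - u (\<sigma> x) (\<sigma> y))"
    using pullback_L1_norm[OF \<phi> M, of "\<lambda>x y. F x y - u (\<sigma> x) (\<sigma> y)"] F S by (simp add: pullback_def)
  also have "cut_norm N (step_fun u (\<lambda>x. \<sigma> (\<phi> x))) \<le> cut_norm M (step_fun u \<sigma>)"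
  proof (rule cut_norm_step_fun_le[OF N _ M \<sigma>m])
    show "(\<lambda>x. \<sigma> (\<phi> x)) \<in> measurable N (count_space UNIV)"
      using finite_labelling_pullback[OF \<phi> \<sigma>] by (simp add: finite_labelling_def)
    show "finite {1..K}" by simp
    show "emeasure N (fiber N (\<lambda>x. \<sigma> (\<phi> x)) i) = emeasure M (fiber M \<sigma> i)" for i
      by (rule measure_preserving_fiber[OF \<phi> \<sigma>m])
    then show "emeasure N (fiber N (\<lambda>x. \<sigma> (\<phi> x)) i) < \<infinity>" if "i \<in> {1..K}" for i
      using finite_labelling_fiber[OF \<sigma>, of i] that by simp
    show "u i j \<noteq> 0 \<Longrightarrow> i \<in> {1..K} \<and> j \<in> {1..K}" for i j using u by (auto simp: label_weights_def)
  qed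
  also have "cut_norm M (step_fun u \<sigma>) \<le> cut_norm M F + L1_norm M (\<lambda>x y. u (\<sigma> x) (\<sigma> y) - F x y)"
    by (rule cut_norm_le_add_L1[OF S F])
  also have "L1_norm M (\<lambda>x y. u (\<sigma> x) (\<sigma> y) - F x y) = L1_norm M (\<lambda>x y. F x y - u (\<sigma> x) (\<sigma> y))"
    by (simp add: L1_norm_def abs_minus_commute)
  finally show "cut_norm N (pullback F \<phi>) \<le> cut_norm M F + e" using err by simp
qed

section \<open>The extension of a space to infinite total mass\<close>

lemma ext_algebra:
  "sigma_algebra (Inl ` space M \<union> range Inr)
     {A. A \<subseteq> Inl ` space M \<union> range Inr \<and> Inl -` A \<in> sets M \<and> Inr -` A \<in> sets (borel :: real measure)}"
  unfolding sigma_algebra_iff2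
proof (intro conjI ballI allI impI)
  fix s :: "('a + real) set"
  assume "s \<in> {A. A \<subseteq> Inl ` space M \<union> range Inr \<and> Inl -` A \<in> sets M \<and> Inr -` A \<in> sets borel}"
  then have s: "Inl -` s \<in> sets M" "Inr -` s \<in> sets borel" by auto
  have "Inl -` (Inl ` space M \<union> range Inr - s) = space M - Inl -` s"
    "Inr -` (Inl ` space M \<union> range Inr - s) = - Inr -` s" by auto
  then show "Inl ` space M \<union> range Inr - s \<in>
    {A. A \<subseteq> Inl ` space M \<union> range Inr \<and> Inl -` A \<in> sets M \<and> Inr -` A \<in> sets borel}"
    using s by (simp add: borel_comp)
next
  fix A :: "nat \<Rightarrow> ('a + real) set"
  assume "range A \<subseteq> {A. A \<subseteq> Inl ` space M \<union> range Inr \<and> Inl -` A \<in> sets M \<and> Inr -` A \<in> sets borel}"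
  then show "(\<Union>i. A i) \<in> {A. A \<subseteq> Inl ` space M \<union> range Inr \<and> Inl -` A \<in> sets M \<and> Inr -` A \<in> sets borel}"
    by (auto simp: vimage_Union image_subset_iff)
qed auto

lemma space_ext: "space (ext_measure M) = Inl ` space M \<union> range Inr"
  unfolding ext_measure_def by (rule space_measure_of) auto

lemma sets_ext: "A \<in> sets (ext_measure M) \<longleftrightarrow>
    A \<subseteq> Inl ` space M \<union> range Inr \<and> Inl -` A \<in> sets M \<and> Inr -` A \<in> sets borel"
  unfolding ext_measure_def by (simp add: sigma_algebra.sets_measure_of_eq[OF ext_algebra])

lemma emeasure_ext:
  assumes "A \<in> sets (ext_measure M)"
  shows "emeasure (ext_measure M) A = emeasure M (Inl -` A) + emeasure lborel (Inr -` A)"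
  unfolding ext_measure_def
proof (rule emeasure_measure_of_sigma[OF ext_algebra])
  let ?S = "{A. A \<subseteq> Inl ` space M \<union> range Inr \<and> Inl -` A \<in> sets M \<and> Inr -` A \<in> sets (borel :: real measure)}"
  show "positive ?S (\<lambda>A. emeasure M (Inl -` A) + emeasure lborel (Inr -` A))"
    by (simp add: positive_def)
  show "countably_additive ?S (\<lambda>A. emeasure M (Inl -` A) + emeasure lborel (Inr -` A))"
  proof (rule countably_additiveI)
    fix A :: "nat \<Rightarrow> ('a + real) set"
    assume A: "range A \<subseteq> ?S" and d: "disjoint_family A"
    have d1: "disjoint_family (\<lambda>i. Inl -` A i)" "disjoint_family (\<lambda>i. Inr -` A i)"
      using d unfolding disjoint_family_on_def by blast+
    have "(\<Sum>i. emeasure M (Inl -` A i) + emeasure lborel (Inr -` A i))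
      = (\<Sum>i. emeasure M (Inl -` A i)) + (\<Sum>i. emeasure lborel (Inr -` A i))"
      by (rule suminf_add[symmetric]) auto
    also have "(\<Sum>i. emeasure M (Inl -` A i)) = emeasure M (\<Union>i. Inl -` A i)"
      by (rule suminf_emeasure[OF _ d1(1)]) (use A in auto)
    also have "(\<Sum>i. emeasure lborel (Inr -` A i)) = emeasure lborel (\<Union>i. Inr -` A i)"
      by (rule suminf_emeasure[OF _ d1(2)]) (use A in auto)
    finally show "(\<Sum>i. emeasure M (Inl -` A i) + emeasure lborel (Inr -` A i)) =
       emeasure M (Inl -` \<Union>(range A)) + emeasure lborel (Inr -` \<Union>(range A))"
      by (simp add: vimage_Union)
  qed
qed (use assms in \<open>simp add: sets_ext\<close>)

lemma emeasure_space_ext: "emeasure (ext_measure M) (space (ext_measure M)) = \<infinity>"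
proof -
  have "Inl -` space (ext_measure M) = space M" "Inr -` space (ext_measure M) = UNIV" by (auto simp: space_ext)
  then show ?thesis by (simp add: emeasure_ext)
qed

lemma sigma_finite_ext:
  assumes "sigma_finite_measure M"
  shows "sigma_finite_measure (ext_measure M)"
proof
  interpret sigma_finite_measure M by fact
  obtain D :: "nat \<Rightarrow> 'a set" where D: "range D \<subseteq> sets M" "(\<Union>i. D i) = space M" "\<And>i. emeasure M (D i) \<noteq> \<infinity>"
    using sigma_finite by blast
  define E :: "nat \<Rightarrow> ('a + real) set" where "E n = Inl ` D n \<union> Inr ` {- real n..real n}" for n
  have vim: "Inl -` E n = D n" "Inr -` E n = {- real n..real n}" for n by (auto simp: E_def)
  have Es: "E n \<in> sets (ext_measure M)" for n
    using D(1) sets.sets_into_space[of "D n" M] by (auto simp: sets_ext vim) (auto simp: E_def)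
  show "\<exists>A. countable A \<and> A \<subseteq> sets (ext_measure M) \<and> \<Union>A = space (ext_measure M) \<and> (\<forall>a\<in>A. emeasure (ext_measure M) a \<noteq> \<infinity>)"
  proof (intro exI conjI ballI)
    show "range E \<subseteq> sets (ext_measure M)" using Es by auto
    have "Inr x \<in> \<Union>(range E)" for x
    proof -
      obtain n :: nat where "\<bar>x\<bar> \<le> real n" using real_arch_simple by blast
      then show ?thesis by (auto simp: E_def abs_le_iff intro!: exI[of _ n])
    qed
    moreover have "Inl x \<in> \<Union>(range E)" if "x \<in> space M" for x
      using that D(2) by (force simp: E_def)
    ultimately have "space (ext_measure M) \<subseteq> \<Union>(range E)" by (auto simp: space_ext)
    moreover have "\<Union>(range E) \<subseteq> space (ext_measure M)" by (intro UN_least sets.sets_into_space Es)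
    ultimately show "\<Union>(range E) = space (ext_measure M)" by blast
    show "emeasure (ext_measure M) a \<noteq> \<infinity>" if "a \<in> range E" for a
      using that D(3) Es by (auto simp: emeasure_ext vim)
  qed simp
qed

lemma measurable_Inl_ext: "Inl \<in> measurable M (ext_measure M)"
  by (rule measurableI) (auto simp: space_ext sets_ext Int_absorb2 dest: sets.sets_into_space)

lemma range_Inl_sets: "range Inl \<inter> space (ext_measure M) \<in> sets (ext_measure M)"
proof -
  have "Inl -` (range Inl \<inter> space (ext_measure M)) = space M"
    "Inr -` (range Inl \<inter> space (ext_measure M)) = {}" by (auto simp: space_ext)
  then show ?thesis by (auto simp: sets_ext space_ext)
qed

text \<open>This reduces integrals over the square of the extension, for functions supported on the
  original square, to integrals over the original square. It holds on one factor by inspection of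
  the sets and passes to the product because both sides factor.\<close>

lemma ext_pair_distr:
  assumes "sigma_finite_measure M"
  shows "distr (sq M) (sq (ext_measure M)) (\<lambda>z. (Inl (fst z), Inl (snd z)))
    = density (sq (ext_measure M)) (\<lambda>z. ennreal (indicator (range Inl \<times> range Inl) z))"
proof -
  interpret E: sigma_finite_measure "ext_measure M" by (rule sigma_finite_ext[OF assms])
  note R = range_Inl_sets[of M]
  have Rm [measurable]: "(indicator (range Inl) :: 'a + real \<Rightarrow> ennreal) \<in> borel_measurable (ext_measure M)"
    using R by (simp add: borel_measurable_indicator_iff)
  have d: "distr M (ext_measure M) Inl = density (ext_measure M) (indicator (range Inl))"
  proof (rule measure_eqI)
    fix A assume "A \<in> sets (distr M (ext_measure M) Inl)"
    then have A: "A \<in> sets (ext_measure M)" by simp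
    have AR: "A \<inter> range Inl \<in> sets (ext_measure M)"
    proof -
      have "A \<inter> range Inl = A \<inter> (range Inl \<inter> space (ext_measure M))"
        using sets.sets_into_space[OF A] by blast
      then show ?thesis using A R by simp
    qed
    have "Inl -` (A \<inter> range Inl) = Inl -` A" "Inr -` (A \<inter> range Inl) = {}" by auto
    moreover have "Inl -` A \<inter> space M = Inl -` A" using A sets.sets_into_space by (auto simp: sets_ext)
    ultimately show "emeasure (distr M (ext_measure M) Inl) A = emeasure (density (ext_measure M) (indicator (range Inl))) A"
      using A AR emeasure_ext[OF AR]
      by (simp add: emeasure_distr measurable_Inl_ext emeasure_density indicator_inter_arith[symmetric] mult.commute Int_commute)
  qed simp
  have s: "sigma_finite_measure (density (ext_measure M) (indicator (range Inl)))"
    by (subst E.sigma_finite_iff_density_finite) (auto simp: indicator_def)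
  have "distr M (ext_measure M) Inl \<Otimes>\<^sub>M distr M (ext_measure M) Inl
    = distr (sq M) (sq (ext_measure M)) (\<lambda>z. (Inl (fst z), Inl (snd z)))"
    using s by (subst pair_measure_distr[OF measurable_Inl_ext measurable_Inl_ext]) (auto simp: d case_prod_beta')
  moreover have "density (ext_measure M) (indicator (range Inl)) \<Otimes>\<^sub>M density (ext_measure M) (indicator (range Inl))
    = density (sq (ext_measure M)) (\<lambda>(x, y). indicator (range Inl) x * indicator (range Inl) y)"
    by (rule pair_measure_density[OF Rm Rm E.sigma_finite_measure_axioms s])
  moreover have "(\<lambda>(x, y). indicator (range Inl) x * indicator (range Inl) y)
     = (\<lambda>z :: ('a + real) \<times> ('a + real). ennreal (indicator (range Inl \<times> range Inl) z))"
    by (auto simp: fun_eq_iff indicator_def)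
  ultimately show ?thesis by (simp add: d)
qed

lemma measurable_ext_pair_Inl:
  "(\<lambda>z. (Inl (fst z), Inl (snd z))) \<in> measurable (sq M) (sq (ext_measure M))"
  by (intro measurable_Pair measurable_compose[OF measurable_fst measurable_Inl_ext]
    measurable_compose[OF measurable_snd measurable_Inl_ext])

lemma
  assumes M: "sigma_finite_measure M" and H: "H \<in> borel_measurable (sq (ext_measure M))"
    and H0: "\<And>z. z \<notin> range Inl \<times> range Inl \<Longrightarrow> H z = (0::real)"
  shows ext_pair_integrable_iff: "integrable (sq (ext_measure M)) H \<longleftrightarrow>
      integrable (sq M) (\<lambda>z. H (Inl (fst z), Inl (snd z)))"
    and ext_pair_integral: "(LINT z|sq (ext_measure M). H z) =
      (LINT z|sq M. H (Inl (fst z), Inl (snd z)))"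
proof -
  let ?E = "sq (ext_measure M)"
  have fstE: "indicat_real (range Inl \<times> range Inl) \<in> borel_measurable ?E"
  proof -
    have "(range Inl \<times> range Inl) \<inter> space ?E = (range Inl \<inter> space (ext_measure M)) \<times> (range Inl \<inter> space (ext_measure M))"
      by (auto simp: space_pair_measure)
    then show ?thesis using range_Inl_sets[of M] by (simp add: borel_measurable_indicator_iff)
  qed
  have eq: "(\<lambda>z. indicator (range Inl \<times> range Inl) z *\<^sub>R H z) = H"
    using H0 by (auto simp: indicator_def fun_eq_iff)
  have "integrable ?E H \<longleftrightarrow> integrable (density ?E (\<lambda>z. ennreal (indicator (range Inl \<times> range Inl) z))) H"
    using H fstE by (subst integrable_density) (auto simp: eq[unfolded real_scaleR_def])
  also have "\<dots> \<longleftrightarrow> integrable (sq M) (\<lambda>z. H (Inl (fst z), Inl (snd z)))"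
    unfolding ext_pair_distr[OF M, symmetric] by (rule integrable_distr_eq[OF measurable_ext_pair_Inl H])
  finally show "integrable ?E H \<longleftrightarrow> integrable (sq M) (\<lambda>z. H (Inl (fst z), Inl (snd z)))" .
  have "(LINT z|?E. H z) = (LINT z|density ?E (\<lambda>z. ennreal (indicator (range Inl \<times> range Inl) z)). H z)"
    using H fstE by (subst integral_density) (auto simp: eq[unfolded real_scaleR_def])
  also have "\<dots> = (LINT z|sq M. H (Inl (fst z), Inl (snd z)))"
    unfolding ext_pair_distr[OF M, symmetric] by (rule integral_distr[OF measurable_ext_pair_Inl H])
  finally show "(LINT z|?E. H z) = (LINT z|sq M. H (Inl (fst z), Inl (snd z)))" .
qed

lemma ext_fun_simps [simp]:
  "ext_fun W (Inl x) (Inl y) = W x y" "ext_fun W (Inr a) v = 0" "ext_fun W u (Inr b) = 0"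
  by (auto simp: ext_fun_def split: sum.split)

text \<open>Where both coordinates lie in the original space, \<open>ext_fun W\<close> is
  \<open>W\<close> composed with a measurable retraction of the extension. The retraction sends the
  added line to a point \<open>x0\<close>, hence the separate treatment of an empty space.\<close>

lemma ext_fun_measurable:
  assumes W: "(\<lambda>z. W (fst z) (snd z)) \<in> borel_measurable (sq M)"
  shows "(\<lambda>z. ext_fun W (fst z) (snd z)) \<in> borel_measurable (sq (ext_measure M))"
proof (cases "space M = {}")
  case True
  have "(\<lambda>z. ext_fun W (fst z) (snd z)) \<in> borel_measurable (sq (ext_measure M))
    \<longleftrightarrow> (\<lambda>z. 0::real) \<in> borel_measurable (sq (ext_measure M))"
    using True by (intro measurable_cong) (auto simp: space_pair_measure space_ext)
  then show ?thesis by simp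
next
  case False
  then obtain x0 where x0: "x0 \<in> space M" by blast
  let ?E = "ext_measure M"
  define p where "p = case_sum id (\<lambda>_::real. x0)"
  have pm [measurable]: "p \<in> measurable ?E M"
  proof (rule measurableI)
    fix A assume A: "A \<in> sets M"
    have "Inl -` (p -` A \<inter> space ?E) = A" "Inr -` (p -` A \<inter> space ?E) = (if x0 \<in> A then UNIV else {})"
      using sets.sets_into_space[OF A] by (auto simp: p_def space_ext)
    then show "p -` A \<inter> space ?E \<in> sets ?E" using A by (auto simp: sets_ext space_ext)
  qed (use x0 in \<open>auto simp: p_def space_ext\<close>)
  have [measurable]: "Measurable.pred ?E isl"
  proof -
    have "Inl -` {x \<in> space ?E. isl x} = space M" "Inr -` {x \<in> space ?E. isl x} = {}" by (auto simp: space_ext)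
    then have "{x \<in> space ?E. isl x} \<in> sets ?E" by (auto simp: sets_ext space_ext)
    then show ?thesis by (simp add: pred_def)
  qed
  have "(\<lambda>z. (p (fst z), p (snd z))) \<in> measurable (sq ?E) (sq M)" by measurable
  from measurable_compose[OF this W] have [measurable]:
    "(\<lambda>z. W (p (fst z)) (p (snd z))) \<in> borel_measurable (sq ?E)" by simp
  have "(\<lambda>z. ext_fun W (fst z) (snd z)) = (\<lambda>z. if isl (fst z) \<and> isl (snd z) then W (p (fst z)) (p (snd z)) else 0)"
    by (auto simp: fun_eq_iff ext_fun_def p_def split: sum.splits)
  then show ?thesis by (simp only:) measurable
qed

lemma
  assumes M: "sigma_finite_measure M" and W: "gintegrable M W"
  shows gintegrable_ext_fun: "gintegrable (ext_measure M) (ext_fun W)"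
    and L1_norm_ext_fun: "L1_norm (ext_measure M) (ext_fun W) = L1_norm M W"
proof -
  have m: "(\<lambda>z. ext_fun W (fst z) (snd z)) \<in> borel_measurable (sq (ext_measure M))"
    using W by (intro ext_fun_measurable) auto
  have z: "ext_fun W (fst z) (snd z) = 0" if "z \<notin> range Inl \<times> range Inl" for z
    using that by (cases z; cases "fst z"; cases "snd z") auto
  show "gintegrable (ext_measure M) (ext_fun W)"
    using ext_pair_integrable_iff[OF M m z] W by simp
  show "L1_norm (ext_measure M) (ext_fun W) = L1_norm M W"
    unfolding L1_norm_def using ext_pair_integral[OF M borel_measurable_abs[OF m]] z by simp
qed

text \<open>The added line joins the background, so the extension changes neither the weights nor
  the masses of the other labels.\<close>

definition ext_label :: "('a \<Rightarrow> nat) \<Rightarrow> 'a + real \<Rightarrow> nat" where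
  "ext_label \<sigma> = case_sum \<sigma> (\<lambda>_. 0)"

lemma ext_label_simps [simp]: "ext_label \<sigma> (Inl x) = \<sigma> x" "ext_label \<sigma> (Inr t) = 0"
  by (auto simp: ext_label_def)

lemma ext_label_sets:
  assumes "\<sigma> -` A \<inter> space M \<in> sets M"
  shows "ext_label \<sigma> -` A \<inter> space (ext_measure M) \<in> sets (ext_measure M)"
proof -
  have "Inl -` (ext_label \<sigma> -` A \<inter> space (ext_measure M)) = \<sigma> -` A \<inter> space M"
    "Inr -` (ext_label \<sigma> -` A \<inter> space (ext_measure M)) = (if 0 \<in> A then UNIV else {})"
    by (auto simp: space_ext)
  then show ?thesis using assms by (auto simp: sets_ext space_ext)
qed

lemma emeasure_ext_label:
  assumes "\<sigma> -` A \<inter> space M \<in> sets M" "0 \<notin> A"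
  shows "emeasure (ext_measure M) (ext_label \<sigma> -` A \<inter> space (ext_measure M)) = emeasure M (\<sigma> -` A \<inter> space M)"
proof -
  have "Inl -` (ext_label \<sigma> -` A \<inter> space (ext_measure M)) = \<sigma> -` A \<inter> space M"
    "Inr -` (ext_label \<sigma> -` A \<inter> space (ext_measure M)) = {}"
    using assms(2) by (auto simp: space_ext)
  then show ?thesis using emeasure_ext[OF ext_label_sets[OF assms(1)]] by simp
qed

lemma finite_labelling_ext:
  assumes "finite_labelling M \<sigma> K"
  shows "finite_labelling (ext_measure M) (ext_label \<sigma>) K"
proof -
  have \<sigma>: "\<sigma> \<in> measurable M (count_space UNIV)" using assms by (simp add: finite_labelling_def)
  have s: "\<sigma> -` A \<inter> space M \<in> sets M" for A using \<sigma> by (rule measurable_sets) simp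
  have "{x \<in> space (ext_measure M). ext_label \<sigma> x \<noteq> 0} = ext_label \<sigma> -` (- {0}) \<inter> space (ext_measure M)"
    "{x \<in> space M. \<sigma> x \<noteq> 0} = \<sigma> -` (- {0}) \<inter> space M" by auto
  then have "emeasure (ext_measure M) {x \<in> space (ext_measure M). ext_label \<sigma> x \<noteq> 0} < \<infinity>"
    using assms emeasure_ext_label[OF s, of "- {0}"] by (simp add: finite_labelling_def)
  moreover have "ext_label \<sigma> \<in> measurable (ext_measure M) (count_space UNIV)"
    using ext_label_sets[OF s] by (simp add: measurable_count_space_eq2_countable)
  moreover have "\<forall>x\<in>space (ext_measure M). ext_label \<sigma> x \<le> K"
    using assms by (auto simp: space_ext finite_labelling_def)
  ultimately show ?thesis by (simp add: finite_labelling_def)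
qed

lemma L1_norm_ext_step:
  assumes M: "sigma_finite_measure M" and W: "gintegrable M W"
    and \<sigma>: "finite_labelling M \<sigma> K" and u: "label_weights K u"
  shows "L1_norm (ext_measure M) (\<lambda>x y. ext_fun W x y - u (ext_label \<sigma> x) (ext_label \<sigma> y))
    = L1_norm M (\<lambda>x y. W x y - u (\<sigma> x) (\<sigma> y))"
proof -
  have u0: "u 0 i = 0" "u i 0 = 0" for i using u unfolding label_weights_def by fastforce+
  have "(\<lambda>x y. ext_fun W x y - u (ext_label \<sigma> x) (ext_label \<sigma> y)) = ext_fun (\<lambda>x y. W x y - u (\<sigma> x) (\<sigma> y))"
    by (auto simp: fun_eq_iff ext_fun_def ext_label_def u0 split: sum.split)
  then show ?thesis
    using L1_norm_ext_fun[OF M] W label_weights_integrable[OF M \<sigma> u] by simp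
qed

section \<open>Splitting Lebesgue measure\<close>

text \<open>The mass of \<open>A\<close> within distance \<open>t\<close> of the origin is
  2-Lipschitz in \<open>t\<close>, starts at 0 and tends to the mass of \<open>A\<close>, so it
  takes every smaller value. The full mass need not be attained at a finite \<open>t\<close>, hence
  the case distinction.\<close>

lemma lborel_subset_of_measure:
  fixes A :: "real set"
  assumes A: "A \<in> sets lborel" and c: "0 \<le> c" "ennreal c \<le> emeasure lborel A"
  obtains B where "B \<in> sets lborel" "B \<subseteq> A" "emeasure lborel B = ennreal c"
proof (cases "emeasure lborel A = ennreal c")
  case True
  then show ?thesis using that[of A] A by simp
next
  case False
  then have less: "ennreal c < emeasure lborel A" using c by simp
  define I where "I t = A \<inter> {-t..t}" for t :: real
  define f where "f t = measure lborel (I t)" for t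
  have Im: "I t \<in> sets lborel" for t using A by (simp add: I_def)
  have fin: "emeasure lborel (I t) < \<infinity>" for t
  proof (rule le_less_trans)
    show "emeasure lborel (I t) \<le> emeasure lborel {-t..t}" by (rule emeasure_mono) (auto simp: I_def)
  qed (simp add: emeasure_lborel_Icc_eq)
  have fm: "I t \<in> fmeasurable lborel" for t using Im fin by (intro fmeasurableI)
  have ef: "emeasure lborel (I t) = ennreal (f t)" for t
    unfolding f_def using fin[of t] by (intro emeasure_eq_ennreal_measure) auto
  have lip: "\<bar>f t - f s\<bar> \<le> 2 * \<bar>t - s\<bar>" if "s \<le> t" for s t
  proof -
    have fmi: "{a..b} \<in> fmeasurable lborel" for a b :: real by (intro fmeasurableI) (auto simp: emeasure_lborel_Icc_eq)
    have "f s \<le> f t" unfolding f_def by (intro measure_mono_fmeasurable Im fm) (use that in \<open>auto simp: I_def\<close>)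
    moreover have "f t \<le> f s + measure lborel ({-t..-s} \<union> {s..t})"
    proof -
      have "f t \<le> measure lborel (I s \<union> ({-t..-s} \<union> {s..t}))"
        unfolding f_def by (intro measure_mono_fmeasurable fmeasurable.Un fm fmi Im) (use that in \<open>auto simp: I_def\<close>)
      also have "\<dots> \<le> f s + measure lborel ({-t..-s} \<union> {s..t})"
        unfolding f_def by (intro measure_Un_le) (use Im in auto)
      finally show ?thesis .
    qed
    moreover have "measure lborel ({-t..-s} \<union> {s..t}) \<le> measure lborel {-t..-s} + measure lborel {s..t}"
      by (intro measure_Un_le) auto
    moreover have "measure lborel {-t..-s} + measure lborel {s..t} = 2 * (t - s)" using that by simp
    ultimately show ?thesis using that by simp
  qed
  have "continuous_on UNIV f"
  proof (rule continuous_onI)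
    fix x e :: real assume "0 < e"
    show "\<exists>d>0. \<forall>x'\<in>UNIV. dist x' x < d \<longrightarrow> dist (f x') (f x) \<le> e"
    proof (intro exI[of _ "e / 2"] conjI ballI impI)
      fix x' assume "dist x' x < e / 2"
      then show "dist (f x') (f x) \<le> e"
        using lip[of x x'] lip[of x' x] by (cases "x \<le> x'") (auto simp: dist_real_def)
    qed (use \<open>0 < e\<close> in simp)
  qed
  then have cont: "continuous_on {a..b} f" for a b by (rule continuous_on_subset) simp
  have "I 0 \<subseteq> {0}" by (auto simp: I_def)
  then have "emeasure lborel (I 0) \<le> emeasure lborel {0::real}" by (intro emeasure_mono) auto
  then have f0: "f 0 = 0" by (simp add: f_def measure_def)
  have "(\<lambda>n. emeasure lborel (I (real n))) \<longlonglongrightarrow> emeasure lborel (\<Union>n. I (real n))"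
    by (intro Lim_emeasure_incseq) (use Im in \<open>auto simp: I_def incseq_def\<close>)
  moreover have "(\<Union>n. I (real n)) = A"
  proof -
    have "\<exists>n. x \<in> I (real n)" if "x \<in> A" for x
    proof -
      obtain n :: nat where "\<bar>x\<bar> \<le> real n" using real_arch_simple by blast
      then show ?thesis using that by (auto simp: I_def abs_le_iff intro!: exI[of _ n])
    qed
    then show ?thesis by (auto simp: I_def)
  qed
  ultimately have "eventually (\<lambda>n. ennreal c < emeasure lborel (I (real n))) sequentially"
    using less by (auto intro: order_tendstoD)
  then obtain n where "ennreal c < ennreal (f (real n))"
    unfolding ef using eventually_happens'[OF sequentially_bot] by blast
  then have "c \<le> f (real n)" using c(1) by (simp add: ennreal_less_iff)
  then obtain t where "f t = c" using IVT'[of f 0 c "real n"] f0 c(1) cont by auto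
  then show ?thesis using that[of "I t"] Im ef[of t] by (auto simp: I_def)
qed

lemma lborel_split:
  fixes A :: "real set"
  assumes J: "finite J" and A: "A \<in> sets lborel" and c: "\<And>j. j \<in> J \<Longrightarrow> 0 \<le> c j"
    and le: "(\<Sum>j\<in>J. ennreal (c j)) \<le> emeasure lborel A"
  shows "\<exists>B. disjoint_family_on B J \<and> (\<forall>j\<in>J. B j \<in> sets lborel \<and> B j \<subseteq> A \<and> emeasure lborel (B j) = ennreal (c j))"
  using J c le
proof (induction J)
  case (insert i J)
  have "(\<Sum>j\<in>J. ennreal (c j)) \<le> emeasure lborel A"
  proof (rule order_trans[OF _ insert.prems(2)])
    show "(\<Sum>j\<in>J. ennreal (c j)) \<le> (\<Sum>j\<in>insert i J. ennreal (c j))"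
      using insert.hyps by (intro sum_mono2) auto
  qed
  then obtain B where B: "disjoint_family_on B J"
    "\<And>j. j \<in> J \<Longrightarrow> B j \<in> sets lborel \<and> B j \<subseteq> A \<and> emeasure lborel (B j) = ennreal (c j)"
    using insert.IH insert.prems(1) by (metis insert_iff)
  define D where "D = (\<Union>j\<in>J. B j)"
  have D: "D \<in> sets lborel" "D \<subseteq> A" using B(2) insert.hyps unfolding D_def by auto
  have eD: "emeasure lborel D = (\<Sum>j\<in>J. ennreal (c j))"
    unfolding D_def using B insert.hyps by (subst sum_emeasure[symmetric]) auto
  have "emeasure lborel A = emeasure lborel D + emeasure lborel (A - D)"
    using D A by (subst plus_emeasure) (auto simp: Un_absorb1)
  then have "ennreal (c i) + (\<Sum>j\<in>J. ennreal (c j)) \<le> emeasure lborel (A - D) + (\<Sum>j\<in>J. ennreal (c j))"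
    using insert.prems(2) insert.hyps eD by (simp add: add.commute)
  \<comment> \<open>Cancellation in \<open>ennreal\<close> is allowed because the sum carved off so
    far is finite; \<open>A\<close> itself may have infinite mass.\<close>
  moreover have "(\<Sum>j\<in>J. ennreal (c j)) \<noteq> top" using insert.hyps by simp
  ultimately have "ennreal (c i) \<le> emeasure lborel (A - D)"
    by (simp add: add.commute ennreal_add_left_cancel_le)
  moreover have "A - D \<in> sets lborel" using A D by blast
  ultimately obtain E where E: "E \<in> sets lborel" "E \<subseteq> A - D" "emeasure lborel E = ennreal (c i)"
    using lborel_subset_of_measure[of "A - D" "c i"] insert.prems(1) by blast
  have BB: "(B(i := E)) j = B j" if "j \<in> J" for j using that insert.hyps by auto
  show ?case
  proof (intro exI[of _ "B(i := E)"] conjI ballI)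
    have "E \<inter> B j = {}" if "j \<in> J" for j using E(2) that by (auto simp: D_def)
    then show "disjoint_family_on (B(i := E)) (insert i J)"
      using B(1) insert.hyps unfolding disjoint_family_on_def by (auto simp: Int_commute)
  qed (use B(2) BB E in auto)
qed (auto simp: disjoint_family_on_def)

text \<open>Masses are prescribed for the cells with \<open>j \<ge> 1\<close> only, and what remains
  of each fiber of \<open>s\<close> receives label 0. Thus the background of infinite mass is
  refined like every other fiber.\<close>

lemma lborel_refine_labelling:
  fixes s :: "real \<Rightarrow> nat"
  assumes s: "finite_labelling lborel s K1" and c: "\<And>i j. 0 \<le> c i j"
    and le: "\<And>i. i \<le> K1 \<Longrightarrow> (\<Sum>j\<in>{1..K2}. ennreal (c i j)) \<le> emeasure lborel (fiber lborel s i)"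
  shows "\<exists>t. finite_labelling lborel t K2 \<and>
    (\<forall>i\<le>K1. \<forall>j\<in>{1..K2}. emeasure lborel (fiber lborel s i \<inter> fiber lborel t j) = ennreal (c i j))"
proof -
  have sm: "s \<in> measurable lborel (count_space UNIV)" and sK: "s x \<le> K1" for x
    using s by (auto simp: finite_labelling_def)
  have "\<exists>B. disjoint_family_on B {1..K2} \<and> (\<forall>j\<in>{1..K2}. B j \<in> sets lborel \<and> B j \<subseteq> fiber lborel s i \<and> emeasure lborel (B j) = ennreal (c i j))"
    if "i \<le> K1" for i
    by (rule lborel_split) (use measurable_sets[OF sm, of "{i}"] le[OF that] c in auto)
  then obtain B where Bd: "\<And>i. i \<le> K1 \<Longrightarrow> disjoint_family_on (B i) {1..K2}"
    and B: "\<And>i j. i \<le> K1 \<Longrightarrow> j \<in> {1..K2} \<Longrightarrow> B i j \<in> sets lborel \<and> B i j \<subseteq> fiber lborel s i \<and> emeasure lborel (B i j) = ennreal (c i j)"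
    by metis
  \<comment> \<open>The pieces \<open>B i j\<close> within a fiber are disjoint, so the description
    is unique; points outside all pieces get the background label 0.\<close>
  define t where "t x = (if \<exists>j\<in>{1..K2}. x \<in> B (s x) j then (THE j. j \<in> {1..K2} \<and> x \<in> B (s x) j) else 0)" for x
  have t_eq: "t x = j \<longleftrightarrow> x \<in> B (s x) j" if j: "j \<in> {1..K2}" for x j
  proof (cases "\<exists>j\<in>{1..K2}. x \<in> B (s x) j")
    case True
    then obtain j' where j': "j' \<in> {1..K2}" "x \<in> B (s x) j'" by blast
    have uniq: "k = j'" if "k \<in> {1..K2}" "x \<in> B (s x) k" for k
      using Bd[OF sK[of x]] that j' unfolding disjoint_family_on_def by blast
    have "(THE j. j \<in> {1..K2} \<and> x \<in> B (s x) j) = j'" by (rule the_equality) (use j' uniq in blast)+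
    then have "t x = j'" using True by (simp add: t_def)
    then show ?thesis using j' uniq[OF j] by blast
  next
    case False
    then show ?thesis using j by (auto simp: t_def)
  qed
  have tK: "t x \<le> K2" for x
  proof (cases "\<exists>j\<in>{1..K2}. x \<in> B (s x) j")
    case True
    then obtain j where "j \<in> {1..K2}" "x \<in> B (s x) j" by blast
    then have "t x = j" using t_eq[of j x] by blast
    then show ?thesis using \<open>j \<in> {1..K2}\<close> by simp
  qed (simp add: t_def)
  have fib: "fiber lborel t j = (\<Union>i\<le>K1. B i j)" if j: "j \<in> {1..K2}" for j
  proof (rule set_eqI)
    fix x
    have "x \<in> (\<Union>i\<le>K1. B i j) \<longleftrightarrow> x \<in> B (s x) j" using B[OF _ j] sK[of x] by blast
    then show "x \<in> fiber lborel t j \<longleftrightarrow> x \<in> (\<Union>i\<le>K1. B i j)" using t_eq[OF j, of x] by simp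
  qed
  have inter: "fiber lborel s i \<inter> fiber lborel t j = B i j" if "i \<le> K1" "j \<in> {1..K2}" for i j
  proof (rule set_eqI)
    fix x
    have "x \<in> B i j \<longleftrightarrow> s x = i \<and> x \<in> B (s x) j" using B[OF that] by blast
    then show "x \<in> fiber lborel s i \<inter> fiber lborel t j \<longleftrightarrow> x \<in> B i j" using t_eq[OF that(2), of x] by auto
  qed
  have fibm: "fiber lborel t j \<in> sets lborel" if "j \<noteq> 0" for j
  proof (cases "j \<le> K2")
    case True
    then have j: "j \<in> {1..K2}" using that by auto
    show ?thesis unfolding fib[OF j] using B[OF _ j] by (intro sets.finite_UN) auto
  next
    case False
    then have "fiber lborel t j = {}" using tK by auto
    then show ?thesis by simp
  qed
  have nz: "{x \<in> space lborel. t x \<noteq> 0} = (\<Union>j\<in>{1..K2}. fiber lborel t j)"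
    using tK by (auto simp: Suc_le_eq)
  have nzm: "{x \<in> space lborel. t x \<noteq> 0} \<in> sets lborel"
    unfolding nz by (intro sets.finite_UN fibm) auto
  have "fiber lborel t j \<in> sets lborel" for j
  proof (cases "j = 0")
    case True
    then have "fiber lborel t j = space lborel - {x \<in> space lborel. t x \<noteq> 0}" by auto
    then show ?thesis using nzm by (simp only: sets.compl_sets)
  qed (rule fibm)
  then have tm: "t \<in> measurable lborel (count_space UNIV)"
    by (subst measurable_count_space_eq2_countable) auto
  have "emeasure lborel {x \<in> space lborel. t x \<noteq> 0} < \<infinity>"
  proof -
    have "emeasure lborel (fiber lborel t j) < \<infinity>" if j: "j \<in> {1..K2}" for j
    proof -
      have "emeasure lborel (fiber lborel t j) \<le> (\<Sum>i\<le>K1. emeasure lborel (B i j))"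
        unfolding fib[OF j] using B[OF _ j] by (intro emeasure_subadditive_finite) auto
      also have "\<dots> < \<infinity>" using B[OF _ j] by (simp add: less_top[symmetric])
      finally show ?thesis .
    qed
    moreover have "emeasure lborel {x \<in> space lborel. t x \<noteq> 0} \<le> (\<Sum>j\<in>{1..K2}. emeasure lborel (fiber lborel t j))"
      unfolding nz using fibm by (intro emeasure_subadditive_finite) auto
    ultimately show ?thesis using ennreal_sum_less_top[of "{1..K2}" "\<lambda>j. emeasure lborel (fiber lborel t j)"]
      by (auto simp only: infinity_ennreal_def finite_atLeastAtMost intro: le_less_trans)
  qed
  then have "finite_labelling lborel t K2" using tm tK by (simp add: finite_labelling_def)
  moreover have "emeasure lborel (fiber lborel s i \<inter> fiber lborel t j) = ennreal (c i j)"
    if "i \<le> K1" "j \<in> {1..K2}" for i j using inter[OF that] B[OF that] by simp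
  ultimately show ?thesis by blast
qed

section \<open>Realising step functions on the line\<close>

definition step_approx :: "'a measure \<Rightarrow> ('a \<Rightarrow> 'a \<Rightarrow> real) \<Rightarrow> ('a \<Rightarrow> nat) \<Rightarrow> nat \<Rightarrow> (nat \<Rightarrow> nat \<Rightarrow> real) \<Rightarrow> real \<Rightarrow> bool" where
  "step_approx M W \<sigma> K u e \<longleftrightarrow> finite_labelling M \<sigma> K \<and> label_weights K u
     \<and> L1_norm M (\<lambda>x y. W x y - u (\<sigma> x) (\<sigma> y)) \<le> e"

text \<open>The background is exempt: on the line it always has infinite mass, whereas that of
  \<open>M\<close> may be finite. Step functions do not see the difference, since their weights
  vanish there.\<close>

definition realises :: "'a measure \<Rightarrow> ('a \<Rightarrow> nat) \<Rightarrow> nat \<Rightarrow> (real \<Rightarrow> nat) \<Rightarrow> bool" where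
  "realises M \<sigma> K s \<longleftrightarrow> finite_labelling lborel s K
     \<and> (\<forall>i\<in>{1..K}. emeasure lborel (fiber lborel s i) = emeasure M (fiber M \<sigma> i))"

lemma finite_labelling_sets:
  "finite_labelling M \<sigma> K \<Longrightarrow> \<sigma> -` A \<inter> space M \<in> sets M"
  unfolding finite_labelling_def by (auto intro: measurable_sets)

lemma emeasure_fiber_sum:
  assumes \<sigma>: "finite_labelling M \<sigma> K" and B: "B \<in> sets M"
  shows "emeasure M B = (\<Sum>i\<le>K. emeasure M (fiber M \<sigma> i \<inter> B))"
proof -
  have "B = (\<Union>i\<le>K. fiber M \<sigma> i \<inter> B)"
    using \<sigma> sets.sets_into_space[OF B] by (auto simp: finite_labelling_def)
  then have "emeasure M B = emeasure M (\<Union>i\<le>K. fiber M \<sigma> i \<inter> B)" by simp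
  also have "\<dots> = (\<Sum>i\<le>K. emeasure M (fiber M \<sigma> i \<inter> B))"
    by (rule sum_emeasure[symmetric])
       (use B finite_labelling_sets[OF \<sigma>] in \<open>auto simp: disjoint_family_on_def\<close>)
  finally show ?thesis .
qed

lemma emeasure_fiber_0:
  assumes \<sigma>: "finite_labelling M \<sigma> K" and inf: "emeasure M (space M) = \<infinity>"
  shows "emeasure M (fiber M \<sigma> 0) = \<infinity>"
proof -
  have "fiber M \<sigma> 0 \<union> {x \<in> space M. \<sigma> x \<noteq> 0} = space M" by auto
  moreover have "{x \<in> space M. \<sigma> x \<noteq> 0} = \<sigma> -` (- {0}) \<inter> space M" by auto
  ultimately have "emeasure M (space M) \<le> emeasure M (fiber M \<sigma> 0) + emeasure M {x \<in> space M. \<sigma> x \<noteq> 0}"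
    using emeasure_subadditive[of "fiber M \<sigma> 0" M "{x \<in> space M. \<sigma> x \<noteq> 0}"] finite_labelling_sets[OF \<sigma>]
    by simp
  then show ?thesis using \<sigma> inf by (auto simp: finite_labelling_def top_unique)
qed

lemma fiber_above:
  assumes "finite_labelling M \<sigma> K" "K < i"
  shows "fiber M \<sigma> i = {}"
  using assms by (force simp: finite_labelling_def)

lemma label_weights_0:
  assumes "label_weights K u"
  shows "u 0 i = 0" "u i 0 = 0"
  using assms unfolding label_weights_def by fastforce+

lemma finite_labelling_Pair:
  assumes "finite_labelling M f k" "finite_labelling M g l"
  shows "(\<lambda>x. (f x, g x)) \<in> measurable M (count_space UNIV)"
proof -
  have "f \<in> measurable M (count_space UNIV)" "g \<in> measurable M (count_space UNIV)"
    using assms by (auto simp: finite_labelling_def)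
  from measurable_Pair[OF this] show ?thesis by (simp add: pair_measure_countable)
qed

lemma realises_exists:
  assumes \<sigma>: "finite_labelling M \<sigma> K"
  obtains s where "realises M \<sigma> K s"
proof -
  have 0: "finite_labelling lborel (\<lambda>_::real. 0) 0" by (simp add: finite_labelling_def)
  \<comment> \<open>The line is refined from the constant label 0, whose only fiber has infinite
    mass and so has room for any finite list of finite masses.\<close>
  define c where "c i j = (if j = 0 then 0 else measure M (fiber M \<sigma> j))" for i j :: nat
  have "fiber lborel (\<lambda>_::real. 0::nat) 0 = UNIV" by auto
  then have "(\<Sum>j\<in>{1..K}. ennreal (c i j)) \<le> emeasure lborel (fiber lborel (\<lambda>_::real. 0) i)" if "i \<le> 0" for i
    using that by simp
  note le = this
  have c0: "0 \<le> c i j" for i j by (simp add: c_def)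
  have "\<exists>s :: real \<Rightarrow> nat. finite_labelling lborel s K \<and>
      (\<forall>i\<le>0. \<forall>j\<in>{1..K}. emeasure lborel (fiber lborel (\<lambda>_. 0) i \<inter> fiber lborel s j) = ennreal (c i j))"
    by (rule lborel_refine_labelling[OF 0 c0 le])
  then obtain s :: "real \<Rightarrow> nat" where s: "finite_labelling lborel s K"
      "\<forall>i\<le>0. \<forall>j\<in>{1..K}. emeasure lborel (fiber lborel (\<lambda>_. 0) i \<inter> fiber lborel s j) = ennreal (c i j)"
    by (elim exE conjE)
  have "emeasure lborel (fiber lborel s j) = emeasure M (fiber M \<sigma> j)" if j: "j \<in> {1..K}" for j
  proof -
    have "fiber lborel (\<lambda>_::real. 0::nat) 0 \<inter> fiber lborel s j = fiber lborel s j" by auto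
    moreover have "emeasure M (fiber M \<sigma> j) = ennreal (c 0 j)"
      using finite_labelling_fiber[OF \<sigma>, of j] j by (auto simp: c_def emeasure_eq_ennreal_measure)
    ultimately show ?thesis using s(2)[rule_format, OF le_refl j] by (simp only:)
  qed
  then have "realises M \<sigma> K s" using s(1) unfolding realises_def by blast
  then show ?thesis by (rule that)
qed

lemma realises_ext:
  assumes \<sigma>: "finite_labelling M \<sigma> K"
  shows "realises (ext_measure M) (ext_label \<sigma>) K s \<longleftrightarrow> realises M \<sigma> K s"
  using emeasure_ext_label[OF finite_labelling_sets[OF \<sigma>]] by (simp add: realises_def)

text \<open>The fibers of the labelling that realises the first graphon are split in the proportions
  dictated by the coupling.\<close>

lemma realise_coupling:
  assumes M1: "sigma_finite_measure M1" and M2: "sigma_finite_measure M2"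
    and W1: "gintegrable M1 W1" and W2: "gintegrable M2 W2"
    and a1: "step_approx M1 W1 \<sigma>1 K1 u1 e1" and a2: "step_approx M2 W2 \<sigma>2 K2 u2 e2"
    and s1: "realises M1 \<sigma>1 K1 s1" and cpl: "coupling N M1 M2 \<phi>1 \<phi>2"
  obtains s2 where "realises M2 \<sigma>2 K2 s2"
    "cut_norm lborel (\<lambda>x y. u1 (s1 x) (s1 y) - u2 (s2 x) (s2 y))
      \<le> cut_norm N (\<lambda>x y. pullback W1 \<phi>1 x y - pullback W2 \<phi>2 x y) + e1 + e2"
proof -
  have N: "sigma_finite_measure N" and \<phi>1: "measure_preserving N M1 \<phi>1" and \<phi>2: "measure_preserving N M2 \<phi>2"
    using cpl by (auto simp: coupling_def)
  have \<sigma>1: "finite_labelling M1 \<sigma>1 K1" and u1: "label_weights K1 u1" and \<sigma>2: "finite_labelling M2 \<sigma>2 K2" and u2: "label_weights K2 u2"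
    and err: "L1_norm M1 (\<lambda>x y. W1 x y - u1 (\<sigma>1 x) (\<sigma>1 y)) \<le> e1" "L1_norm M2 (\<lambda>x y. W2 x y - u2 (\<sigma>2 x) (\<sigma>2 y)) \<le> e2"
    using a1 a2 by (auto simp: step_approx_def)
  have s1f: "finite_labelling lborel s1 K1" using s1 by (simp add: realises_def)
  define t1 where "t1 z = \<sigma>1 (\<phi>1 z)" for z
  define t2 where "t2 z = \<sigma>2 (\<phi>2 z)" for z
  have t1: "finite_labelling N t1 K1" unfolding t1_def by (rule finite_labelling_pullback[OF \<phi>1 \<sigma>1])
  have t2: "finite_labelling N t2 K2" unfolding t2_def by (rule finite_labelling_pullback[OF \<phi>2 \<sigma>2])
  have f1: "emeasure N (fiber N t1 i) = emeasure M1 (fiber M1 \<sigma>1 i)" for i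
    unfolding t1_def by (rule measure_preserving_fiber[OF \<phi>1]) (use \<sigma>1 in \<open>simp add: finite_labelling_def\<close>)
  have f2: "emeasure N (fiber N t2 i) = emeasure M2 (fiber M2 \<sigma>2 i)" for i
    unfolding t2_def by (rule measure_preserving_fiber[OF \<phi>2]) (use \<sigma>2 in \<open>simp add: finite_labelling_def\<close>)
  note m1 = finite_labelling_sets[OF t1] and m2 = finite_labelling_sets[OF t2]
  \<comment> \<open>Every cell other than the intersection of the two backgrounds lies in a nonzero
    fiber of one of the labellings.\<close>
  have finN: "emeasure N (fiber N t1 i \<inter> fiber N t2 j) < \<infinity>" if "(i, j) \<noteq> (0, 0)" for i j
  proof (cases "i = 0")
    case True
    then have "j \<noteq> 0" using that by simp
    have "emeasure N (fiber N t1 i \<inter> fiber N t2 j) \<le> emeasure N (fiber N t2 j)" by (rule emeasure_mono) (use m2 in auto)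
    also have "\<dots> < \<infinity>" by (rule finite_labelling_fiber[OF t2 \<open>j \<noteq> 0\<close>])
    finally show ?thesis .
  next
    case False
    have "emeasure N (fiber N t1 i \<inter> fiber N t2 j) \<le> emeasure N (fiber N t1 i)" by (rule emeasure_mono) (use m1 in auto)
    also have "\<dots> < \<infinity>" by (rule finite_labelling_fiber[OF t1 False])
    finally show ?thesis .
  qed
  define c where "c i j = measure N (fiber N t1 i \<inter> fiber N t2 j)" for i j
  have ec: "ennreal (c i j) = emeasure N (fiber N t1 i \<inter> fiber N t2 j)" if "(i, j) \<noteq> (0, 0)" for i j
    unfolding c_def using finN[OF that] by (intro emeasure_eq_ennreal_measure[symmetric]) auto
  have split_N: "emeasure N (fiber N t1 i) = emeasure N (fiber N t1 i \<inter> fiber N t2 0) + (\<Sum>j\<in>{1..K2}. ennreal (c i j))" for i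
  proof -
    have "emeasure N (fiber N t1 i) = (\<Sum>j\<le>K2. emeasure N (fiber N t1 i \<inter> fiber N t2 j))"
      using emeasure_fiber_sum[OF t2 m1, of "{i}"] by (simp add: Int_commute)
    also have "\<dots> = emeasure N (fiber N t1 i \<inter> fiber N t2 0) + (\<Sum>j\<in>{1..K2}. emeasure N (fiber N t1 i \<inter> fiber N t2 j))"
      by (simp add: atMost_atLeast0 sum.atLeast_Suc_atMost)
    also have "(\<Sum>j\<in>{1..K2}. emeasure N (fiber N t1 i \<inter> fiber N t2 j)) = (\<Sum>j\<in>{1..K2}. ennreal (c i j))"
      by (intro sum.cong refl ec[symmetric]) auto
    finally show ?thesis .
  qed
  have "(\<Sum>j\<in>{1..K2}. ennreal (c i j)) \<le> emeasure lborel (fiber lborel s1 i)" if "i \<le> K1" for i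
  proof (cases "i = 0")
    case True
    then show ?thesis using emeasure_fiber_0[OF s1f] by simp
  next
    case False
    then have "emeasure lborel (fiber lborel s1 i) = emeasure N (fiber N t1 i)"
      using s1 that by (simp add: realises_def f1)
    then show ?thesis by (simp add: split_N)
  qed
  note le = this
  have c0: "0 \<le> c i j" for i j by (simp add: c_def)
  obtain s2 where s2f: "finite_labelling lborel s2 K2" and
    s2: "\<And>i j. i \<le> K1 \<Longrightarrow> j \<in> {1..K2} \<Longrightarrow> emeasure lborel (fiber lborel s1 i \<inter> fiber lborel s2 j) = ennreal (c i j)"
    using lborel_refine_labelling[OF s1f c0 le] by auto
  note n1 = finite_labelling_sets[OF s1f] and n2 = finite_labelling_sets[OF s2f]
  have "emeasure lborel (fiber lborel s2 j) = emeasure M2 (fiber M2 \<sigma>2 j)" if j: "j \<in> {1..K2}" for j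
  proof -
    have "emeasure lborel (fiber lborel s2 j) = (\<Sum>i\<le>K1. ennreal (c i j))"
      unfolding emeasure_fiber_sum[OF s1f n2] using s2 j by (intro sum.cong) auto
    also have "\<dots> = (\<Sum>i\<le>K1. emeasure N (fiber N t1 i \<inter> fiber N t2 j))"
      using j by (intro sum.cong refl ec) auto
    also have "\<dots> = emeasure N (fiber N t2 j)" by (rule emeasure_fiber_sum[OF t1 m2, symmetric])
    finally show ?thesis by (simp add: f2)
  qed
  then have real2: "realises M2 \<sigma>2 K2 s2" using s2f by (simp add: realises_def)
  \<comment> \<open>The difference of the two step functions is one step function of the pair of
    labels. Its weights vanish as soon as one of the pairs is \<open>(0, 0)\<close>, and every other
    cell has the same finite mass on the line as in \<open>N\<close>.\<close>
  define J where "J = {..K1} \<times> {..K2} - {(0, 0)}"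
  define U where "U p q = (if p \<in> J \<and> q \<in> J then u1 (fst p) (fst q) - u2 (snd p) (snd q) else 0)" for p q
  define r where "r x = (s1 x, s2 x)" for x
  define r' where "r' z = (t1 z, t2 z)" for z
  have fr: "fiber lborel r (i, j) = fiber lborel s1 i \<inter> fiber lborel s2 j"
    "fiber N r' (i, j) = fiber N t1 i \<inter> fiber N t2 j" for i j by (auto simp: r_def r'_def)
  have mass: "emeasure lborel (fiber lborel r p) = emeasure N (fiber N r' p)" if p: "p \<in> J" for p
  proof -
    obtain i j where ij: "p = (i, j)" "i \<le> K1" "j \<le> K2" "(i, j) \<noteq> (0, 0)" using p unfolding J_def by fast
    have "emeasure lborel (fiber lborel s1 i \<inter> fiber lborel s2 j) = emeasure N (fiber N t1 i \<inter> fiber N t2 j)"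
    proof (cases "j = 0")
      case False
      then show ?thesis using s2[of i j] ij ec[of i j] by simp
    next
      \<comment> \<open>The refinement prescribes only the cells with \<open>j \<ge> 1\<close>. For
        \<open>j = 0\<close> the cell is what remains of the fiber of \<open>i\<close>. Here
        \<open>i\<close> is nonzero, so the fibers on the line and in \<open>N\<close> have equal
        masses and the finite prescribed part cancels.\<close>
      case True
      then have i: "i \<in> {1..K1}" using ij by auto
      have "emeasure lborel (fiber lborel s1 i) = (\<Sum>j\<le>K2. emeasure lborel (fiber lborel s1 i \<inter> fiber lborel s2 j))"
        using emeasure_fiber_sum[OF s2f n1, of "{i}"] by (simp add: Int_commute)
      also have "\<dots> = emeasure lborel (fiber lborel s1 i \<inter> fiber lborel s2 0) + (\<Sum>j\<in>{1..K2}. emeasure lborel (fiber lborel s1 i \<inter> fiber lborel s2 j))"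
        by (simp add: atMost_atLeast0 sum.atLeast_Suc_atMost)
      also have "(\<Sum>j\<in>{1..K2}. emeasure lborel (fiber lborel s1 i \<inter> fiber lborel s2 j)) = (\<Sum>j\<in>{1..K2}. ennreal (c i j))"
        using ij by (intro sum.cong s2) auto
      finally have "(\<Sum>j\<in>{1..K2}. ennreal (c i j)) + emeasure lborel (fiber lborel s1 i \<inter> fiber lborel s2 0)
         = (\<Sum>j\<in>{1..K2}. ennreal (c i j)) + emeasure N (fiber N t1 i \<inter> fiber N t2 0)"
        using s1 i f1[of i] split_N[of i] by (simp add: realises_def add.commute)
      moreover have "(\<Sum>j\<in>{1..K2}. ennreal (c i j)) \<noteq> top" by simp
      ultimately show ?thesis using True by (simp add: ennreal_add_left_cancel)
    qed
    then show ?thesis by (simp only: ij(1) fr)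
  qed
  have U_lborel: "U (r x) (r y) = u1 (s1 x) (s1 y) - u2 (s2 x) (s2 y)" for x y
    using s1f s2f label_weights_0[OF u1] label_weights_0[OF u2]
    by (auto simp: U_def r_def J_def finite_labelling_def)
  have U_N: "U (r' x) (r' y) = u1 (t1 x) (t1 y) - u2 (t2 x) (t2 y)" if "x \<in> space N" "y \<in> space N" for x y
    using t1 t2 label_weights_0[OF u1] label_weights_0[OF u2] that
    by (auto simp: U_def r'_def J_def finite_labelling_def)
  have S1: "gintegrable N (step_fun u1 t1)" by (rule label_weights_integrable[OF N t1 u1])
  have S2: "gintegrable N (step_fun u2 t2)" by (rule label_weights_integrable[OF N t2 u2])
  have P1: "gintegrable N (pullback W1 \<phi>1)" by (rule pullback_integrable[OF \<phi>1 M1 W1])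
  have P2: "gintegrable N (pullback W2 \<phi>2)" by (rule pullback_integrable[OF \<phi>2 M2 W2])
  have "cut_norm lborel (\<lambda>x y. u1 (s1 x) (s1 y) - u2 (s2 x) (s2 y)) = cut_norm lborel (step_fun U r)"
    by (simp add: U_lborel)
  also have "\<dots> \<le> cut_norm N (step_fun U r')"
  proof (rule cut_norm_step_fun_le[OF sigma_finite_lborel _ N _ _ _ mass])
    show "finite J" by (simp add: J_def)
    show "r \<in> measurable lborel (count_space UNIV)" unfolding r_def[abs_def] by (rule finite_labelling_Pair[OF s1f s2f])
    show "r' \<in> measurable N (count_space UNIV)" unfolding r'_def[abs_def] by (rule finite_labelling_Pair[OF t1 t2])
    show "emeasure lborel (fiber lborel r p) < \<infinity>" if p: "p \<in> J" for p
    proof -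
      obtain i j where ij: "p = (i, j)" "(i, j) \<noteq> (0, 0)" using p unfolding J_def by fast
      then show ?thesis using mass[OF p] finN[of i j] by (simp add: fr)
    qed
    show "U p q \<noteq> 0 \<Longrightarrow> p \<in> J \<and> q \<in> J" for p q by (auto simp: U_def split: if_splits)
  qed
  also have "\<dots> = cut_norm N (\<lambda>x y. u1 (t1 x) (t1 y) - u2 (t2 x) (t2 y))"
  proof (rule cut_norm_cong_AE)
    show m: "(\<lambda>z. u1 (t1 (fst z)) (t1 (snd z)) - u2 (t2 (fst z)) (t2 (snd z))) \<in> borel_measurable (sq N)"
      using S1 S2 by (intro borel_measurable_diff) auto
    show "(\<lambda>z. U (r' (fst z)) (r' (snd z))) \<in> borel_measurable (sq N)"
      using m by (rule measurable_cong[THEN iffD1, rotated]) (auto simp: U_N space_pair_measure)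
    show "AE z in sq N. U (r' (fst z)) (r' (snd z)) = u1 (t1 (fst z)) (t1 (snd z)) - u2 (t2 (fst z)) (t2 (snd z))"
      by (rule AE_I2) (auto simp: U_N space_pair_measure)
  qed
  also have "\<dots> \<le> cut_norm N (\<lambda>x y. pullback W1 \<phi>1 x y - pullback W2 \<phi>2 x y)
      + L1_norm N (\<lambda>x y. (u1 (t1 x) (t1 y) - u2 (t2 x) (t2 y)) - (pullback W1 \<phi>1 x y - pullback W2 \<phi>2 x y))"
    by (rule cut_norm_le_add_L1[OF Bochner_Integration.integrable_diff[OF S1 S2] Bochner_Integration.integrable_diff[OF P1 P2]])
  also have "L1_norm N (\<lambda>x y. (u1 (t1 x) (t1 y) - u2 (t2 x) (t2 y)) - (pullback W1 \<phi>1 x y - pullback W2 \<phi>2 x y))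
    \<le> L1_norm N (\<lambda>x y. pullback W1 \<phi>1 x y - u1 (t1 x) (t1 y)) + L1_norm N (\<lambda>x y. pullback W2 \<phi>2 x y - u2 (t2 x) (t2 y))"
  proof -
    have i: "integrable (sq N) (\<lambda>z. \<bar>pullback W1 \<phi>1 (fst z) (snd z) - u1 (t1 (fst z)) (t1 (snd z))\<bar>)"
      "integrable (sq N) (\<lambda>z. \<bar>pullback W2 \<phi>2 (fst z) (snd z) - u2 (t2 (fst z)) (t2 (snd z))\<bar>)"
      using S1 S2 P1 P2 by simp_all
    show ?thesis
      unfolding L1_norm_def Bochner_Integration.integral_add[OF i, symmetric]
    proof (rule integral_mono)
      show "integrable (sq N) (\<lambda>z. \<bar>u1 (t1 (fst z)) (t1 (snd z)) - u2 (t2 (fst z)) (t2 (snd z)) -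
         (pullback W1 \<phi>1 (fst z) (snd z) - pullback W2 \<phi>2 (fst z) (snd z))\<bar>)" using S1 S2 P1 P2 by simp
    qed (use i in \<open>auto intro: Bochner_Integration.integrable_add\<close>)
  qed
  also have "L1_norm N (\<lambda>x y. pullback W1 \<phi>1 x y - u1 (t1 x) (t1 y)) \<le> e1"
    using pullback_L1_norm[OF \<phi>1 M1 Bochner_Integration.integrable_diff[OF W1 label_weights_integrable[OF M1 \<sigma>1 u1]]] err(1)
    by (simp add: pullback_def t1_def)
  also have "L1_norm N (\<lambda>x y. pullback W2 \<phi>2 x y - u2 (t2 x) (t2 y)) \<le> e2"
    using pullback_L1_norm[OF \<phi>2 M2 Bochner_Integration.integrable_diff[OF W2 label_weights_integrable[OF M2 \<sigma>2 u2]]] err(2)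
    by (simp add: pullback_def t2_def)
  finally show ?thesis using that[OF real2] by simp
qed

section \<open>Couplings and the infimum that defines the cut metric\<close>

lemma coupling_exists:
  fixes M1 :: "'a measure" and M2 :: "'b measure"
  assumes "sigma_finite_measure M1" "sigma_finite_measure M2" "emeasure M1 (space M1) = emeasure M2 (space M2)"
  shows "\<exists>(N :: ('a \<times> 'b) measure) \<phi>1 \<phi>2. coupling N M1 M2 \<phi>1 \<phi>2"
proof -
  \<comment> \<open>Giving all points one label turns equality of the total masses into equality of
    the masses of the fibers.\<close>
  have "fiber M (\<lambda>_. 0::nat) i = (if i = 0 then space M else {})" for M :: "'c measure" and i by auto
  moreover have "fiber M (\<lambda>_. 0::nat) i = (if i = 0 then space M else {})" for M :: "'d measure" and i by auto
  ultimately have "emeasure M1 (fiber M1 (\<lambda>_. 0::nat) i) = emeasure M2 (fiber M2 (\<lambda>_. 0::nat) i)" for i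
    using assms(3) by auto
  note eq = this
  have m: "(\<lambda>_. 0::nat) \<in> measurable M1 (count_space UNIV)" "(\<lambda>_. 0::nat) \<in> measurable M2 (count_space UNIV)"
    by simp_all
  obtain N :: "('a \<times> 'b) measure" where "coupling N M1 M2 fst snd"
    using coupling_of_labels[OF assms(1,2) m eq] .
  then show ?thesis by blast
qed

lemma delta_eq_less_coupling:
  fixes M1 :: "'a measure" and M2 :: "'b measure"
  assumes "sigma_finite_measure M1" "sigma_finite_measure M2" "emeasure M1 (space M1) = emeasure M2 (space M2)"
    and "delta_eq M1 W1 M2 W2 < e"
  obtains N :: "('a \<times> 'b) measure" and \<phi>1 \<phi>2 where "coupling N M1 M2 \<phi>1 \<phi>2"
    "cut_norm N (\<lambda>x y. pullback W1 \<phi>1 x y - pullback W2 \<phi>2 x y) < e"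
proof -
  have "{cut_norm N (\<lambda>x y. pullback W1 \<phi>1 x y - pullback W2 \<phi>2 x y)
       | (N :: ('a \<times> 'b) measure) \<phi>1 \<phi>2. coupling N M1 M2 \<phi>1 \<phi>2} \<noteq> {}"
    using coupling_exists[OF assms(1-3)] by blast
  from cInf_lessD[OF this assms(4)[unfolded delta_eq_def]] show ?thesis using that by blast
qed

lemma
  fixes M1 :: "'a measure" and M2 :: "'b measure"
  assumes M1: "sigma_finite_measure M1" and M2: "sigma_finite_measure M2"
    and W1: "gintegrable M1 W1" and W2: "gintegrable M2 W2"
  shows delta_eq_nonneg: "emeasure M1 (space M1) = emeasure M2 (space M2) \<Longrightarrow> 0 \<le> delta_eq M1 W1 M2 W2"
    and delta_eq_le: "\<And>(N :: ('a \<times> 'b) measure) \<phi>1 \<phi>2. coupling N M1 M2 \<phi>1 \<phi>2 \<Longrightarrow>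
      delta_eq M1 W1 M2 W2 \<le> cut_norm N (\<lambda>x y. pullback W1 \<phi>1 x y - pullback W2 \<phi>2 x y)"
proof -
  let ?S = "{cut_norm N (\<lambda>x y. pullback W1 \<phi>1 x y - pullback W2 \<phi>2 x y)
       | (N :: ('a \<times> 'b) measure) \<phi>1 \<phi>2. coupling N M1 M2 \<phi>1 \<phi>2}"
  have pos: "0 \<le> x" if x: "x \<in> ?S" for x
  proof -
    obtain N :: "('a \<times> 'b) measure" and \<phi>1 \<phi>2 where c: "coupling N M1 M2 \<phi>1 \<phi>2"
      and x_eq: "x = cut_norm N (\<lambda>x y. pullback W1 \<phi>1 x y - pullback W2 \<phi>2 x y)" using x by blast
    have "gintegrable N (\<lambda>x y. pullback W1 \<phi>1 x y - pullback W2 \<phi>2 x y)"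
      using c by (intro Bochner_Integration.integrable_diff pullback_integrable[OF _ M1 W1] pullback_integrable[OF _ M2 W2])
        (auto simp: coupling_def)
    then show ?thesis unfolding x_eq by (rule cut_norm_nonneg)
  qed
  show "0 \<le> delta_eq M1 W1 M2 W2" if "emeasure M1 (space M1) = emeasure M2 (space M2)"
    unfolding delta_eq_def
  proof (rule cInf_greatest)
    show "?S \<noteq> {}" using coupling_exists[OF M1 M2 that] by blast
  qed (rule pos)
  fix N :: "('a \<times> 'b) measure" and \<phi>1 \<phi>2 assume "coupling N M1 M2 \<phi>1 \<phi>2"
  then show "delta_eq M1 W1 M2 W2 \<le> cut_norm N (\<lambda>x y. pullback W1 \<phi>1 x y - pullback W2 \<phi>2 x y)"
    unfolding delta_eq_def by (intro cInf_lower bdd_belowI[of _ 0] pos) auto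
qed

lemma delta_cut_nonneg:
  assumes "graphon M1 W1" "graphon M2 W2"
  shows "0 \<le> delta_cut M1 W1 M2 W2"
  using assms
  by (auto simp: delta_cut_def graphon_def emeasure_space_ext
      intro!: delta_eq_nonneg sigma_finite_ext gintegrable_ext_fun)

lemma step_approx_ext:
  assumes M: "sigma_finite_measure M" and W: "gintegrable M W" and a: "step_approx M W \<sigma> K u e"
  shows "step_approx (ext_measure M) (ext_fun W) (ext_label \<sigma>) K u e"
  using a finite_labelling_ext L1_norm_ext_step[OF M W] by (auto simp: step_approx_def)

text \<open>Both branches in the definition of \<open>delta_cut\<close> lead to a labelling of the
  same line, because \<open>ext_label\<close> keeps the weights and \<open>realises\<close> ignores
  the background.\<close>

lemma realise_delta_cut:
  assumes G1: "graphon M1 W1" and G2: "graphon M2 W2"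
    and a1: "step_approx M1 W1 \<sigma>1 K1 u1 e1" and a2: "step_approx M2 W2 \<sigma>2 K2 u2 e2"
    and s1: "realises M1 \<sigma>1 K1 s1" and d: "delta_cut M1 W1 M2 W2 < e"
  shows "\<exists>s2. realises M2 \<sigma>2 K2 s2 \<and>
    cut_norm lborel (\<lambda>x y. u1 (s1 x) (s1 y) - u2 (s2 x) (s2 y)) \<le> e + e1 + e2"
proof -
  have M: "sigma_finite_measure M1" "sigma_finite_measure M2" and W: "gintegrable M1 W1" "gintegrable M2 W2"
    using G1 G2 by (auto simp: graphon_def)
  have \<sigma>: "finite_labelling M1 \<sigma>1 K1" "finite_labelling M2 \<sigma>2 K2" using a1 a2 by (auto simp: step_approx_def)
  show ?thesis
  proof (cases "emeasure M1 (space M1) = emeasure M2 (space M2)")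
    case True
    with d have d': "delta_eq M1 W1 M2 W2 < e" by (simp add: delta_cut_def)
    obtain N :: "('a \<times> 'b) measure" and \<phi>1 \<phi>2 where N: "coupling N M1 M2 \<phi>1 \<phi>2"
      "cut_norm N (\<lambda>x y. pullback W1 \<phi>1 x y - pullback W2 \<phi>2 x y) < e"
      using delta_eq_less_coupling[OF M True d'] .
    obtain s2 where "realises M2 \<sigma>2 K2 s2"
      "cut_norm lborel (\<lambda>x y. u1 (s1 x) (s1 y) - u2 (s2 x) (s2 y))
        \<le> cut_norm N (\<lambda>x y. pullback W1 \<phi>1 x y - pullback W2 \<phi>2 x y) + e1 + e2"
      using realise_coupling[OF M W a1 a2 s1 N(1)] .
    then show ?thesis using N(2) by (intro exI[of _ s2]) simp
  next
    case False
    with d have d': "delta_eq (ext_measure M1) (ext_fun W1) (ext_measure M2) (ext_fun W2) < e" by (simp add: delta_cut_def)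
    have E: "emeasure (ext_measure M1) (space (ext_measure M1)) = emeasure (ext_measure M2) (space (ext_measure M2))"
      by (simp add: emeasure_space_ext)
    obtain N :: "(('a + real) \<times> ('b + real)) measure" and \<phi>1 \<phi>2 where N: "coupling N (ext_measure M1) (ext_measure M2) \<phi>1 \<phi>2"
      "cut_norm N (\<lambda>x y. pullback (ext_fun W1) \<phi>1 x y - pullback (ext_fun W2) \<phi>2 x y) < e"
      using delta_eq_less_coupling[OF sigma_finite_ext[OF M(1)] sigma_finite_ext[OF M(2)] E d'] .
    have s1': "realises (ext_measure M1) (ext_label \<sigma>1) K1 s1" using s1 \<sigma> by (simp add: realises_ext)
    obtain s2 where "realises (ext_measure M2) (ext_label \<sigma>2) K2 s2"
      "cut_norm lborel (\<lambda>x y. u1 (s1 x) (s1 y) - u2 (s2 x) (s2 y))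
        \<le> cut_norm N (\<lambda>x y. pullback (ext_fun W1) \<phi>1 x y - pullback (ext_fun W2) \<phi>2 x y) + e1 + e2"
      using realise_coupling[OF sigma_finite_ext[OF M(1)] sigma_finite_ext[OF M(2)] gintegrable_ext_fun[OF M(1) W(1)]
        gintegrable_ext_fun[OF M(2) W(2)] step_approx_ext[OF M(1) W(1) a1] step_approx_ext[OF M(2) W(2) a2] s1' N(1)] .
    then show ?thesis using N(2) \<sigma>(2) by (intro exI[of _ s2]) (simp add: realises_ext)
  qed
qed

lemma AE_pair_both:
  assumes N: "sigma_finite_measure N" and P: "AE x in N. P x"
  shows "AE z in sq N. P (fst z) \<and> P (snd z)"
proof -
  interpret sigma_finite_measure N by (rule N)
  obtain A where A: "A \<in> sets N" "emeasure N A = 0" "{x \<in> space N. \<not> P x} \<subseteq> A"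
    using P by (auto elim!: AE_E)
  have "emeasure (sq N) (A \<times> space N \<union> space N \<times> A) \<le> emeasure (sq N) (A \<times> space N) + emeasure (sq N) (space N \<times> A)"
    by (rule emeasure_subadditive) (use A in auto)
  also have "\<dots> = 0" using A by (simp add: emeasure_pair_measure_Times)
  finally have "emeasure (sq N) (A \<times> space N \<union> space N \<times> A) = 0" by simp
  then show ?thesis
    by (rule AE_I[rotated]) (use A in \<open>auto simp: space_pair_measure\<close>)
qed

text \<open>The way back from realisations to couplings. Once the spaces are coupled along their
  labels, the step function seen through \<open>fst\<close> agrees almost everywhere with the one
  seen through \<open>snd\<close>, and the comparison with \<open>W2\<close> takes place on
  \<open>M2\<close> alone. Infinite total masses make the two backgrounds match as well.\<close>

lemma delta_eq_le_step:
  fixes M1 :: "'a measure" and M2 :: "'b measure"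
  assumes M1: "sigma_finite_measure M1" and M2: "sigma_finite_measure M2"
    and W1: "gintegrable M1 W1" and W2: "gintegrable M2 W2"
    and inf: "emeasure M1 (space M1) = \<infinity>" "emeasure M2 (space M2) = \<infinity>"
    and a: "step_approx M1 W1 \<sigma>1 K u e" and \<sigma>2: "finite_labelling M2 \<sigma>2 K"
    and eq: "\<And>i. i \<in> {1..K} \<Longrightarrow> emeasure M2 (fiber M2 \<sigma>2 i) = emeasure M1 (fiber M1 \<sigma>1 i)"
  shows "delta_eq M1 W1 M2 W2 \<le> cut_norm M2 (\<lambda>x y. u (\<sigma>2 x) (\<sigma>2 y) - W2 x y) + e"
proof -
  have \<sigma>1: "finite_labelling M1 \<sigma>1 K" and u: "label_weights K u"
    and err: "L1_norm M1 (\<lambda>x y. W1 x y - u (\<sigma>1 x) (\<sigma>1 y)) \<le> e" using a by (auto simp: step_approx_def)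
  have "emeasure M1 (fiber M1 \<sigma>1 i) = emeasure M2 (fiber M2 \<sigma>2 i)" for i
  proof -
    consider "i = 0" | "i \<in> {1..K}" | "K < i" by fastforce
    then show ?thesis
      by cases (use eq fiber_above[OF \<sigma>1] fiber_above[OF \<sigma>2] emeasure_fiber_0[OF \<sigma>1 inf(1)] emeasure_fiber_0[OF \<sigma>2 inf(2)] in auto)
  qed
  note eq = this
  have m: "\<sigma>1 \<in> measurable M1 (count_space UNIV)" "\<sigma>2 \<in> measurable M2 (count_space UNIV)"
    using \<sigma>1 \<sigma>2 by (auto simp: finite_labelling_def)
  obtain N :: "('a \<times> 'b) measure" where
    N: "coupling N M1 M2 fst snd" "AE z in N. \<sigma>1 (fst z) = \<sigma>2 (snd z)"
    using coupling_of_labels[OF M1 M2 m eq] .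
  have sN: "sigma_finite_measure N" and p1: "measure_preserving N M1 fst" and p2: "measure_preserving N M2 snd"
    using N(1) by (auto simp: coupling_def)
  have P1: "gintegrable N (pullback W1 fst)" by (rule pullback_integrable[OF p1 M1 W1])
  have P2: "gintegrable N (pullback W2 snd)" by (rule pullback_integrable[OF p2 M2 W2])
  have S1: "gintegrable N (step_fun u (\<lambda>z. \<sigma>1 (fst z)))"
    by (rule label_weights_integrable[OF sN finite_labelling_pullback[OF p1 \<sigma>1] u])
  have S2: "gintegrable N (step_fun u (\<lambda>z. \<sigma>2 (snd z)))"
    by (rule label_weights_integrable[OF sN finite_labelling_pullback[OF p2 \<sigma>2] u])
  have "delta_eq M1 W1 M2 W2 \<le> cut_norm N (\<lambda>x y. pullback W1 fst x y - pullback W2 snd x y)"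
    by (rule delta_eq_le[OF M1 M2 W1 W2 N(1)])
  also have "\<dots> \<le> cut_norm N (\<lambda>x y. u (\<sigma>1 (fst x)) (\<sigma>1 (fst y)) - pullback W2 snd x y)
     + L1_norm N (\<lambda>x y. (pullback W1 fst x y - pullback W2 snd x y) - (u (\<sigma>1 (fst x)) (\<sigma>1 (fst y)) - pullback W2 snd x y))"
    by (rule cut_norm_le_add_L1[OF Bochner_Integration.integrable_diff[OF P1 P2] Bochner_Integration.integrable_diff[OF S1 P2]])
  also have "L1_norm N (\<lambda>x y. (pullback W1 fst x y - pullback W2 snd x y) - (u (\<sigma>1 (fst x)) (\<sigma>1 (fst y)) - pullback W2 snd x y)) \<le> e"
    using pullback_L1_norm[OF p1 M1 Bochner_Integration.integrable_diff[OF W1 label_weights_integrable[OF M1 \<sigma>1 u]]] err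
    by (simp add: pullback_def)
  also have "cut_norm N (\<lambda>x y. u (\<sigma>1 (fst x)) (\<sigma>1 (fst y)) - pullback W2 snd x y)
     = cut_norm N (pullback (\<lambda>x y. u (\<sigma>2 x) (\<sigma>2 y) - W2 x y) snd)"
  proof (rule cut_norm_cong_AE)
    show "AE z in sq N. u (\<sigma>1 (fst (fst z))) (\<sigma>1 (fst (snd z))) - pullback W2 snd (fst z) (snd z)
      = pullback (\<lambda>x y. u (\<sigma>2 x) (\<sigma>2 y) - W2 x y) snd (fst z) (snd z)"
      using AE_pair_both[OF sN N(2)] by eventually_elim (simp add: pullback_def)
  qed (use S1 S2 P2 in \<open>auto simp: pullback_def\<close>)
  also have "\<dots> \<le> cut_norm M2 (\<lambda>x y. u (\<sigma>2 x) (\<sigma>2 y) - W2 x y)"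
    by (rule cut_norm_pullback_le[OF p2 sN M2 Bochner_Integration.integrable_diff[OF label_weights_integrable[OF M2 \<sigma>2 u] W2]])
  finally show ?thesis by simp
qed

lemma cut_norm_ext_fun_le:
  assumes M: "sigma_finite_measure M" and F: "gintegrable M F"
  shows "cut_norm (ext_measure M) (ext_fun F) \<le> cut_norm M F"
proof (rule cut_norm_least)
  fix T U assume TU: "T \<in> sets (ext_measure M)" "U \<in> sets (ext_measure M)"
  let ?H = "\<lambda>z. indicator (T \<times> U) z *\<^sub>R ext_fun F (fst z) (snd z)"
  have "?H \<in> borel_measurable (sq (ext_measure M))"
    using rect_set_integrable[OF gintegrable_ext_fun[OF M F] TU] by (auto simp: set_integrable_def)
  moreover have "?H z = 0" if "z \<notin> range Inl \<times> range Inl" for z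
    using that by (cases z; cases "fst z"; cases "snd z") auto
  ultimately have "rect_int (ext_measure M) (ext_fun F) T U = (LINT z|sq M. ?H (Inl (fst z), Inl (snd z)))"
    unfolding set_lebesgue_integral_def by (rule ext_pair_integral[OF M])
  also have "\<dots> = rect_int M F (Inl -` T) (Inl -` U)"
    unfolding set_lebesgue_integral_def by (rule Bochner_Integration.integral_cong) (auto simp: indicator_def)
  finally show "\<bar>rect_int (ext_measure M) (ext_fun F) T U\<bar> \<le> cut_norm M F"
    using cut_norm_upper[OF F, of "Inl -` T" "Inl -` U"] TU by (simp add: sets_ext)
qed

lemma delta_cut_lborel_le:
  assumes G: "graphon M W" and w: "graphon lborel w"
    and a: "step_approx M W \<sigma> K u e" and s: "realises M \<sigma> K s"
  shows "delta_cut M W lborel w \<le> cut_norm lborel (\<lambda>x y. u (s x) (s y) - w x y) + e"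
proof -
  have M: "sigma_finite_measure M" and W: "gintegrable M W" and wi: "gintegrable lborel w"
    using G w by (auto simp: graphon_def)
  have sf: "finite_labelling lborel s K"
    and seq: "\<And>i. i \<in> {1..K} \<Longrightarrow> emeasure lborel (fiber lborel s i) = emeasure M (fiber M \<sigma> i)"
    using s by (auto simp: realises_def)
  have u: "label_weights K u" and \<sigma>: "finite_labelling M \<sigma> K" using a by (auto simp: step_approx_def)
  show ?thesis
  proof (cases "emeasure M (space M) = \<infinity>")
    case True
    then show ?thesis
      using delta_eq_le_step[OF M sigma_finite_lborel W wi _ _ a sf seq] by (simp add: delta_cut_def)
  next
    \<comment> \<open>A space of finite mass never has the mass of the line, so
      \<open>delta_cut\<close> compares the two extensions.\<close>
    case False
    have u0: "u 0 i = 0" "u i 0 = 0" for i by (rule label_weights_0[OF u])+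
    have eq': "emeasure (ext_measure lborel) (fiber (ext_measure lborel) (ext_label s) i)
        = emeasure (ext_measure M) (fiber (ext_measure M) (ext_label \<sigma>) i)" if i: "i \<in> {1..K}" for i
    proof -
      have "0 \<notin> {i}" using i by auto
      then show ?thesis
        using emeasure_ext_label[OF finite_labelling_sets[OF sf]] emeasure_ext_label[OF finite_labelling_sets[OF \<sigma>]] seq[OF i] by simp
    qed
    have "delta_cut M W lborel w = delta_eq (ext_measure M) (ext_fun W) (ext_measure lborel) (ext_fun w)"
      using False by (simp add: delta_cut_def)
    also have "\<dots> \<le> cut_norm (ext_measure lborel) (\<lambda>x y. u (ext_label s x) (ext_label s y) - ext_fun w x y) + e"
      by (rule delta_eq_le_step[OF sigma_finite_ext[OF M] sigma_finite_ext[OF sigma_finite_lborel]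
            gintegrable_ext_fun[OF M W] gintegrable_ext_fun[OF sigma_finite_lborel wi]
            emeasure_space_ext emeasure_space_ext step_approx_ext[OF M W a] finite_labelling_ext[OF sf] eq'])
    also have "(\<lambda>x y. u (ext_label s x) (ext_label s y) - ext_fun w x y) = ext_fun (\<lambda>x y. u (s x) (s y) - w x y)"
      by (auto simp: fun_eq_iff ext_fun_def ext_label_def u0 split: sum.split)
    also have "cut_norm (ext_measure lborel) \<dots> \<le> cut_norm lborel (\<lambda>x y. u (s x) (s y) - w x y)"
      by (rule cut_norm_ext_fun_le[OF sigma_finite_lborel Bochner_Integration.integrable_diff[OF label_weights_integrable[OF sigma_finite_lborel sf u] wi]])
    finally show ?thesis by simp
  qed
qed

section \<open>Limits in the cut norm\<close>

text \<open>Midpoint convexity passes bounds to the hull, nonnegativity and continuity pass them to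
  almost sure limits by Fatou's lemma, and the Lipschitz bound absorbs \<open>L^1\<close> errors.
  The value 0 at 0 gives integrability over infinite mass and keeps the background of a step
  function out of the integral.\<close>

definition test_function :: "(real \<Rightarrow> real) \<Rightarrow> bool" where
  "test_function \<psi> \<longleftrightarrow> (\<forall>x y. \<psi> ((x + y) / 2) \<le> (\<psi> x + \<psi> y) / 2) \<and> (\<forall>x. 0 \<le> \<psi> x) \<and> \<psi> 0 = 0
     \<and> (\<exists>L. \<forall>x y. \<bar>\<psi> x - \<psi> y\<bar> \<le> L * \<bar>x - y\<bar>)"

lemma test_function_abs: "test_function abs"
  unfolding test_function_def by (intro conjI allI exI[of _ 1]) (auto simp: abs_le_iff)

lemma test_function_max:
  assumes "test_function \<psi>" "0 \<le> B"
  shows "test_function (\<lambda>x. max (\<psi> x - B) 0)"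
proof -
  obtain L where L: "\<And>x y. \<bar>\<psi> x - \<psi> y\<bar> \<le> L * \<bar>x - y\<bar>" using assms(1) by (auto simp: test_function_def)
  have "\<bar>max (\<psi> x - B) 0 - max (\<psi> y - B) 0\<bar> \<le> L * \<bar>x - y\<bar>" for x y
    using L[of x y] by linarith
  moreover have "max (\<psi> ((x + y) / 2) - B) 0 \<le> (max (\<psi> x - B) 0 + max (\<psi> y - B) 0) / 2" for x y
  proof -
    have "\<psi> ((x + y) / 2) \<le> (\<psi> x + \<psi> y) / 2" using assms(1) by (simp add: test_function_def)
    then show ?thesis by (auto simp: max_def field_simps split: if_splits)
  qed
  ultimately show ?thesis using assms unfolding test_function_def by auto
qed

lemma test_function_measurable:
  assumes "test_function \<psi>"
  shows "\<psi> \<in> borel_measurable borel"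
proof -
  obtain L where L: "\<And>x y. \<bar>\<psi> x - \<psi> y\<bar> \<le> L * \<bar>x - y\<bar>" using assms by (auto simp: test_function_def)
  have "continuous_on UNIV \<psi>"
  proof (rule continuous_onI)
    fix x e :: real assume e: "0 < e"
    show "\<exists>d>0. \<forall>x'\<in>UNIV. dist x' x < d \<longrightarrow> dist (\<psi> x') (\<psi> x) \<le> e"
    proof (intro exI[of _ "e / (\<bar>L\<bar> + 1)"] conjI ballI impI)
      fix x' assume d: "dist x' x < e / (\<bar>L\<bar> + 1)"
      have "\<bar>\<psi> x' - \<psi> x\<bar> \<le> (\<bar>L\<bar> + 1) * \<bar>x' - x\<bar>"
        by (rule order_trans[OF L]) (intro mult_right_mono, auto)
      also have "\<dots> \<le> e" using d by (simp add: dist_real_def field_simps)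
      finally show "dist (\<psi> x') (\<psi> x) \<le> e" by (simp add: dist_real_def)
    qed (use e in auto)
  qed
  then show ?thesis by (rule borel_measurable_continuous_onI)
qed

lemma test_function_tendsto:
  assumes "test_function \<psi>" "(f \<longlongrightarrow> l) F"
  shows "((\<lambda>x. \<psi> (f x)) \<longlongrightarrow> \<psi> l) F"
proof -
  obtain L where L: "\<And>x y. \<bar>\<psi> x - \<psi> y\<bar> \<le> L * \<bar>x - y\<bar>" using assms by (auto simp: test_function_def)
  have "((\<lambda>x. L * \<bar>f x - l\<bar>) \<longlongrightarrow> L * \<bar>l - l\<bar>) F" by (intro tendsto_intros assms)
  then have "((\<lambda>x. L * \<bar>f x - l\<bar>) \<longlongrightarrow> 0) F" by simp
  then have "((\<lambda>x. \<psi> (f x) - \<psi> l) \<longlongrightarrow> 0) F"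
    by (rule Lim_null_comparison[rotated]) (use L in simp)
  then show ?thesis by (simp add: LIM_zero_iff)
qed

lemma test_function_integrable:
  assumes \<psi>: "test_function \<psi>" and f: "integrable M f"
  shows "integrable M (\<lambda>x. \<psi> (f x))"
proof -
  obtain L where L: "\<And>x y. \<bar>\<psi> x - \<psi> y\<bar> \<le> L * \<bar>x - y\<bar>" using \<psi> by (auto simp: test_function_def)
  have "integrable M (\<lambda>x. L * \<bar>f x\<bar>)" using f by auto
  then show ?thesis
  proof (rule Bochner_Integration.integrable_bound)
    show "(\<lambda>x. \<psi> (f x)) \<in> borel_measurable M"
      using f by (intro measurable_compose[OF _ test_function_measurable[OF \<psi>]]) auto
    have "\<bar>\<psi> y\<bar> \<le> \<bar>L * \<bar>y\<bar>\<bar>" for y using L[of y 0] \<psi> by (auto simp: test_function_def)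
    then show "AE x in M. norm (\<psi> (f x)) \<le> norm (L * \<bar>f x\<bar>)" by auto
  qed
qed

lemma test_function_midhull:
  assumes \<psi>: "test_function \<psi>"
    and S: "\<And>f. f \<in> S \<Longrightarrow> integrable M f" "\<And>f. f \<in> S \<Longrightarrow> (LINT x|M. \<psi> (f x)) \<le> c"
    and g: "g \<in> midhull S"
  shows "integrable M g \<and> (LINT x|M. \<psi> (g x)) \<le> c"
  using g
proof induction
  case (mid f g)
  note I = test_function_integrable[OF \<psi>]
  have i: "integrable M f" "integrable M g" "integrable M (\<lambda>x. (f x + g x) / 2)" using mid by auto
  have "(LINT x|M. \<psi> ((f x + g x) / 2)) \<le> (LINT x|M. \<psi> (f x) / 2 + \<psi> (g x) / 2)"
  proof (rule integral_mono)
    show "\<psi> ((f x + g x) / 2) \<le> \<psi> (f x) / 2 + \<psi> (g x) / 2" for x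
      using \<psi> by (simp add: test_function_def add_divide_distrib)
  qed (use I[OF i(1)] I[OF i(2)] I[OF i(3)] in auto)
  also have "\<dots> = (LINT x|M. \<psi> (f x)) / 2 + (LINT x|M. \<psi> (g x)) / 2"
    using I[OF i(1)] I[OF i(2)] by (subst Bochner_Integration.integral_add) auto
  finally show ?case using mid i by simp
qed (use S in auto)

text \<open>The bound is assumed only up to every positive \<open>e\<close> and only for late
  \<open>k\<close>, because the step functions on the line satisfy the bounds of the graphons up to
  errors that tend to 0.\<close>

lemma test_function_Fatou:
  assumes \<psi>: "test_function \<psi>" and g: "\<And>k. integrable M (g k)" and w: "w \<in> borel_measurable M"
    and lim: "AE x in M. (\<lambda>k. g k x) \<longlonglongrightarrow> w x"
    and c: "\<And>e. 0 < e \<Longrightarrow> eventually (\<lambda>k. (LINT x|M. \<psi> (g k x)) \<le> c + e) sequentially"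
  shows "(\<integral>\<^sup>+x. ennreal (\<psi> (w x)) \<partial>M) \<le> ennreal c"
proof -
  note [measurable] = test_function_measurable[OF \<psi>] w borel_measurable_integrable[OF g]
  have "(\<integral>\<^sup>+x. ennreal (\<psi> (w x)) \<partial>M) = (\<integral>\<^sup>+x. liminf (\<lambda>k. ennreal (\<psi> (g k x))) \<partial>M)"
  proof (rule nn_integral_cong_AE)
    show "AE x in M. ennreal (\<psi> (w x)) = liminf (\<lambda>k. ennreal (\<psi> (g k x)))"
      using lim
    proof eventually_elim
      case (elim x)
      then have "(\<lambda>k. ennreal (\<psi> (g k x))) \<longlonglongrightarrow> ennreal (\<psi> (w x))"
        by (intro tendsto_ennrealI test_function_tendsto[OF \<psi>])
      then show ?case by (intro lim_imp_Liminf[symmetric]) auto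
    qed
  qed
  also have "\<dots> \<le> liminf (\<lambda>k. \<integral>\<^sup>+x. ennreal (\<psi> (g k x)) \<partial>M)" by (rule nn_integral_liminf) measurable
  finally have F: "(\<integral>\<^sup>+x. ennreal (\<psi> (w x)) \<partial>M) \<le> liminf (\<lambda>k. \<integral>\<^sup>+x. ennreal (\<psi> (g k x)) \<partial>M)" .
  have nn: "(\<integral>\<^sup>+x. ennreal (\<psi> (g k x)) \<partial>M) = ennreal (LINT x|M. \<psi> (g k x))" for k
    by (rule nn_integral_eq_integral[OF test_function_integrable[OF \<psi> g]]) (use \<psi> in \<open>auto simp: test_function_def\<close>)
  have le: "(\<integral>\<^sup>+x. ennreal (\<psi> (w x)) \<partial>M) \<le> ennreal (c + e)" if "0 < e" for e
  proof -
    have "liminf (\<lambda>k. \<integral>\<^sup>+x. ennreal (\<psi> (g k x)) \<partial>M) \<le> liminf (\<lambda>k::nat. ennreal (c + e))"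
      using c[OF that] by (intro Liminf_mono) (auto simp: nn elim!: eventually_mono intro: ennreal_leI)
    also have "\<dots> = ennreal (c + e)" by (rule Liminf_const) simp
    finally show ?thesis using F by (rule order_trans[rotated])
  qed
  show ?thesis
  proof (rule tendsto_lowerbound)
    show "((\<lambda>e. ennreal (c + e)) \<longlongrightarrow> ennreal c) (at_right 0)"
      by (intro tendsto_ennrealI tendsto_eq_intros) auto
    show "\<forall>\<^sub>F e in at_right 0. (\<integral>\<^sup>+x. ennreal (\<psi> (w x)) \<partial>M) \<le> ennreal (c + e)"
      unfolding eventually_at_right_field by (intro exI[of _ 1]) (auto intro: le)
  qed simp
qed

lemma test_function_nn_bound:
  assumes \<psi>: "test_function \<psi>" and w: "w \<in> borel_measurable M" and c: "0 \<le> c"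
    and le: "(\<integral>\<^sup>+x. ennreal (\<psi> (w x)) \<partial>M) \<le> ennreal c"
  shows "integrable M (\<lambda>x. \<psi> (w x))" "(LINT x|M. \<psi> (w x)) \<le> c"
proof -
  note [measurable] = test_function_measurable[OF \<psi>] w
  have pos: "0 \<le> \<psi> x" for x using \<psi> by (simp add: test_function_def)
  show int: "integrable M (\<lambda>x. \<psi> (w x))"
    by (rule integrableI_bounded) (use le pos in \<open>auto intro: le_less_trans\<close>)
  then have "ennreal (LINT x|M. \<psi> (w x)) \<le> ennreal c"
    using le pos by (subst nn_integral_eq_integral[symmetric]) auto
  then show "(LINT x|M. \<psi> (w x)) \<le> c" using c by simp
qed

text \<open>Dominated convergence applies to the truncations at level \<open>B\<close>, and uniform integrability
  controls the rest.\<close>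

lemma vitali_set:
  fixes g :: "nat \<Rightarrow> 'a \<Rightarrow> real" and w :: "'a \<Rightarrow> real"
  assumes g: "\<And>k. integrable M (g k)" and w: "integrable M w"
    and lim: "AE x in M. (\<lambda>k. g k x) \<longlonglongrightarrow> w x"
    and R: "R \<in> sets M" "emeasure M R < \<infinity>"
    and ui: "\<And>e. 0 < e \<Longrightarrow> \<exists>B\<ge>0. (\<forall>k. (LINT x|M. max (\<bar>g k x\<bar> - B) 0) \<le> e) \<and> (LINT x|M. max (\<bar>w x\<bar> - B) 0) \<le> e"
  shows "(\<lambda>k. LINT x:R|M. g k x) \<longlonglongrightarrow> (LINT x:R|M. w x)"
proof (rule LIMSEQ_I)
  fix e :: real assume "0 < e"
  then have e: "0 < e / 4" by simp
  obtain B where B: "0 \<le> B" "\<And>k. (LINT x|M. max (\<bar>g k x\<bar> - B) 0) \<le> e / 4" "(LINT x|M. max (\<bar>w x\<bar> - B) 0) \<le> e / 4"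
    using ui[OF e] by blast
  \<comment> \<open>\<open>cl\<close> clips to the interval from \<open>-B\<close> to
    \<open>B\<close>, and the distance from \<open>x\<close> to \<open>cl x\<close> is exactly the
    excess over \<open>B\<close>. On the set \<open>R\<close> of finite mass the clipped differences
    are dominated by a constant; three errors of \<open>e / 4\<close> remain below
    \<open>e\<close>.\<close>
  define cl where "cl x = max (-B) (min B x)" for x
  have clm [measurable]: "cl \<in> borel_measurable borel" unfolding cl_def by measurable
  note [measurable] = borel_measurable_integrable[OF g] borel_measurable_integrable[OF w] R(1)
  have clb: "\<bar>cl x - cl y\<bar> \<le> 2 * B" for x y using B(1) by (auto simp: cl_def)
  let ?D = "\<lambda>k x. indicator R x * \<bar>cl (g k x) - cl (w x)\<bar>"
  have Rint: "integrable M (\<lambda>x. indicator R x * (2 * B))" using R by simp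
  have Db: "norm (?D k x) \<le> indicator R x * (2 * B)" for k x
    using clb by (auto simp: indicator_def abs_mult)
  have Dint: "integrable M (?D k)" for k
    by (rule Bochner_Integration.integrable_bound[OF Rint])
       (use Db B(1) in \<open>auto simp: abs_mult intro!: AE_I2\<close>)
  have "(\<lambda>k. LINT x|M. ?D k x) \<longlonglongrightarrow> (LINT x|M. 0)"
  proof (rule integral_dominated_convergence[OF _ _ Rint])
    show "AE x in M. (\<lambda>k. ?D k x) \<longlonglongrightarrow> 0"
      using lim
    proof eventually_elim
      case (elim x)
      have "(\<lambda>k. ?D k x) \<longlonglongrightarrow> indicator R x * \<bar>cl (w x) - cl (w x)\<bar>"
        unfolding cl_def by (intro tendsto_intros elim)
      then show ?case by simp
    qed
    show "AE x in M. norm (?D k x) \<le> indicator R x * (2 * B)" for k using Db by (intro AE_I2)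
  qed measurable
  then have "eventually (\<lambda>k. (LINT x|M. ?D k x) < e / 4) sequentially"
    using e by (intro order_tendstoD) auto
  then obtain N where N: "\<And>k. k \<ge> N \<Longrightarrow> (LINT x|M. ?D k x) < e / 4" by (auto simp: eventually_sequentially)
  show "\<exists>no. \<forall>n\<ge>no. norm ((LINT x:R|M. g n x) - (LINT x:R|M. w x)) < e"
  proof (intro exI allI impI)
    fix k assume k: "k \<ge> N"
    let ?h = "\<lambda>f x. max (\<bar>f x\<bar> - B) 0"
    have hint: "integrable M (?h f)" if "integrable M f" for f
      using test_function_integrable[OF test_function_max[OF test_function_abs B(1)] that] .
    have si: "set_integrable M R f" if "integrable M f" for f :: "'a \<Rightarrow> real"
      unfolding set_integrable_def using that R(1) by (intro integrable_mult_indicator)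
    have "(LINT x:R|M. g k x) - (LINT x:R|M. w x) = (LINT x:R|M. g k x - w x)"
      by (rule set_integral_diff(2)[symmetric]) (use si g w in auto)
    also have "norm \<dots> \<le> (LINT x|M. norm (indicator R x *\<^sub>R (g k x - w x)))"
      unfolding set_lebesgue_integral_def by (rule integral_norm_bound)
    also have "\<dots> \<le> (LINT x|M. ?D k x + ?h (g k) x + ?h w x)"
    proof (rule integral_mono)
      show "integrable M (\<lambda>x. norm (indicator R x *\<^sub>R (g k x - w x)))"
        using si[of "\<lambda>x. g k x - w x"] g w unfolding set_integrable_def by (intro integrable_norm) auto
      show "integrable M (\<lambda>x. ?D k x + ?h (g k) x + ?h w x)"
        using Dint hint[OF g] hint[OF w] by (intro Bochner_Integration.integrable_add)
      have cl: "\<bar>x - cl x\<bar> = max (\<bar>x\<bar> - B) 0" for x using B(1) by (auto simp: cl_def)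
      have "\<bar>x - y\<bar> \<le> \<bar>cl x - cl y\<bar> + max (\<bar>x\<bar> - B) 0 + max (\<bar>y\<bar> - B) 0" for x y
        unfolding cl[symmetric] by linarith
      then show "norm (indicator R x *\<^sub>R (g k x - w x)) \<le> ?D k x + ?h (g k) x + ?h w x" for x
        by (auto simp: indicator_def)
    qed
    also have "\<dots> = (LINT x|M. ?D k x) + (LINT x|M. ?h (g k) x) + (LINT x|M. ?h w x)"
      using Dint[of k] hint[OF g, of k] hint[OF w] by simp
    also have "\<dots> < e" using N[OF k] B(2)[of k] B(3) e by linarith
    finally show "norm ((LINT x:R|M. g k x) - (LINT x:R|M. w x)) < e" .
  qed
qed

text \<open>It serves in place of \<open>tail_int\<close>: the integrand is convex and 1-Lipschitz
  in the value of \<open>W\<close>, unlike that of the tail, which jumps at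
  \<open>B\<close>.\<close>

abbreviation excess :: "'a measure \<Rightarrow> ('a \<Rightarrow> 'a \<Rightarrow> real) \<Rightarrow> real \<Rightarrow> real" where
  "excess M W B \<equiv> (LINT z|sq M. max (\<bar>W (fst z) (snd z)\<bar> - B) 0)"

lemma cut_norm_limit:
  fixes F :: "nat \<Rightarrow> 'a \<Rightarrow> 'a \<Rightarrow> real"
  assumes M: "sigma_finite_measure M" and F: "\<And>n. gintegrable M (F n)"
    and K: "\<And>n. L1_norm M (F n) \<le> K"
    and ui: "\<forall>e>0. \<exists>B\<ge>0. \<forall>n. excess M (F n) B \<le> e"
    and cauchy: "\<forall>e>0. \<exists>N. \<forall>m\<ge>N. \<forall>n\<ge>N. cut_norm M (\<lambda>x y. F m x y - F n x y) \<le> e"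
    and sym: "\<And>n x y. F n x y = F n y x"
  shows "\<exists>w. gintegrable M w \<and> (\<forall>x y. w x y = w y x) \<and>
    (\<lambda>n. cut_norm M (\<lambda>x y. F n x y - w x y)) \<longlonglongrightarrow> 0 \<and>
    (\<forall>\<psi> c. test_function \<psi> \<longrightarrow> 0 \<le> c \<longrightarrow>
      (\<forall>e>0. eventually (\<lambda>n. (LINT z|sq M. \<psi> (F n (fst z) (snd z))) \<le> c + e) sequentially) \<longrightarrow>
      (LINT z|sq M. \<psi> (w (fst z) (snd z))) \<le> c)"
proof -
  interpret sigma_finite_measure M by (rule M)
  interpret P: pair_sigma_finite M M ..
  define f where "f n z = F n (fst z) (snd z)" for n z
  have f: "integrable (sq M) (f n)" for n using F by (simp add: f_def[abs_def])
  have fK: "(LINT z|sq M. \<bar>f n z\<bar>) \<le> K" for n using K[of n] by (simp add: f_def L1_norm_def)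
  obtain g where g: "\<And>k. g k \<in> midhull (f ` {k..})" and conv: "AE z in sq M. convergent (\<lambda>k. g k z)"
    using komlos_midhull[of "sq M" f K, OF P.sigma_finite_measure_axioms f fK] by blast
  have gi: "integrable (sq M) (g k)" for k
    using test_function_midhull[OF test_function_abs _ _ g, of k "sq M" K] f fK by auto
  have gsym: "g k (x, y) = g k (y, x)" for k x y
    using g[of k] by induction (auto simp: f_def sym)
  note [measurable] = borel_measurable_integrable[OF gi]
  \<comment> \<open>Taking \<open>lim\<close> at every point, also where the sequence diverges,
    makes \<open>w\<close> symmetric everywhere and not just almost everywhere.\<close>
  define w where "w x y = lim (\<lambda>k. g k (x, y))" for x y
  have w_eq: "w (fst z) (snd z) = lim (\<lambda>k. g k z)" for z by (simp add: w_def)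
  have wm: "(\<lambda>z. w (fst z) (snd z)) \<in> borel_measurable (sq M)"
    unfolding w_eq by (rule borel_measurable_lim_metric) measurable
  have lim: "AE z in sq M. (\<lambda>k. g k z) \<longlonglongrightarrow> w (fst z) (snd z)"
    using conv by eventually_elim (simp add: w_eq convergent_LIMSEQ_iff)
  \<comment> \<open>The use of tails matters here: an asymptotic bound on \<open>f n\<close> bounds
    every element of the hulls from some index on.\<close>
  have nn: "(\<integral>\<^sup>+z. ennreal (\<psi> (w (fst z) (snd z))) \<partial>(sq M)) \<le> ennreal c"
    if \<psi>: "test_function \<psi>" and
      c: "\<And>e. 0 < e \<Longrightarrow> eventually (\<lambda>n. (LINT z|sq M. \<psi> (f n z)) \<le> c + e) sequentially" for \<psi> c
  proof (rule test_function_Fatou[OF \<psi> gi wm lim])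
    fix e :: real assume "0 < e"
    from c[OF this] obtain N where N: "\<And>n. n \<ge> N \<Longrightarrow> (LINT z|sq M. \<psi> (f n z)) \<le> c + e"
      by (auto simp: eventually_sequentially)
    have "(LINT z|sq M. \<psi> (g k z)) \<le> c + e" if "k \<ge> N" for k
    proof (rule test_function_midhull[OF \<psi> _ _ g, THEN conjunct2])
      show "integrable (sq M) h" "(LINT z|sq M. \<psi> (h z)) \<le> c + e" if "h \<in> f ` {k..}" for h
        using that f N \<open>k \<ge> N\<close> by auto
    qed
    then show "eventually (\<lambda>k. (LINT z|sq M. \<psi> (g k z)) \<le> c + e) sequentially"
      by (auto simp: eventually_sequentially)
  qed
  have "0 \<le> L1_norm M (F 0)" by (simp add: L1_norm_def)
  then have K0: "0 \<le> K" using K[of 0] by simp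
  have "(\<integral>\<^sup>+z. ennreal \<bar>w (fst z) (snd z)\<bar> \<partial>(sq M)) \<le> ennreal K"
    by (rule nn[OF test_function_abs]) (use fK in \<open>auto intro!: always_eventually intro: add_increasing2\<close>)
  then have wi: "gintegrable M w"
    using wm test_function_nn_bound(1)[OF test_function_abs wm K0] by (simp add: integrable_abs_iff)
  have ui': "\<exists>B\<ge>0. (\<forall>k. (LINT z|sq M. max (\<bar>g k z\<bar> - B) 0) \<le> e) \<and> excess M w B \<le> e"
    if e: "0 < e" for e
  proof -
    obtain B where B: "0 \<le> B" "\<And>n. (LINT z|sq M. max (\<bar>f n z\<bar> - B) 0) \<le> e"
      using ui[rule_format, OF e] unfolding f_def by blast
    note T = test_function_max[OF test_function_abs B(1)]
    have "(LINT z|sq M. max (\<bar>g k z\<bar> - B) 0) \<le> e" for k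
      using test_function_midhull[OF T _ _ g, of k "sq M" e] f B(2) by auto
    moreover have "excess M w B \<le> e"
      by (rule test_function_nn_bound(2)[OF T wm _ nn[OF T]])
         (use e B(2) in \<open>auto intro!: always_eventually intro: add_increasing2\<close>)
    ultimately show ?thesis using B(1) by blast
  qed
  have cut_le: "cut_norm M (\<lambda>x y. F m x y - w x y) \<le> e"
    if N: "\<And>m n. m \<ge> N \<Longrightarrow> n \<ge> N \<Longrightarrow> cut_norm M (\<lambda>x y. F m x y - F n x y) \<le> e" and m: "m \<ge> N" for e N m
  proof (rule cut_norm_least)
    \<comment> \<open>For a fixed rectangle the distance to the integral of \<open>F m\<close> is a
      convex function of the other argument, so the Cauchy estimate passes from the tail to its
      midpoint hull.\<close>
    have hull: "\<bar>rect_int M (F m) T U - (LINT z:(T \<times> U)|(sq M). g k z)\<bar> \<le> e"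
      if k: "k \<ge> N" and TU: "T \<in> sets M" "U \<in> sets M" for k T U
    proof -
      have "integrable (sq M) h \<and> \<bar>rect_int M (F m) T U - (LINT z:(T \<times> U)|(sq M). h z)\<bar> \<le> e"
        if "h \<in> midhull (f ` {k..})" for h
        using that
      proof induction
        case (base h)
        then obtain n where n: "n \<ge> k" "h = f n" by auto
        have "\<bar>rect_int M (\<lambda>x y. F m x y - F n x y) T U\<bar> \<le> cut_norm M (\<lambda>x y. F m x y - F n x y)"
          by (rule cut_norm_upper[OF Bochner_Integration.integrable_diff[OF F F] TU])
        also have "\<dots> \<le> e" using N[OF m] n(1) k by simp
        finally show ?case using rect_int_diff[OF F F TU, of m n] f n by (simp add: f_def[abs_def])
      next
        case (mid h h')
        have s: "set_integrable (sq M) (T \<times> U) h" if "integrable (sq M) h" for h :: "'a \<times> 'a \<Rightarrow> real"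
          unfolding set_integrable_def using that TU by (intro integrable_mult_indicator) auto
        have "(LINT z:(T \<times> U)|(sq M). (h z + h' z) / 2)
          = ((LINT z:(T \<times> U)|(sq M). h z) + (LINT z:(T \<times> U)|(sq M). h' z)) / 2"
          using set_integral_add(2)[OF s s, of h h'] mid by simp
        then show ?case using mid.IH unfolding abs_le_iff by (auto simp: field_simps)
      qed
      then show ?thesis using g[of k] by blast
    qed
    \<comment> \<open>\<open>vitali_set\<close> works on a rectangle of finite mass. General
      \<open>T\<close> and \<open>U\<close> are reached afterwards by exhausting the space, with the
      integrable difference of \<open>F m\<close> and \<open>w\<close> as dominating
      function.\<close>
    have fin: "\<bar>rect_int M (\<lambda>x y. F m x y - w x y) T U\<bar> \<le> e"
      if TU: "T \<in> sets M" "U \<in> sets M" "emeasure M T < \<infinity>" "emeasure M U < \<infinity>" for T U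
    proof -
      have "(\<lambda>k. LINT z:(T \<times> U)|(sq M). g k z) \<longlonglongrightarrow> rect_int M w T U"
        by (rule vitali_set[OF gi wi lim _ _ ui'])
           (use TU in \<open>auto simp: emeasure_pair_measure_Times ennreal_mult_less_top\<close>)
      then have "(\<lambda>k. \<bar>rect_int M (F m) T U - (LINT z:(T \<times> U)|(sq M). g k z)\<bar>)
        \<longlonglongrightarrow> \<bar>rect_int M (F m) T U - rect_int M w T U\<bar>"
        by (intro tendsto_intros)
      then have "\<bar>rect_int M (F m) T U - rect_int M w T U\<bar> \<le> e"
        by (rule LIMSEQ_le_const2) (use hull[OF _ TU(1,2)] in \<open>auto intro!: exI[of _ N]\<close>)
      then show ?thesis using rect_int_diff[OF F wi TU(1,2)] by simp
    qed
    fix T U assume TU: "T \<in> sets M" "U \<in> sets M"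
    obtain D :: "nat \<Rightarrow> 'a set" where D: "range D \<subseteq> sets M" "(\<Union>i. D i) = space M" "\<And>i. emeasure M (D i) \<noteq> \<infinity>" "incseq D"
      using sigma_finite_incseq by blast
    let ?H = "\<lambda>z. F m (fst z) (snd z) - w (fst z) (snd z)"
    have H: "integrable (sq M) ?H" using F wi by auto
    have Ds: "T \<inter> D i \<in> sets M" "U \<inter> D i \<in> sets M" for i using D(1) TU by auto
    have "(\<lambda>i. rect_int M (\<lambda>x y. F m x y - w x y) (T \<inter> D i) (U \<inter> D i)) \<longlonglongrightarrow> rect_int M (\<lambda>x y. F m x y - w x y) T U"
      unfolding set_lebesgue_integral_def
    proof (rule integral_dominated_convergence)
      show "integrable (sq M) (\<lambda>z. \<bar>?H z\<bar>)" using H by (rule integrable_abs)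
      show "AE z in sq M. (\<lambda>i. indicator ((T \<inter> D i) \<times> (U \<inter> D i)) z *\<^sub>R ?H z) \<longlonglongrightarrow> indicator (T \<times> U) z *\<^sub>R ?H z"
      proof (rule AE_I2)
        fix z assume "z \<in> space (sq M)"
        then have "fst z \<in> (\<Union>i. D i)" "snd z \<in> (\<Union>i. D i)" using D(2) by (auto simp: space_pair_measure)
        then obtain i j where ij: "fst z \<in> D i" "snd z \<in> D j" by blast
        have "eventually (\<lambda>n. indicator ((T \<inter> D n) \<times> (U \<inter> D n)) z *\<^sub>R ?H z = indicator (T \<times> U) z *\<^sub>R ?H z) sequentially"
          unfolding eventually_sequentially
          by (rule exI[of _ "max i j"])
             (use ij incseqD[OF D(4), of i] incseqD[OF D(4), of j] in \<open>auto simp: indicator_def mem_Times_iff subset_iff\<close>)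
        then show "(\<lambda>i. indicator ((T \<inter> D i) \<times> (U \<inter> D i)) z *\<^sub>R ?H z) \<longlonglongrightarrow> indicator (T \<times> U) z *\<^sub>R ?H z"
          by (rule tendsto_eventually)
      qed
      show "AE z in sq M. norm (indicator ((T \<inter> D i) \<times> (U \<inter> D i)) z *\<^sub>R ?H z) \<le> \<bar>?H z\<bar>" for i
        by (auto simp: indicator_def)
      have "(T \<inter> D i) \<times> (U \<inter> D i) \<in> sets (sq M)" "T \<times> U \<in> sets (sq M)" for i using Ds TU by auto
      then show "(\<lambda>z. indicator ((T \<inter> D i) \<times> (U \<inter> D i)) z *\<^sub>R ?H z) \<in> borel_measurable (sq M)"
        "(\<lambda>z. indicator (T \<times> U) z *\<^sub>R ?H z) \<in> borel_measurable (sq M)" for i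
        using borel_measurable_integrable[OF H] by (auto intro!: borel_measurable_scaleR borel_measurable_indicator)
    qed
    then have "(\<lambda>i. \<bar>rect_int M (\<lambda>x y. F m x y - w x y) (T \<inter> D i) (U \<inter> D i)\<bar>) \<longlonglongrightarrow> \<bar>rect_int M (\<lambda>x y. F m x y - w x y) T U\<bar>"
      by (rule tendsto_rabs)
    then show "\<bar>rect_int M (\<lambda>x y. F m x y - w x y) T U\<bar> \<le> e"
    proof (rule LIMSEQ_le_const2)
      have "emeasure M (T \<inter> D i) < \<infinity>" "emeasure M (U \<inter> D i) < \<infinity>" for i
        using D(1,3) emeasure_mono[of "T \<inter> D i" "D i" M] emeasure_mono[of "U \<inter> D i" "D i" M]
        by (auto simp: less_top[symmetric] top_unique)
      then show "\<exists>N. \<forall>i\<ge>N. \<bar>rect_int M (\<lambda>x y. F m x y - w x y) (T \<inter> D i) (U \<inter> D i)\<bar> \<le> e"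
        using fin[OF Ds] by blast
    qed
  qed
  show ?thesis
  proof (intro exI[of _ w] conjI allI impI)
    show "gintegrable M w" by (rule wi)
    show "w x y = w y x" for x y by (simp add: w_def gsym[of _ x y])
    show "(\<lambda>n. cut_norm M (\<lambda>x y. F n x y - w x y)) \<longlonglongrightarrow> 0"
    proof (rule LIMSEQ_I)
      fix r :: real assume r: "0 < r"
      then have "0 < r / 2" by simp
      from cauchy[rule_format, OF this] obtain N where N: "\<And>m n. m \<ge> N \<Longrightarrow> n \<ge> N \<Longrightarrow> cut_norm M (\<lambda>x y. F m x y - F n x y) \<le> r / 2" by blast
      show "\<exists>no. \<forall>n\<ge>no. norm (cut_norm M (\<lambda>x y. F n x y - w x y) - 0) < r"
      proof (intro exI allI impI)
        fix n assume "n \<ge> N"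
        then have "cut_norm M (\<lambda>x y. F n x y - w x y) \<le> r / 2" using cut_le[of N "r / 2" n] N by blast
        moreover have "0 \<le> cut_norm M (\<lambda>x y. F n x y - w x y)"
          by (rule cut_norm_nonneg[OF Bochner_Integration.integrable_diff[OF F wi]])
        ultimately show "norm (cut_norm M (\<lambda>x y. F n x y - w x y) - 0) < r" using r by simp
      qed
    qed
    fix \<psi> and c :: real assume "test_function \<psi>" "0 \<le> c"
      "\<forall>e>0. eventually (\<lambda>n. (LINT z|sq M. \<psi> (F n (fst z) (snd z))) \<le> c + e) sequentially"
    then show "(LINT z|sq M. \<psi> (w (fst z) (snd z))) \<le> c"
      by (intro test_function_nn_bound(2)[OF _ wm _ nn]) (simp_all add: f_def)
  qed
qed

section \<open>Limits of Cauchy sequences of graphons\<close>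

text \<open>The coordinate swap preserves the product measure and \<open>W\<close>, so averaging the
  weights with their transpose does not increase the error. Symmetric weights are what makes the
  limit on the line symmetric.\<close>

lemma step_approx_exists:
  assumes G: "graphon M W" and e: "0 < e"
  shows "\<exists>\<sigma> K u. step_approx M W \<sigma> K u e \<and> (\<forall>i j. u i j = u j i)"
proof -
  have M: "sigma_finite_measure M" and W: "gintegrable M W"
    and sym: "\<And>x y. x \<in> space M \<Longrightarrow> y \<in> space M \<Longrightarrow> W x y = W y x"
    using G by (auto simp: graphon_def)
  interpret sigma_finite_measure M by (rule M)
  interpret P: pair_sigma_finite M M ..
  obtain \<sigma> K v where \<sigma>: "finite_labelling M \<sigma> K" and v: "label_weights K v"
    and err: "L1_norm M (\<lambda>x y. W x y - v (\<sigma> x) (\<sigma> y)) \<le> e"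
    using step_fun_approx[OF M W e] .
  define u where "u i j = (v i j + v j i) / 2" for i j
  have u: "label_weights K u"
    unfolding label_weights_def
  proof (intro allI impI)
    fix i j assume "u i j \<noteq> 0"
    then have "v i j \<noteq> 0 \<or> v j i \<noteq> 0" by (auto simp: u_def)
    then show "i \<in> {1..K} \<and> j \<in> {1..K}" using v unfolding label_weights_def by blast
  qed
  have S: "gintegrable M (step_fun v \<sigma>)" by (rule label_weights_integrable[OF M \<sigma> v])
  let ?E = "\<lambda>z. \<bar>W (fst z) (snd z) - v (\<sigma> (fst z)) (\<sigma> (snd z))\<bar>"
  have E: "integrable (sq M) ?E" using W S by simp
  have E': "integrable (sq M) (\<lambda>z. ?E (snd z, fst z))"
    using P.integrable_product_swap[OF E] by (simp add: case_prod_beta')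
  have swap: "(LINT z|sq M. ?E (snd z, fst z)) = (LINT z|sq M. ?E z)"
    using P.integral_product_swap[of ?E] E by (simp add: case_prod_beta')
  have U: "gintegrable M (step_fun u \<sigma>)" by (rule label_weights_integrable[OF M \<sigma> u])
  have "L1_norm M (\<lambda>x y. W x y - u (\<sigma> x) (\<sigma> y)) \<le> (LINT z|sq M. ?E z / 2 + ?E (snd z, fst z) / 2)"
    unfolding L1_norm_def
  proof (rule integral_mono)
    fix z assume "z \<in> space (sq M)"
    then have "W (snd z) (fst z) = W (fst z) (snd z)" by (intro sym) (auto simp: space_pair_measure)
    then show "\<bar>W (fst z) (snd z) - u (\<sigma> (fst z)) (\<sigma> (snd z))\<bar> \<le> ?E z / 2 + ?E (snd z, fst z) / 2"
      unfolding u_def by (simp add: field_simps)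
  qed (use W U E E' in auto)
  also have "\<dots> = (LINT z|sq M. ?E z / 2) + (LINT z|sq M. ?E (snd z, fst z) / 2)"
    by (rule Bochner_Integration.integral_add) (use E E' in auto)
  also have "\<dots> = L1_norm M (\<lambda>x y. W x y - v (\<sigma> x) (\<sigma> y))"
    using swap by (simp add: L1_norm_def)
  finally have "L1_norm M (\<lambda>x y. W x y - u (\<sigma> x) (\<sigma> y)) \<le> e" using err by simp
  then have "step_approx M W \<sigma> K u e" using \<sigma> u by (simp add: step_approx_def)
  moreover have "\<forall>i j. u i j = u j i" by (simp add: u_def add.commute)
  ultimately show ?thesis by blast
qed

text \<open>As \<open>\<psi> 0 = 0\<close>, composing with \<open>\<psi>\<close> gives a step
  function again, whose integral is determined by the masses of the fibers and so is the same on
  both spaces. The Lipschitz bound then pays for replacing the step function on \<open>M\<close> by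
  \<open>W\<close>.\<close>

lemma test_function_transfer:
  assumes G: "graphon M W" and a: "step_approx M W \<sigma> K u e" and s: "realises M \<sigma> K s"
    and \<psi>: "test_function \<psi>" and L: "\<And>x y. \<bar>\<psi> x - \<psi> y\<bar> \<le> L * \<bar>x - y\<bar>" "0 \<le> L"
  shows "(LINT z|sq lborel. \<psi> (u (s (fst z)) (s (snd z))))
    \<le> (LINT z|sq M. \<psi> (W (fst z) (snd z))) + L * e"
proof -
  have M: "sigma_finite_measure M" and W: "gintegrable M W" using G by (auto simp: graphon_def)
  have \<sigma>: "finite_labelling M \<sigma> K" and u: "label_weights K u"
    and err: "L1_norm M (\<lambda>x y. W x y - u (\<sigma> x) (\<sigma> y)) \<le> e" using a by (auto simp: step_approx_def)
  have sf: "finite_labelling lborel s K"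
    and seq: "\<And>i. i \<in> {1..K} \<Longrightarrow> emeasure lborel (fiber lborel s i) = emeasure M (fiber M \<sigma> i)"
    using s by (auto simp: realises_def)
  have \<psi>u: "\<psi> (u i j) \<noteq> 0 \<Longrightarrow> i \<in> {1..K} \<and> j \<in> {1..K}" for i j
    using u \<psi> unfolding label_weights_def test_function_def by metis
  have "(LINT z|sq lborel. step_fun (\<lambda>i j. \<psi> (u i j)) s (fst z) (snd z)) =
     (\<Sum>i\<in>{1..K}. \<Sum>j\<in>{1..K}. \<psi> (u i j) * measure lborel (fiber lborel s i) * measure lborel (fiber lborel s j))"
    by (rule integral_step_fun[OF sigma_finite_lborel _ _ _ \<psi>u])
       (use sf finite_labelling_fiber[OF sf] in \<open>auto simp: finite_labelling_def\<close>)
  also have "\<dots> = (\<Sum>i\<in>{1..K}. \<Sum>j\<in>{1..K}. \<psi> (u i j) * measure M (fiber M \<sigma> i) * measure M (fiber M \<sigma> j))"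
    using seq by (intro sum.cong refl) (simp add: measure_def)
  also have "\<dots> = (LINT z|sq M. step_fun (\<lambda>i j. \<psi> (u i j)) \<sigma> (fst z) (snd z))"
    by (rule integral_step_fun[OF M _ _ _ \<psi>u, symmetric])
       (use \<sigma> finite_labelling_fiber[OF \<sigma>] in \<open>auto simp: finite_labelling_def\<close>)
  also have "\<dots> \<le> (LINT z|sq M. \<psi> (W (fst z) (snd z)) + L * \<bar>W (fst z) (snd z) - u (\<sigma> (fst z)) (\<sigma> (snd z))\<bar>)"
  proof (rule integral_mono)
    have S: "gintegrable M (step_fun u \<sigma>)" by (rule label_weights_integrable[OF M \<sigma> u])
    show "integrable (sq M) (\<lambda>z. \<psi> (u (\<sigma> (fst z)) (\<sigma> (snd z))))" by (rule test_function_integrable[OF \<psi> S])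
    show "integrable (sq M) (\<lambda>z. \<psi> (W (fst z) (snd z)) + L * \<bar>W (fst z) (snd z) - u (\<sigma> (fst z)) (\<sigma> (snd z))\<bar>)"
      using test_function_integrable[OF \<psi> W] S W by simp
    show "\<psi> (u (\<sigma> (fst z)) (\<sigma> (snd z))) \<le> \<psi> (W (fst z) (snd z)) + L * \<bar>W (fst z) (snd z) - u (\<sigma> (fst z)) (\<sigma> (snd z))\<bar>" for z
      using L(1)[of "W (fst z) (snd z)" "u (\<sigma> (fst z)) (\<sigma> (snd z))"] by linarith
  qed
  also have "\<dots> = (LINT z|sq M. \<psi> (W (fst z) (snd z))) + L * L1_norm M (\<lambda>x y. W x y - u (\<sigma> x) (\<sigma> y))"
    using test_function_integrable[OF \<psi> W] label_weights_integrable[OF M \<sigma> u] W by (simp add: L1_norm_def)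
  also have "L * L1_norm M (\<lambda>x y. W x y - u (\<sigma> x) (\<sigma> y)) \<le> L * e" using err L(2) by (rule mult_left_mono)
  finally show ?thesis by simp
qed

lemma test_function_negpart: "test_function (\<lambda>x. max (- x) 0)"
  unfolding test_function_def by (intro conjI allI exI[of _ 1]) (auto simp: max_def field_simps)

text \<open>The classes of the theorem impose pointwise bounds, hence the freedom to change the limit on a
  null set.\<close>

definition limit_graphon :: "(nat \<Rightarrow> 'a measure \<times> ('a \<Rightarrow> 'a \<Rightarrow> real)) \<Rightarrow> (real \<Rightarrow> real \<Rightarrow> real) \<Rightarrow> bool" where
  "limit_graphon G w \<longleftrightarrow> graphon lborel w \<and>
    (\<forall>w'. graphon lborel w' \<longrightarrow> (AE z in sq lborel. w' (fst z) (snd z) = w (fst z) (snd z)) \<longrightarrow>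
      cut_converges G lborel w') \<and>
    (\<forall>\<psi> c. test_function \<psi> \<longrightarrow> 0 \<le> c \<longrightarrow>
      (\<forall>n. (LINT z|sq (fst (G n)). \<psi> (snd (G n) (fst z) (snd z))) \<le> c) \<longrightarrow>
      (LINT z|sq lborel. \<psi> (w (fst z) (snd z))) \<le> c)"

lemma
  assumes "limit_graphon G w"
  shows limit_graphon_graphon: "graphon lborel w"
    and limit_graphon_converges: "\<And>w'. graphon lborel w' \<Longrightarrow>
      AE z in sq lborel. w' (fst z) (snd z) = w (fst z) (snd z) \<Longrightarrow> cut_converges G lborel w'"
    and limit_graphon_test: "\<And>\<psi> c. test_function \<psi> \<Longrightarrow> 0 \<le> c \<Longrightarrow>
      (\<And>n. (LINT z|sq (fst (G n)). \<psi> (snd (G n) (fst z) (snd z))) \<le> c) \<Longrightarrow>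
      (LINT z|sq lborel. \<psi> (w (fst z) (snd z))) \<le> c"
  using assms by (simp_all add: limit_graphon_def)

text \<open>A fast Cauchy subsequence is realised by step functions on the line one after the other; a
  later term of the original sequence is compared with the limit by realising it next to the
  preceding member of the subsequence.\<close>

theorem cut_cauchy_limit:
  fixes G :: "nat \<Rightarrow> 'a measure \<times> ('a \<Rightarrow> 'a \<Rightarrow> real)"
  assumes G: "\<And>n. graphon (fst (G n)) (snd (G n))" and C: "cut_cauchy G"
    and ui: "\<forall>e>0. \<exists>B\<ge>0. \<forall>n. excess (fst (G n)) (snd (G n)) B \<le> e"
    and bd: "(\<exists>K. \<forall>n. L1_norm (fst (G n)) (snd (G n)) \<le> K) \<or> (\<forall>n. nonneg_graphon (fst (G n)) (snd (G n)))"
  shows "\<exists>w. limit_graphon G w"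
proof -
  let ?M = "\<lambda>n. fst (G n)" and ?W = "\<lambda>n. snd (G n)"
  define h where "h k = (1/2::real)^k" for k :: nat
  have h0: "0 < h k" "h k \<le> 1" "h (Suc k) = h k / 2" for k
    by (auto simp: h_def power_le_one)
  have hlim: "h \<longlonglongrightarrow> 0" unfolding h_def by (rule LIMSEQ_power_zero) simp
  have "\<exists>N. \<forall>m\<ge>N. \<forall>n\<ge>N. delta_cut (?M m) (?W m) (?M n) (?W n) < h k" for k
    using C h0(1)[of k] unfolding cut_cauchy_def by blast
  then obtain N where N: "\<And>k m n. m \<ge> N k \<Longrightarrow> n \<ge> N k \<Longrightarrow> delta_cut (?M m) (?W m) (?M n) (?W n) < h k" by metis
  \<comment> \<open>Partial sums make the indices increase while \<open>q k\<close> is still at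
    least \<open>N k\<close>.\<close>
  define q where "q k = (\<Sum>j\<le>k. N j)" for k
  have qN: "N k \<le> q k" for k unfolding q_def by (rule member_le_sum) auto
  have qS: "q k \<le> q (Suc k)" for k by (simp add: q_def)
  have "\<exists>\<sigma> K u. step_approx (?M (q k)) (?W (q k)) \<sigma> K u (h k) \<and> (\<forall>i j. u i j = u j i)" for k
    by (rule step_approx_exists[OF G h0(1)])
  then obtain \<sigma> K u where a: "\<And>k. step_approx (?M (q k)) (?W (q k)) (\<sigma> k) (K k) (u k) (h k)"
    and usym: "\<And>k i j. u k i j = u k j i" by metis
  \<comment> \<open>Each realisation is built next to the previous one. The distance
    \<open>h k\<close> of the graphons and the approximation errors \<open>h k\<close> and
    \<open>h (Suc k)\<close> give the bound \<open>3 * h k\<close>.\<close>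
  have "\<exists>s. \<forall>k. realises (?M (q k)) (\<sigma> k) (K k) (s k) \<and>
    cut_norm lborel (\<lambda>x y. u k (s k x) (s k y) - u (Suc k) (s (Suc k) x) (s (Suc k) y)) \<le> 3 * h k"
  proof (rule dependent_nat_choice)
    show "\<exists>s. realises (?M (q 0)) (\<sigma> 0) (K 0) s"
      using realises_exists[of "?M (q 0)" "\<sigma> 0" "K 0"] a[of 0] unfolding step_approx_def by blast
    fix s k assume s: "realises (?M (q k)) (\<sigma> k) (K k) s"
    have "delta_cut (?M (q k)) (?W (q k)) (?M (q (Suc k))) (?W (q (Suc k))) < h k"
      using N[of k "q k" "q (Suc k)"] qN[of k] qS[of k] by simp
    from realise_delta_cut[OF G G a a s this] obtain s' where "realises (?M (q (Suc k))) (\<sigma> (Suc k)) (K (Suc k)) s'"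
      "cut_norm lborel (\<lambda>x y. u k (s x) (s y) - u (Suc k) (s' x) (s' y)) \<le> h k + h k + h (Suc k)" by blast
    then show "\<exists>s'. realises (?M (q (Suc k))) (\<sigma> (Suc k)) (K (Suc k)) s' \<and>
      cut_norm lborel (\<lambda>x y. u k (s x) (s y) - u (Suc k) (s' x) (s' y)) \<le> 3 * h k"
      using h0[of k] by (intro exI[of _ s']) auto
  qed
  then obtain s where s': "\<forall>k. realises (?M (q k)) (\<sigma> k) (K k) (s k) \<and>
    cut_norm lborel (\<lambda>x y. u k (s k x) (s k y) - u (Suc k) (s (Suc k) x) (s (Suc k) y)) \<le> 3 * h k" by (elim exE)
  then have s: "\<And>k. realises (?M (q k)) (\<sigma> k) (K k) (s k)"
    and step: "\<And>k. cut_norm lborel (\<lambda>x y. u k (s k x) (s k y) - u (Suc k) (s (Suc k) x) (s (Suc k) y)) \<le> 3 * h k"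
    by simp_all
  define F where "F k x y = u k (s k x) (s k y)" for k x y
  have uw: "label_weights (K k) (u k)" for k using a by (simp add: step_approx_def)
  have Fi: "gintegrable lborel (F k)" for k
  proof -
    have "finite_labelling lborel (s k) (K k)" using s[of k] by (simp add: realises_def)
    then show ?thesis unfolding F_def by (rule label_weights_integrable[OF sigma_finite_lborel _ uw])
  qed
  have Fsym: "F k x y = F k y x" for k x y unfolding F_def by (rule usym)
  have transfer: "(LINT z|sq lborel. \<psi> (F k (fst z) (snd z)))
    \<le> (LINT z|sq (?M (q k)). \<psi> (?W (q k) (fst z) (snd z))) + L * h k"
    if "test_function \<psi>" "\<And>x y. \<bar>\<psi> x - \<psi> y\<bar> \<le> L * \<bar>x - y\<bar>" "0 \<le> L" for \<psi> L k
    unfolding F_def by (rule test_function_transfer[OF G a s that])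
  \<comment> \<open>As \<open>h\<close> halves at each step, \<open>3 * h n\<close> is
    \<open>6 * (h n - h (Suc n))\<close>, which telescopes.\<close>
  have tele: "cut_norm lborel (\<lambda>x y. F m x y - F n x y) \<le> 6 * (h m - h n)" if "m \<le> n" for m n
    using that
  proof (induction n rule: dec_induct)
    case base
    have "cut_norm lborel (\<lambda>x y. F m x y - F m x y) \<le> L1_norm lborel (\<lambda>x y. F m x y - F m x y)"
      by (rule cut_norm_le_L1) simp
    then show ?case by (simp add: L1_norm_def)
  next
    case (step n)
    have "cut_norm lborel (\<lambda>x y. F m x y - F (Suc n) x y)
      \<le> cut_norm lborel (\<lambda>x y. F m x y - F n x y) + cut_norm lborel (\<lambda>x y. F n x y - F (Suc n) x y)"
      by (rule cut_norm_triangle[OF Fi Fi Fi])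
    also have "\<dots> \<le> 6 * (h m - h n) + 3 * h n"
      using step.IH \<open>\<And>k. cut_norm lborel (\<lambda>x y. u k (s k x) (s k y) - u (Suc k) (s (Suc k) x) (s (Suc k) y)) \<le> 3 * h k\<close>[of n]
      unfolding F_def by (rule add_mono)
    also have "\<dots> = 6 * (h m - h (Suc n))" by (simp add: h0(3))
    finally show ?case .
  qed
  have cauchy: "\<exists>N. \<forall>m\<ge>N. \<forall>n\<ge>N. cut_norm lborel (\<lambda>x y. F m x y - F n x y) \<le> e" if "0 < e" for e
  proof -
    have "eventually (\<lambda>k. h k < e / 6) sequentially" using hlim that by (intro order_tendstoD) auto
    then obtain k0 where k0: "\<And>k. k \<ge> k0 \<Longrightarrow> h k < e / 6" by (auto simp: eventually_sequentially)
    have le: "cut_norm lborel (\<lambda>x y. F m x y - F n x y) \<le> e" if "k0 \<le> m" "m \<le> n" for m n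
    proof -
      have "6 * (h m - h n) \<le> 6 * h m" using h0(1)[of n] by simp
      then show ?thesis using tele[OF that(2)] k0[OF that(1)] by linarith
    qed
    have "cut_norm lborel (\<lambda>x y. F m x y - F n x y) \<le> e" if "k0 \<le> m" "k0 \<le> n" for m n
    proof (cases "m \<le> n")
      case False
      then show ?thesis using le[of n m] that cut_norm_commute[of lborel "F m" "F n"] by simp
    qed (use le that in auto)
    then show ?thesis by blast
  qed
  \<comment> \<open>Uniform integrability reaches \<open>F k\<close> up to the error
    \<open>h k\<close>, which is small for late \<open>k\<close> only. The finitely many earlier
    \<open>F k\<close> are bounded functions, and \<open>B'\<close> is raised above their
    bounds.\<close>
  have F_ui: "\<exists>B\<ge>0. \<forall>k. excess lborel (F k) B \<le> e" if "0 < e" for e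
  proof -
    have e2: "0 < e / 2" using that by simp
    obtain B where B: "0 \<le> B" "\<And>n. excess (?M n) (?W n) B \<le> e / 2"
      using ui[rule_format, OF e2] by blast
    have "eventually (\<lambda>k. h k < e / 2) sequentially" using hlim e2 by (rule order_tendstoD)
    then obtain k0 where k0: "\<And>k. k \<ge> k0 \<Longrightarrow> h k < e / 2" by (auto simp: eventually_sequentially)
    define b where "b k = (\<Sum>i\<le>K k. \<Sum>j\<le>K k. \<bar>u k i j\<bar>)" for k
    have ub: "\<bar>u k i j\<bar> \<le> b k" for k i j
    proof (cases "u k i j = 0")
      case True
      then show ?thesis by (simp add: b_def sum_nonneg)
    next
      case False
      then have ij: "i \<le> K k" "j \<le> K k" using uw[of k] by (auto simp: label_weights_def)
      have "\<bar>u k i j\<bar> \<le> (\<Sum>j\<le>K k. \<bar>u k i j\<bar>)" using ij by (intro member_le_sum) auto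
      also have "\<dots> \<le> b k" unfolding b_def using ij
        by (intro member_le_sum[where f="\<lambda>i. \<Sum>j\<le>K k. \<bar>u k i j\<bar>"]) (auto simp: sum_nonneg)
      finally show ?thesis .
    qed
    have b0: "0 \<le> b k" for k by (simp add: b_def sum_nonneg)
    define B' where "B' = B + (\<Sum>k<k0. b k)"
    have B': "0 \<le> B'" "B \<le> B'" using B(1) b0 by (auto simp: B'_def sum_nonneg)
    have "excess lborel (F k) B' \<le> e" for k
    proof (cases "k < k0")
      case True
      then have "b k \<le> (\<Sum>k<k0. b k)" using b0 by (intro member_le_sum) auto
      then have "b k \<le> B'" using B(1) by (simp add: B'_def)
      then have "max (\<bar>F k x y\<bar> - B') 0 = 0" for x y using ub[of k "s k x" "s k y"] by (simp add: F_def)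
      then show ?thesis using that by simp
    next
      case False
      have T: "test_function (\<lambda>x. max (\<bar>x\<bar> - c) 0)" if "0 \<le> c" for c by (rule test_function_max[OF test_function_abs that])
      have "excess lborel (F k) B'
        \<le> excess lborel (F k) B"
        by (rule integral_mono)
           (use B'(2) in \<open>auto intro!: test_function_integrable[OF T[OF B'(1)] Fi] test_function_integrable[OF T[OF B(1)] Fi]\<close>)
      also have "\<dots> \<le> excess (?M (q k)) (?W (q k)) B + 1 * h k"
        by (rule transfer[OF T[OF B(1)]]) (auto simp: max_def)
      also have "\<dots> \<le> e" using B(2)[of "q k"] k0[of k] False by simp
      finally show ?thesis .
    qed
    then show ?thesis using B'(1) by blast
  qed
  have "\<exists>C. \<forall>k. L1_norm lborel (F k) \<le> C"
    using bd
  proof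
    assume "\<exists>K. \<forall>n. L1_norm (?M n) (?W n) \<le> K"
    then obtain C where C: "\<And>n. L1_norm (?M n) (?W n) \<le> C" by blast
    have "L1_norm lborel (F k) \<le> C + 1" for k
    proof -
      have "L1_norm lborel (F k) \<le> L1_norm (?M (q k)) (?W (q k)) + 1 * h k"
        unfolding L1_norm_def by (rule transfer[OF test_function_abs]) auto
      then show ?thesis using C[of "q k"] h0(2)[of k] by linarith
    qed
    then show ?thesis by blast
  next
    \<comment> \<open>The total integral is the integral over one rectangle, so it differs from the
      first one by at most 6. The negative part of \<open>F k\<close> has integral at most
      \<open>h k\<close>, since that of the graphon vanishes. An absolute value is the number plus
      twice its negative part, hence the constant \<open>6 + 2\<close>.\<close>
    assume nn: "\<forall>n. nonneg_graphon (?M n) (?W n)"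
    have neg: "(LINT z|sq lborel. max (- F k (fst z) (snd z)) 0) \<le> 1" for k
    proof -
      have "(LINT z|sq lborel. max (- F k (fst z) (snd z)) 0)
        \<le> (LINT z|sq (?M (q k)). max (- ?W (q k) (fst z) (snd z)) 0) + 1 * h k"
        by (rule transfer[OF test_function_negpart]) (auto simp: max_def)
      also have "(LINT z|sq (?M (q k)). max (- ?W (q k) (fst z) (snd z)) 0) = (LINT z|sq (?M (q k)). 0)"
      proof (rule Bochner_Integration.integral_cong[OF refl])
        fix z assume "z \<in> space (sq (?M (q k)))"
        then have "0 \<le> ?W (q k) (fst z) (snd z)" using nn by (auto simp: nonneg_graphon_def space_pair_measure)
        then show "max (- ?W (q k) (fst z) (snd z)) 0 = 0" by simp
      qed
      finally show ?thesis using h0(2)[of k] by simp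
    qed
    define I where "I k = (LINT z|sq lborel. F k (fst z) (snd z))" for k
    have I: "rect_int lborel (F k) UNIV UNIV = I k" for k
      unfolding I_def set_lebesgue_integral_def by simp
    have "L1_norm lborel (F k) \<le> \<bar>I 0\<bar> + 8" for k
    proof -
      have Tn: "integrable (sq lborel) (\<lambda>z. max (- F k (fst z) (snd z)) 0)"
        by (rule test_function_integrable[OF test_function_negpart Fi])
      have "\<bar>rect_int lborel (\<lambda>x y. F 0 x y - F k x y) UNIV UNIV\<bar> \<le> cut_norm lborel (\<lambda>x y. F 0 x y - F k x y)"
        by (rule cut_norm_upper[OF Bochner_Integration.integrable_diff[OF Fi Fi]]) auto
      also have "\<dots> \<le> 6 * (h 0 - h k)" by (rule tele) simp
      also have "\<dots> \<le> 6" using h0(1)[of k] h0(2)[of 0] by simp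
      finally have d: "\<bar>I 0 - I k\<bar> \<le> 6" using rect_int_diff[OF Fi Fi, of UNIV UNIV 0 k] I by simp
      have "L1_norm lborel (F k) = (LINT z|sq lborel. F k (fst z) (snd z) + 2 * max (- F k (fst z) (snd z)) 0)"
        unfolding L1_norm_def by (rule Bochner_Integration.integral_cong) (auto simp: max_def)
      also have "\<dots> = I k + 2 * (LINT z|sq lborel. max (- F k (fst z) (snd z)) 0)"
        using Fi[of k] Tn unfolding I_def by simp
      also have "\<dots> \<le> \<bar>I 0\<bar> + 8" using d neg[of k] by linarith
      finally show ?thesis .
    qed
    then show ?thesis by blast
  qed
  then obtain C1 where C1: "\<And>k. L1_norm lborel (F k) \<le> C1" by blast
  have F_ui': "\<forall>e>0. \<exists>B\<ge>0. \<forall>k. excess lborel (F k) B \<le> e"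
    and cauchy': "\<forall>e>0. \<exists>N. \<forall>m\<ge>N. \<forall>n\<ge>N. cut_norm lborel (\<lambda>x y. F m x y - F n x y) \<le> e"
    using F_ui cauchy by blast+
  obtain w where wi: "gintegrable lborel w" and wsym: "\<forall>x y. w x y = w y x"
    and wlim: "(\<lambda>n. cut_norm lborel (\<lambda>x y. F n x y - w x y)) \<longlonglongrightarrow> 0"
    and wtest: "\<forall>\<psi> c. test_function \<psi> \<longrightarrow> 0 \<le> c \<longrightarrow>
      (\<forall>e>0. eventually (\<lambda>n. (LINT z|sq lborel. \<psi> (F n (fst z) (snd z))) \<le> c + e) sequentially) \<longrightarrow>
      (LINT z|sq lborel. \<psi> (w (fst z) (snd z))) \<le> c"
    using cut_norm_limit[OF sigma_finite_lborel Fi C1 F_ui' cauchy' Fsym] by (elim exE conjE) (rule that)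
  show ?thesis
    unfolding limit_graphon_def
  proof (intro exI[of _ w] conjI allI impI)
    show "graphon lborel w" using wi wsym by (auto simp: graphon_def sigma_finite_lborel)
  next
    fix \<psi> and c :: real
    assume \<psi>: "test_function \<psi>" and c: "0 \<le> c"
      and le: "\<forall>n. (LINT z|sq (?M n). \<psi> (?W n (fst z) (snd z))) \<le> c"
    obtain L where L: "\<And>x y. \<bar>\<psi> x - \<psi> y\<bar> \<le> L * \<bar>x - y\<bar>" using \<psi> by (auto simp: test_function_def)
    have "0 \<le> L" using L[of 1 0] by simp
    show "(LINT z|sq lborel. \<psi> (w (fst z) (snd z))) \<le> c"
    proof (rule wtest[rule_format, OF \<psi> c])
      fix e :: real assume "0 < e"
      have "(\<lambda>k. L * h k) \<longlonglongrightarrow> L * 0" by (intro tendsto_intros hlim)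
      then have "eventually (\<lambda>k. L * h k < e) sequentially" using \<open>0 < e\<close> by (intro order_tendstoD) auto
      then show "eventually (\<lambda>k. (LINT z|sq lborel. \<psi> (F k (fst z) (snd z))) \<le> c + e) sequentially"
      proof eventually_elim
        case (elim k)
        then show ?case using transfer[OF \<psi> L \<open>0 \<le> L\<close>, of k] spec[OF le, of "q k"] by linarith
      qed
    qed
  next
    fix w' assume w': "graphon lborel w'"
      and AE: "AE z in sq lborel. w' (fst z) (snd z) = w (fst z) (snd z)"
    have w'i: "gintegrable lborel w'" using w' by (simp add: graphon_def)
    have "cut_norm lborel (\<lambda>x y. F n x y - w' x y) = cut_norm lborel (\<lambda>x y. F n x y - w x y)" for n
    proof (rule cut_norm_cong_AE)
      show "AE z in sq lborel. F n (fst z) (snd z) - w' (fst z) (snd z) = F n (fst z) (snd z) - w (fst z) (snd z)"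
        using AE by eventually_elim simp
    qed (intro borel_measurable_diff borel_measurable_integrable Fi wi w'i)+
    then have w'lim: "(\<lambda>n. cut_norm lborel (\<lambda>x y. F n x y - w' x y)) \<longlonglongrightarrow> 0" using wlim by simp
    show "cut_converges G lborel w'"
      unfolding cut_converges_def
    proof (rule LIMSEQ_I)
      fix r :: real assume r: "0 < r"
      \<comment> \<open>One index \<open>k\<close> serves all \<open>n \<ge> N k\<close> at once.
        The error is the distance of \<open>F k\<close> from the limit, three times
        \<open>h k\<close> for realising \<open>G n\<close> next to \<open>F k\<close>, and one more
        \<open>h k\<close> for its step approximation, hence \<open>r / 2\<close> and
        \<open>r / 8\<close>.\<close>
      have "eventually (\<lambda>k. cut_norm lborel (\<lambda>x y. F k x y - w' x y) < r / 2) sequentially"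
        using w'lim r by (intro order_tendstoD) auto
      moreover have "eventually (\<lambda>k. h k < r / 8) sequentially" using hlim r by (intro order_tendstoD) auto
      ultimately have "eventually (\<lambda>k. cut_norm lborel (\<lambda>x y. F k x y - w' x y) < r / 2 \<and> h k < r / 8) sequentially"
        by (rule eventually_conj)
      then obtain k where k: "cut_norm lborel (\<lambda>x y. F k x y - w' x y) < r / 2" "h k < r / 8"
        using eventually_happens'[OF sequentially_bot] by blast
      show "\<exists>no. \<forall>n\<ge>no. norm (delta_cut (?M n) (?W n) lborel w' - 0) < r"
      proof (intro exI allI impI)
        fix n assume n: "n \<ge> N k"
        obtain \<tau> J v where v: "step_approx (?M n) (?W n) \<tau> J v (h k)" "\<forall>i j. v i j = v j i"
          using step_approx_exists[OF G[of n] h0(1)[of k]] by blast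
        have "delta_cut (?M (q k)) (?W (q k)) (?M n) (?W n) < h k" using N[OF qN n] .
        from realise_delta_cut[OF G G a v(1) s this] obtain t where t: "realises (?M n) \<tau> J t"
          "cut_norm lborel (\<lambda>x y. u k (s k x) (s k y) - v (t x) (t y)) \<le> h k + h k + h k" by blast
        have T: "gintegrable lborel (step_fun v t)"
        proof -
          have "finite_labelling lborel t J" "label_weights J v" using t v by (auto simp: realises_def step_approx_def)
          then show ?thesis by (rule label_weights_integrable[OF sigma_finite_lborel])
        qed
        have "delta_cut (?M n) (?W n) lborel w' \<le> cut_norm lborel (\<lambda>x y. v (t x) (t y) - w' x y) + h k"
          by (rule delta_cut_lborel_le[OF G w' v(1) t(1)])
        also have "cut_norm lborel (\<lambda>x y. v (t x) (t y) - w' x y)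
          \<le> cut_norm lborel (\<lambda>x y. v (t x) (t y) - F k x y) + cut_norm lborel (\<lambda>x y. F k x y - w' x y)"
          by (rule cut_norm_triangle[OF T Fi w'i])
        also have "cut_norm lborel (\<lambda>x y. v (t x) (t y) - F k x y) = cut_norm lborel (\<lambda>x y. F k x y - v (t x) (t y))"
          by (rule cut_norm_commute)
        finally have "delta_cut (?M n) (?W n) lborel w' < r" using t(2) k unfolding F_def by linarith
        moreover have "0 \<le> delta_cut (?M n) (?W n) lborel w'" by (rule delta_cut_nonneg[OF G w'])
        ultimately show "norm (delta_cut (?M n) (?W n) lborel w' - 0) < r" by simp
      qed
    qed
  qed
qed

section \<open>Completeness of the classes\<close>

text \<open>Subtracting the threshold only decreases the integrand on the tail set. The threshold is
  made nonnegative, as the integrand of \<open>excess\<close> at a negative one need not be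
  integrable over infinite mass.\<close>

lemma trunc_integral_le_tail:
  assumes W: "gintegrable M W"
  shows "excess M W (max B 0) \<le> tail_int M W (max B 0)"
  unfolding tail_int_def set_lebesgue_integral_def
proof (rule integral_mono)
  let ?B = "max B 0"
  show "integrable (sq M) (\<lambda>z. max (\<bar>W (fst z) (snd z)\<bar> - ?B) 0)"
    using test_function_integrable[OF test_function_max[OF test_function_abs] W, of ?B] by simp
  note [measurable] = borel_measurable_integrable[OF W]
  show "integrable (sq M) (\<lambda>z. indicator {z. \<bar>W (fst z) (snd z)\<bar> > ?B} z *\<^sub>R \<bar>W (fst z) (snd z)\<bar>)"
  proof (rule Bochner_Integration.integrable_bound[OF W])
    have "(\<lambda>z. if \<bar>W (fst z) (snd z)\<bar> > ?B then \<bar>W (fst z) (snd z)\<bar> else 0) \<in> borel_measurable (sq M)"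
      by measurable
    moreover have "(\<lambda>z. if \<bar>W (fst z) (snd z)\<bar> > ?B then \<bar>W (fst z) (snd z)\<bar> else 0)
      = (\<lambda>z. indicator {z. \<bar>W (fst z) (snd z)\<bar> > ?B} z *\<^sub>R \<bar>W (fst z) (snd z)\<bar>)"
      by (auto simp: fun_eq_iff)
    ultimately show "(\<lambda>z. indicator {z. \<bar>W (fst z) (snd z)\<bar> > ?B} z *\<^sub>R \<bar>W (fst z) (snd z)\<bar>) \<in> borel_measurable (sq M)"
      by simp
  qed (auto simp: indicator_def)
  show "max (\<bar>W (fst z) (snd z)\<bar> - ?B) 0 \<le> indicator {z. \<bar>W (fst z) (snd z)\<bar> > ?B} z *\<^sub>R \<bar>W (fst z) (snd z)\<bar>" for z
    by (auto simp: indicator_def)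
qed

lemma semiunif_integrable_trunc:
  assumes A: "semiunif_integrable A" and G: "\<And>H. H \<in> A \<Longrightarrow> graphon (fst H) (snd H)"
  shows "\<forall>e>0. \<exists>B\<ge>0. \<forall>H\<in>A. excess (fst H) (snd H) B \<le> e"
proof (intro allI impI)
  fix e :: real assume e: "0 < e"
  obtain B0 where B0: "\<And>B H. B \<ge> B0 \<Longrightarrow> H \<in> A \<Longrightarrow> tail_int (fst H) (snd H) B \<le> e"
    using A e unfolding semiunif_integrable_def by blast
  have "excess (fst H) (snd H) (max B0 0) \<le> e" if "H \<in> A" for H
  proof -
    have "gintegrable (fst H) (snd H)" using G[OF that] by (simp add: graphon_def)
    from trunc_integral_le_tail[OF this, of B0] B0[of "max B0 0" H] that show ?thesis by simp
  qed
  then show "\<exists>B\<ge>0. \<forall>H\<in>A. excess (fst H) (snd H) B \<le> e"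
    by (intro exI[of _ "max B0 0"]) auto
qed

section \<open>Norm bounds in L^p, as uniform integrability and through test functions\<close>

lemma max_le_powr:
  fixes x r B :: real
  assumes r: "1 < r" and B: "0 < B"
  shows "max (\<bar>x\<bar> - B) 0 \<le> \<bar>x\<bar> powr r * B powr (1 - r)"
proof (cases "\<bar>x\<bar> \<le> B")
  case False
  then have x: "0 < \<bar>x\<bar>" "B \<le> \<bar>x\<bar>" using B by linarith+
  \<comment> \<open>The exponent \<open>1 - r\<close> is negative, so this power is decreasing and
    may be estimated by its value at \<open>B\<close>.\<close>
  have "\<bar>x\<bar> = \<bar>x\<bar> powr r * \<bar>x\<bar> powr (1 - r)" using x by (simp add: powr_add[symmetric])
  also have "\<dots> \<le> \<bar>x\<bar> powr r * B powr (1 - r)"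
    using x B r by (intro mult_left_mono powr_mono2') auto
  finally show ?thesis using B by auto
qed auto

lemma Lp_finite_bound:
  assumes p: "1 < p" "p \<noteq> \<infinity>" and W: "gintegrable M W" and L: "Lp_le p C M W"
  defines "r \<equiv> real_of_ereal p"
  shows "1 < r" "0 \<le> C" "integrable (sq M) (\<lambda>z. \<bar>W (fst z) (snd z)\<bar> powr r)"
    "(LINT z|sq M. \<bar>W (fst z) (snd z)\<bar> powr r) \<le> C powr r"
proof -
  show r: "1 < r" using p unfolding r_def by (cases p) auto
  note [measurable] = borel_measurable_integrable[OF W]
  have L': "(\<integral>\<^sup>+ z. ennreal (\<bar>W (fst z) (snd z)\<bar> powr r) \<partial>(sq M)) < \<infinity>"
    "(LINT z|sq M. \<bar>W (fst z) (snd z)\<bar> powr r) powr (1 / r) \<le> C"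
    using L p unfolding Lp_le_def r_def by auto
  show "0 \<le> C" by (rule order_trans[OF _ L'(2)]) simp
  show "integrable (sq M) (\<lambda>z. \<bar>W (fst z) (snd z)\<bar> powr r)"
    by (rule integrableI_bounded) (use L'(1) in auto)
  have pos: "0 \<le> (LINT z|sq M. \<bar>W (fst z) (snd z)\<bar> powr r)" by simp
  have "((LINT z|sq M. \<bar>W (fst z) (snd z)\<bar> powr r) powr (1 / r)) powr r \<le> C powr r"
    using L'(2) r by (intro powr_mono2) auto
  then show "(LINT z|sq M. \<bar>W (fst z) (snd z)\<bar> powr r) \<le> C powr r"
    using r pos by (simp add: powr_powr)
qed

lemma AE_bounded_trunc:
  fixes W :: "'a \<Rightarrow> 'a \<Rightarrow> real"
  assumes "AE z in sq M. \<bar>W (fst z) (snd z)\<bar> \<le> C" "C \<le> B"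
  shows "excess M W B = 0"
proof (rule integral_eq_zero_AE)
  show "AE z in sq M. max (\<bar>W (fst z) (snd z)\<bar> - B) 0 = 0"
    using assms(1) by eventually_elim (use assms(2) in linarith)
qed

text \<open>For finite \<open>p\<close> the excess is at most
  \<open>C powr r * B powr (1 - r)\<close>, which tends to 0 because \<open>r\<close> exceeds 1. For
  \<open>p = \<infinity>\<close> it vanishes from \<open>\<bar>C\<bar>\<close> on.\<close>

lemma Lp_bounded_trunc:
  fixes A :: "('a measure \<times> ('a \<Rightarrow> 'a \<Rightarrow> real)) set"
  assumes p: "1 < p" and G: "\<And>H. H \<in> A \<Longrightarrow> graphon (fst H) (snd H)"
    and L: "\<And>H. H \<in> A \<Longrightarrow> Lp_le p C (fst H) (snd H)"
  shows "\<forall>e>0. \<exists>B\<ge>0. \<forall>H\<in>A. excess (fst H) (snd H) B \<le> e"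
proof (intro allI impI, cases "p = \<infinity>")
  fix e :: real assume e: "0 < e"

  assume True: "p = \<infinity>"
  have "excess (fst H) (snd H) \<bar>C\<bar> \<le> e" if "H \<in> A" for H
    using AE_bounded_trunc[where M="fst H" and W="snd H" and C=C and B="\<bar>C\<bar>"] L[OF that] e True by (simp add: Lp_le_def)
  then show "\<exists>B\<ge>0. \<forall>H\<in>A. excess (fst H) (snd H) B \<le> e"
    by (intro exI[of _ "\<bar>C\<bar>"]) auto
next
  fix e :: real assume e: "0 < e" and False: "p \<noteq> \<infinity>"
  define r where "r = real_of_ereal p"
  have r: "1 < r" using p False unfolding r_def by (cases p) auto
  have "((\<lambda>B. C powr r * B powr (1 - r)) \<longlongrightarrow> C powr r * 0) at_top"
    using r by (intro tendsto_intros tendsto_neg_powr filterlim_ident) auto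
  then have "eventually (\<lambda>B. C powr r * B powr (1 - r) < e) at_top"
    using e by (intro order_tendstoD) auto
  then have "eventually (\<lambda>B. C powr r * B powr (1 - r) < e \<and> 0 < B) at_top"
    using eventually_gt_at_top[of 0] by (rule eventually_conj)
  then obtain B where B: "C powr r * B powr (1 - r) < e" "0 < B"
    using eventually_happens'[OF trivial_limit_at_top_linorder] by blast
  have "excess (fst H) (snd H) B \<le> e" if "H \<in> A" for H
  proof -
    have W: "gintegrable (fst H) (snd H)" using G[OF that] by (simp add: graphon_def)
    note b = Lp_finite_bound[OF p False W L[OF that], folded r_def]
    have "excess (fst H) (snd H) B
      \<le> (LINT z|sq (fst H). \<bar>snd H (fst z) (snd z)\<bar> powr r * B powr (1 - r))"
    proof (rule integral_mono)
      show "integrable (sq (fst H)) (\<lambda>z. max (\<bar>snd H (fst z) (snd z)\<bar> - B) 0)"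
        using test_function_integrable[OF test_function_max[OF test_function_abs] W, of B] B(2) by simp
    qed (use b(3) max_le_powr[OF r B(2)] in auto)
    also have "\<dots> = (LINT z|sq (fst H). \<bar>snd H (fst z) (snd z)\<bar> powr r) * B powr (1 - r)" by simp
    also have "\<dots> \<le> C powr r * B powr (1 - r)" by (rule mult_right_mono[OF b(4)]) simp
    finally show ?thesis using B(1) by simp
  qed
  then show "\<exists>B\<ge>0. \<forall>H\<in>A. excess (fst H) (snd H) B \<le> e"
    using B(2) by (intro exI[of _ B]) auto
qed

text \<open>\<open>powr_cut r B\<close> follows \<open>\<bar>x\<bar> powr r\<close> up to \<open>B\<close> and continues along its tangent there; it is the
  supremum of the tangents at the points of \<open>[0, B]\<close>.\<close>

definition powr_tangent :: "real \<Rightarrow> real \<Rightarrow> real \<Rightarrow> real" where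
  "powr_tangent r t y = t powr r + r * t powr (r - 1) * (y - t)"

definition powr_cut :: "real \<Rightarrow> real \<Rightarrow> real \<Rightarrow> real" where
  "powr_cut r B x = powr_tangent r (min \<bar>x\<bar> B) \<bar>x\<bar>"

text \<open>Bernoulli's inequality, which is the case of the tangent at 1, scaled by
  \<open>t\<close>. The values \<open>t = 0\<close> and \<open>y = 0\<close> are treated apart
  because convexity and derivative of the power are used on the open half line.\<close>

lemma powr_tangent_le_powr:
  assumes r: "1 < r" and t: "0 \<le> t" and y: "0 \<le> y"
  shows "powr_tangent r t y \<le> y powr r"
proof (cases "t = 0")
  case True
  then show ?thesis using r by (simp add: powr_tangent_def)
next
  case False
  then have t: "0 < t" using t by simp
  have bern: "1 + r * (y / t - 1) \<le> (y / t) powr r"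
  proof (cases "y = 0")
    case True
    then show ?thesis using r by simp
  next
    case False
    then have "0 < y / t" using y t by simp
    have conv: "convex_on {0<..} (\<lambda>x. x powr r)"
      by (rule convex_on_subset[OF powr_convex]) (use r in auto)
    have "((\<lambda>x. x powr r) has_real_derivative r * 1 powr (r - 1)) (at 1)"
      using has_real_derivative_powr[of 1 r] by simp
    then have "((\<lambda>x. x powr r) has_real_derivative r) (at 1 within {0<..})"
      by (simp add: has_field_derivative_at_within)
    from convex_on_imp_above_tangent[OF conv _ _ _ this, of "y / t"] \<open>0 < y / t\<close>
    have "(y / t) powr r - 1 powr r \<ge> r * (y / t - 1)" by (simp add: interior_open)
    then show ?thesis by simp
  qed
  have tr: "t powr r = t powr (r - 1) * t" using t by (simp add: powr_diff)
  have "powr_tangent r t y = t powr r * (1 + r * (y / t - 1))"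
    unfolding powr_tangent_def tr using t by (simp add: field_simps)
  also have "\<dots> \<le> t powr r * (y / t) powr r" using bern by (intro mult_left_mono) auto
  also have "\<dots> = y powr r" using t y by (simp add: powr_mult[symmetric])
  finally show ?thesis .
qed

lemma powr_tangent_self: "powr_tangent r t t = t powr r"
  by (simp add: powr_tangent_def)

text \<open>Beyond \<open>B\<close> two lines are compared. The tangent at \<open>B\<close> is not
  below the tangent at \<open>t\<close> when both are evaluated at \<open>B\<close>, and its slope
  is not smaller.\<close>

lemma powr_tangent_le_cut:
  assumes r: "1 < r" and t: "0 \<le> t" "t \<le> B"
  shows "powr_tangent r t \<bar>x\<bar> \<le> powr_cut r B x"
proof (cases "\<bar>x\<bar> \<le> B")
  case True
  then show ?thesis using powr_tangent_le_powr[OF r t(1), of "\<bar>x\<bar>"] by (simp add: powr_cut_def powr_tangent_self)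
next
  case False
  have "powr_tangent r B \<bar>x\<bar> - powr_tangent r t \<bar>x\<bar>
    = (B powr r - powr_tangent r t B) + r * (B powr (r - 1) - t powr (r - 1)) * (\<bar>x\<bar> - B)"
    by (simp add: powr_tangent_def algebra_simps)
  moreover have "0 \<le> B powr r - powr_tangent r t B" using powr_tangent_le_powr[OF r t(1), of B] t by simp
  moreover have "t powr (r - 1) \<le> B powr (r - 1)" using r t by (intro powr_mono2) auto
  then have "0 \<le> r * (B powr (r - 1) - t powr (r - 1)) * (\<bar>x\<bar> - B)" using r False by (intro mult_nonneg_nonneg) auto
  ultimately show ?thesis using False by (simp add: powr_cut_def)
qed

lemma powr_cut_le_powr: "1 < r \<Longrightarrow> 0 \<le> B \<Longrightarrow> powr_cut r B x \<le> \<bar>x\<bar> powr r"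
  unfolding powr_cut_def by (rule powr_tangent_le_powr) auto

lemma powr_cut_eq: "\<bar>x\<bar> \<le> B \<Longrightarrow> powr_cut r B x = \<bar>x\<bar> powr r"
  by (simp add: powr_cut_def powr_tangent_self)

text \<open>All properties come from the tangents: the tangent that attains the value at one point
  lies below \<open>powr_cut\<close> at every other, and its slope is between 0 and
  \<open>r * B powr (r - 1)\<close>.\<close>

lemma test_function_powr_cut:
  assumes r: "1 < r" and B: "0 \<le> B"
  shows "test_function (powr_cut r B)"
  unfolding test_function_def
proof (intro conjI allI exI)
  have slope: "0 \<le> r * t powr (r - 1)" "r * t powr (r - 1) \<le> r * B powr (r - 1)" if "0 \<le> t" "t \<le> B" for t
    using r that by (auto intro!: mult_left_mono powr_mono2)
  fix x y :: real
  let ?t = "min \<bar>(x + y) / 2\<bar> B"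
  have t: "0 \<le> ?t" "?t \<le> B" using B by auto
  have "powr_cut r B ((x + y) / 2) = powr_tangent r ?t \<bar>(x + y) / 2\<bar>" by (simp only: powr_cut_def)
  also have "\<dots> \<le> powr_tangent r ?t ((\<bar>x\<bar> + \<bar>y\<bar>) / 2)"
    unfolding powr_tangent_def using slope(1)[OF t]
    by (intro add_left_mono mult_left_mono diff_right_mono) (auto simp: abs_triangle_ineq divide_right_mono)
  also have "\<dots> = (powr_tangent r ?t \<bar>x\<bar> + powr_tangent r ?t \<bar>y\<bar>) / 2"
    by (simp add: powr_tangent_def field_simps)
  also have "\<dots> \<le> (powr_cut r B x + powr_cut r B y) / 2"
    using powr_tangent_le_cut[OF r t] by (intro divide_right_mono add_mono) auto
  finally show "powr_cut r B ((x + y) / 2) \<le> (powr_cut r B x + powr_cut r B y) / 2" .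
  show "0 \<le> powr_cut r B x" using powr_tangent_le_cut[OF r order_refl B, of x] r by (simp add: powr_tangent_def)
  show "powr_cut r B 0 = 0" using B r by (simp add: powr_cut_def powr_tangent_def min_def)
  have half: "powr_cut r B x - powr_cut r B y \<le> r * B powr (r - 1) * \<bar>x - y\<bar>" for x y
  proof -
    let ?t = "min \<bar>x\<bar> B"
    have t: "0 \<le> ?t" "?t \<le> B" using B by auto
    have "powr_cut r B x - powr_cut r B y \<le> powr_tangent r ?t \<bar>x\<bar> - powr_tangent r ?t \<bar>y\<bar>"
      using powr_tangent_le_cut[OF r t, of y] by (simp add: powr_cut_def)
    also have "\<dots> = r * ?t powr (r - 1) * (\<bar>x\<bar> - \<bar>y\<bar>)" by (simp add: powr_tangent_def algebra_simps)
    also have "\<dots> \<le> r * ?t powr (r - 1) * \<bar>x - y\<bar>" using slope(1)[OF t] by (intro mult_left_mono) auto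
    also have "\<dots> \<le> r * B powr (r - 1) * \<bar>x - y\<bar>" using slope(2)[OF t] by (intro mult_right_mono) auto
    finally show ?thesis .
  qed
  show "\<bar>powr_cut r B x - powr_cut r B y\<bar> \<le> r * B powr (r - 1) * \<bar>x - y\<bar>"
    using half[of x y] half[of y x] by (simp add: abs_le_iff abs_minus_commute)
qed

text \<open>The power itself is not Lipschitz, hence not a test function. At each point the
  functions \<open>powr_cut r (real n)\<close> agree with it from some \<open>n\<close> on, and
  Fatou's lemma transfers their common bound.\<close>

lemma Lp_le_of_test:
  assumes p: "1 < p" "p \<noteq> \<infinity>" and C: "0 \<le> C" and W: "gintegrable M W"
    and le: "\<And>B. 0 \<le> B \<Longrightarrow> (LINT z|sq M. powr_cut (real_of_ereal p) B (W (fst z) (snd z))) \<le> C powr real_of_ereal p"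
  shows "Lp_le p C M W"
proof -
  define r where "r = real_of_ereal p"
  have r: "1 < r" using p unfolding r_def by (cases p) auto
  note [measurable] = borel_measurable_integrable[OF W]
  let ?f = "\<lambda>z. W (fst z) (snd z)"
  note T = test_function_powr_cut[OF r]
  have mT: "powr_cut r (real n) \<in> borel_measurable borel" for n by (rule test_function_measurable[OF T]) simp
  note [measurable] = mT
  have "(\<integral>\<^sup>+z. ennreal (\<bar>?f z\<bar> powr r) \<partial>(sq M)) = (\<integral>\<^sup>+z. liminf (\<lambda>n. ennreal (powr_cut r (real n) (?f z))) \<partial>(sq M))"
  proof (rule nn_integral_cong)
    fix z
    obtain n0 :: nat where n0: "\<bar>?f z\<bar> \<le> real n0" using real_arch_simple by blast
    have "eventually (\<lambda>n. ennreal (powr_cut r (real n) (?f z)) = ennreal (\<bar>?f z\<bar> powr r)) sequentially"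
      unfolding eventually_sequentially using n0 by (intro exI[of _ n0]) (auto simp: powr_cut_eq)
    then have "(\<lambda>n. ennreal (powr_cut r (real n) (?f z))) \<longlonglongrightarrow> ennreal (\<bar>?f z\<bar> powr r)" by (rule tendsto_eventually)
    then show "ennreal (\<bar>?f z\<bar> powr r) = liminf (\<lambda>n. ennreal (powr_cut r (real n) (?f z)))"
      by (intro lim_imp_Liminf[symmetric]) auto
  qed
  also have "\<dots> \<le> liminf (\<lambda>n. \<integral>\<^sup>+z. ennreal (powr_cut r (real n) (?f z)) \<partial>(sq M))"
    by (rule nn_integral_liminf) measurable
  also have "\<dots> \<le> liminf (\<lambda>n::nat. ennreal (C powr r))"
  proof (rule Liminf_mono, rule always_eventually, rule allI)
    fix n :: nat
    have "(\<integral>\<^sup>+z. ennreal (powr_cut r (real n) (?f z)) \<partial>(sq M)) = ennreal (LINT z|sq M. powr_cut r (real n) (?f z))"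
      by (rule nn_integral_eq_integral[OF test_function_integrable[OF T W]])
         (use T[of "real n"] in \<open>auto simp: test_function_def\<close>)
    then show "(\<integral>\<^sup>+z. ennreal (powr_cut r (real n) (?f z)) \<partial>(sq M)) \<le> ennreal (C powr r)"
      using le[of "real n"] by (simp add: r_def ennreal_leI)
  qed
  also have "\<dots> = ennreal (C powr r)" by (rule Liminf_const) simp
  finally have nn: "(\<integral>\<^sup>+z. ennreal (\<bar>?f z\<bar> powr r) \<partial>(sq M)) \<le> ennreal (C powr r)" .
  then have fin: "(\<integral>\<^sup>+z. ennreal (\<bar>?f z\<bar> powr r) \<partial>(sq M)) < \<infinity>" by (auto intro: le_less_trans)
  have int: "integrable (sq M) (\<lambda>z. \<bar>?f z\<bar> powr r)" by (rule integrableI_bounded) (use fin in auto)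
  have "ennreal (LINT z|sq M. \<bar>?f z\<bar> powr r) \<le> ennreal (C powr r)"
    using nn by (subst nn_integral_eq_integral[symmetric, OF int]) auto
  then have "(LINT z|sq M. \<bar>?f z\<bar> powr r) \<le> C powr r" by (simp add: ennreal_le_iff)
  then have "(LINT z|sq M. \<bar>?f z\<bar> powr r) powr (1 / r) \<le> (C powr r) powr (1 / r)"
    using r by (intro powr_mono2) auto
  also have "\<dots> = C" using r C by (simp add: powr_powr)
  finally show ?thesis using fin p unfolding Lp_le_def r_def by auto
qed

text \<open>A pointwise constraint reaches the limit as the vanishing of the integral of a test
  function that measures its violation.\<close>

lemma test_integral_0_AE:
  assumes \<psi>: "test_function \<psi>" and W: "gintegrable M W"
    and le: "(LINT z|sq M. \<psi> (W (fst z) (snd z))) \<le> 0"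
  shows "AE z in sq M. \<psi> (W (fst z) (snd z)) = 0"
proof -
  have pos: "0 \<le> \<psi> x" for x using \<psi> by (simp add: test_function_def)
  have "(LINT z|sq M. \<psi> (W (fst z) (snd z))) = 0"
    using le pos by (intro antisym integral_nonneg_AE) auto
  then show ?thesis
    using pos by (subst integral_nonneg_eq_0_iff_AE[symmetric, OF test_function_integrable[OF \<psi> W]]) auto
qed

lemma test_function_pos_part: "0 \<le> B \<Longrightarrow> test_function (\<lambda>x. max (x - B) 0)"
  unfolding test_function_def by (intro conjI allI exI[of _ 1]) (auto simp: max_def field_simps)

text \<open>Sign and range constraints are asked for at every point, while the limit satisfies them
  almost everywhere; clipping repairs the exceptional null set.\<close>

lemma graphon_clip:
  assumes w: "graphon lborel w" and f: "f \<in> borel_measurable borel" "\<And>x. \<bar>f x\<bar> \<le> \<bar>x\<bar>"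
  shows "graphon lborel (\<lambda>x y. f (w x y))"
proof -
  have wi: "gintegrable lborel w" using w by (simp add: graphon_def)
  have "gintegrable lborel (\<lambda>x y. f (w x y))"
    by (rule Bochner_Integration.integrable_bound[OF wi])
       (use f measurable_compose[OF borel_measurable_integrable[OF wi] f(1)] in auto)
  then show ?thesis using w by (auto simp: graphon_def)
qed

lemma sigma_finite_null: "sigma_finite_measure (null_measure (lborel :: real measure))"
  by (rule finite_measure.axioms) (auto intro!: finite_measureI)

text \<open>For \<open>p = \<infinity>\<close> and \<open>C < 0\<close> the bound only says that all the spaces are null.\<close>

lemma cut_converges_null:
  fixes G :: "nat \<Rightarrow> 'a measure \<times> ('a \<Rightarrow> 'a \<Rightarrow> real)"
  assumes G: "\<And>n. graphon (fst (G n)) (snd (G n))"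
    and L: "\<And>n. Lp_le \<infinity> C (fst (G n)) (snd (G n))" and C: "C < 0"
  shows "graphon (null_measure (lborel :: real measure)) (\<lambda>_ _. 0)"
    "Lp_le \<infinity> C (null_measure (lborel :: real measure)) (\<lambda>_ _. 0)"
    "cut_converges G (null_measure (lborel :: real measure)) (\<lambda>_ _. 0)"
proof -
  let ?N = "null_measure (lborel :: real measure)"
  show g: "graphon ?N (\<lambda>_ _. 0)" using sigma_finite_null by (simp add: graphon_def)
  interpret N: sigma_finite_measure ?N by (rule sigma_finite_null)
  have S: "space ?N \<times> space ?N \<in> sets (sq ?N)" by (intro pair_measureI sets.top)
  have "emeasure (sq ?N) (space ?N \<times> space ?N) = emeasure ?N (space ?N) * emeasure ?N (space ?N)"
    by (intro N.emeasure_pair_measure_Times sets.top)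
  then have Z: "emeasure (sq ?N) (space ?N \<times> space ?N) = 0" by simp
  have "AE z in sq ?N. False"
    by (rule AE_I[OF _ Z S]) (simp add: space_pair_measure)
  then show "Lp_le \<infinity> C ?N (\<lambda>_ _. 0)" by (auto simp: Lp_le_def elim: eventually_mono)
  have z: "AE z in sq (fst (G n)). False" for n
  proof -
    have "AE z in sq (fst (G n)). \<bar>snd (G n) (fst z) (snd z)\<bar> \<le> C" using L[of n] by (simp add: Lp_le_def)
    then show ?thesis by eventually_elim (use C in auto)
  qed
  have "delta_cut (fst (G n)) (snd (G n)) ?N (\<lambda>_ _. 0) = 0" for n
  proof -
    have M: "sigma_finite_measure (fst (G n))" and W: "gintegrable (fst (G n)) (snd (G n))"
      using G[of n] by (auto simp: graphon_def)
    interpret sigma_finite_measure "fst (G n)" by (rule M)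
    have "emeasure (sq (fst (G n))) (space (fst (G n)) \<times> space (fst (G n))) = 0"
    proof -
      obtain N where N: "{x \<in> space (sq (fst (G n))). \<not> False} \<subseteq> N"
        "emeasure (sq (fst (G n))) N = 0" "N \<in> sets (sq (fst (G n)))"
        by (rule AE_E[OF z[of n]])
      have "emeasure (sq (fst (G n))) (space (fst (G n)) \<times> space (fst (G n))) \<le> emeasure (sq (fst (G n))) N"
        by (rule emeasure_mono) (use N in \<open>auto simp: space_pair_measure\<close>)
      then show ?thesis using N(2) by simp
    qed
    then have m: "emeasure (fst (G n)) (space (fst (G n))) = 0"
      by (simp add: emeasure_pair_measure_Times)
    have eq: "emeasure (fst (G n)) (space (fst (G n))) = emeasure ?N (space ?N)" using m by simp
    obtain N :: "('a \<times> real) measure" and \<phi>1 \<phi>2 where c: "coupling N (fst (G n)) ?N \<phi>1 \<phi>2"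
      using coupling_exists[OF M sigma_finite_null eq] by blast
    have sN: "sigma_finite_measure N" and p: "measure_preserving N (fst (G n)) \<phi>1" using c by (auto simp: coupling_def)
    have P: "gintegrable N (pullback (snd (G n)) \<phi>1)" by (rule pullback_integrable[OF p M W])
    have "L1_norm (fst (G n)) (snd (G n)) = 0"
      unfolding L1_norm_def by (rule integral_eq_zero_AE) (use z[of n] in auto)
    then have L: "L1_norm N (pullback (snd (G n)) \<phi>1) = 0" using pullback_L1_norm[OF p M W] by simp
    have "delta_eq (fst (G n)) (snd (G n)) ?N (\<lambda>_ _. 0) \<le> cut_norm N (\<lambda>x y. pullback (snd (G n)) \<phi>1 x y - pullback (\<lambda>_ _. 0) \<phi>2 x y)"
      by (rule delta_eq_le[OF M sigma_finite_null W _ c]) simp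
    also have "\<dots> = cut_norm N (pullback (snd (G n)) \<phi>1)" by (simp add: pullback_def)
    also have "\<dots> \<le> 0" using cut_norm_le_L1[OF P] L by simp
    finally have "delta_cut (fst (G n)) (snd (G n)) ?N (\<lambda>_ _. 0) \<le> 0" using eq by (simp add: delta_cut_def)
    then show ?thesis using delta_cut_nonneg[OF G[of n] g] by simp
  qed
  then show "cut_converges G ?N (\<lambda>_ _. 0)" by (simp add: cut_converges_def)
qed

text \<open>Common source of all the assertions on relative completeness, which differ only in how
  the decay of the excess and one of the two alternatives in \<open>bd\<close> are obtained.\<close>

lemma rel_complete_trunc:
  fixes A :: "('a measure \<times> ('a \<Rightarrow> 'a \<Rightarrow> real)) set"
  assumes G: "\<And>H. H \<in> A \<Longrightarrow> graphon (fst H) (snd H)"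
    and ui: "\<forall>e>0. \<exists>B\<ge>0. \<forall>H\<in>A. excess (fst H) (snd H) B \<le> e"
    and bd: "(\<exists>K. \<forall>H\<in>A. L1_norm (fst H) (snd H) \<le> K) \<or> (\<forall>H\<in>A. nonneg_graphon (fst H) (snd H))"
  shows "rel_complete A"
  unfolding rel_complete_def
proof (intro allI impI, elim conjE)
  fix \<Gamma> assume \<Gamma>: "\<forall>n. \<Gamma> n \<in> A" and C: "cut_cauchy \<Gamma>"
  have ui': "\<forall>e>0. \<exists>B\<ge>0. \<forall>n. excess (fst (\<Gamma> n)) (snd (\<Gamma> n)) B \<le> e"
    using ui \<Gamma> by meson
  have bd': "(\<exists>K. \<forall>n. L1_norm (fst (\<Gamma> n)) (snd (\<Gamma> n)) \<le> K) \<or> (\<forall>n. nonneg_graphon (fst (\<Gamma> n)) (snd (\<Gamma> n)))"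
    using bd \<Gamma> by blast
  obtain w where w: "limit_graphon \<Gamma> w"
    using cut_cauchy_limit[OF G[OF spec[OF \<Gamma>]] C ui' bd'] by blast
  have "cut_converges \<Gamma> lborel w"
    by (rule limit_graphon_converges[OF w limit_graphon_graphon[OF w]]) simp
  then show "\<exists>(M :: real measure) W. graphon M W \<and> cut_converges \<Gamma> M W" using limit_graphon_graphon[OF w] by blast
qed

lemma complete_unit:
  "complete_class (\<lambda>(M::'a measure) W. unit_graphon M W) (\<lambda>M W. unit_graphon M W)"
  unfolding complete_class_def
proof (intro allI impI, elim conjE)
  fix G :: "nat \<Rightarrow> 'a measure \<times> ('a \<Rightarrow> 'a \<Rightarrow> real)"
  assume G: "\<forall>n. graphon (fst (G n)) (snd (G n)) \<and> unit_graphon (fst (G n)) (snd (G n))" and C: "cut_cauchy G"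
  have g: "graphon (fst (G n)) (snd (G n))" for n using G by simp
  have unit: "0 \<le> snd (G n) (fst z) (snd z)" "snd (G n) (fst z) (snd z) \<le> 1"
    if "z \<in> space (sq (fst (G n)))" for n z
    using G that by (auto simp: unit_graphon_def space_pair_measure)
  have zero: "(LINT z|sq (fst (G n)). \<psi> (snd (G n) (fst z) (snd z))) = 0"
    if "\<And>x. 0 \<le> x \<Longrightarrow> x \<le> 1 \<Longrightarrow> \<psi> x = 0" for \<psi> :: "real \<Rightarrow> real" and n
  proof -
    have "(LINT z|sq (fst (G n)). \<psi> (snd (G n) (fst z) (snd z))) = (LINT z|sq (fst (G n)). 0)"
      by (rule Bochner_Integration.integral_cong[OF refl]) (use that unit in blast)
    then show ?thesis by simp
  qed
  \<comment> \<open>At level 1 the excess of a unit graphon vanishes, so this level serves every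
    \<open>e\<close>.\<close>
  have ui: "\<forall>e>0. \<exists>B\<ge>0. \<forall>n. excess (fst (G n)) (snd (G n)) B \<le> e"
    using zero[of "\<lambda>x. max (\<bar>x\<bar> - 1) 0"] by (intro allI impI exI[of _ 1]) auto
  have nonneg: "\<forall>n. nonneg_graphon (fst (G n)) (snd (G n))"
    using G by (auto simp: nonneg_graphon_def unit_graphon_def)
  obtain w where w: "limit_graphon G w"
    using cut_cauchy_limit[OF g C ui disjI2[OF nonneg]] by blast
  have wi: "gintegrable lborel w" using limit_graphon_graphon[OF w] by (simp add: graphon_def)
  \<comment> \<open>None of the \<open>G n\<close> leaves the unit interval, so the test functions
    for the negative part and for the part above 1 integrate to 0 on the limit as well.\<close>
  have "(LINT z|sq lborel. max (- w (fst z) (snd z)) 0) \<le> 0"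
    by (rule limit_graphon_test[OF w test_function_negpart order_refl]) (subst zero, auto)
  then have AE1: "AE z in sq lborel. max (- w (fst z) (snd z)) 0 = 0"
    by (rule test_integral_0_AE[OF test_function_negpart wi])
  have T: "test_function (\<lambda>x. max (x - 1) 0)" by (rule test_function_pos_part) simp
  have "(LINT z|sq lborel. max (w (fst z) (snd z) - 1) 0) \<le> 0"
    by (rule limit_graphon_test[OF w T order_refl]) (subst zero, auto)
  then have AE2: "AE z in sq lborel. max (w (fst z) (snd z) - 1) 0 = 0"
    by (rule test_integral_0_AE[OF T wi])
  let ?f = "\<lambda>x::real. min 1 (max 0 x)"
  have "graphon lborel (\<lambda>x y. ?f (w x y))" by (rule graphon_clip[OF limit_graphon_graphon[OF w]]) auto
  moreover have "AE z in sq lborel. ?f (w (fst z) (snd z)) = w (fst z) (snd z)"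
    using AE1 AE2 by eventually_elim (auto simp: max_def split: if_splits)
  ultimately have "cut_converges G lborel (\<lambda>x y. ?f (w x y))" by (rule limit_graphon_converges[OF w])
  moreover have "unit_graphon lborel (\<lambda>x y. ?f (w x y))" by (auto simp: unit_graphon_def)
  moreover have "graphon lborel (\<lambda>x y. ?f (w x y))" by (rule graphon_clip[OF limit_graphon_graphon[OF w]]) auto
  ultimately show "\<exists>(M :: real measure) W. graphon M W \<and> unit_graphon M W \<and> cut_converges G M W"
    by (intro exI[of _ lborel] exI[of _ "\<lambda>x y. ?f (w x y)"] conjI)
qed

lemma Lp_cut_cauchy_limit:
  fixes G :: "nat \<Rightarrow> 'a measure \<times> ('a \<Rightarrow> 'a \<Rightarrow> real)"
  assumes p: "1 < p" and g: "\<And>n. graphon (fst (G n)) (snd (G n))" and C: "cut_cauchy G"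
    and L: "\<And>n. Lp_le p c (fst (G n)) (snd (G n))" and c: "p = \<infinity> \<longrightarrow> 0 \<le> c"
    and bd: "(\<exists>K. \<forall>n. L1_norm (fst (G n)) (snd (G n)) \<le> K) \<or> (\<forall>n. nonneg_graphon (fst (G n)) (snd (G n)))"
  shows "\<exists>w. limit_graphon G w \<and> Lp_le p c lborel w"
proof -
  have gi: "gintegrable (fst (G n)) (snd (G n))" for n using g by (simp add: graphon_def)
  have "graphon (fst H) (snd H)" "Lp_le p c (fst H) (snd H)" if "H \<in> range G" for H using that g L by auto
  from Lp_bounded_trunc[of p "range G" c, OF p this]
  have ui: "\<forall>e>0. \<exists>B\<ge>0. \<forall>n. excess (fst (G n)) (snd (G n)) B \<le> e"
    by simp
  obtain w where w: "limit_graphon G w"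
    using cut_cauchy_limit[OF g C ui bd] by blast
  have wi: "gintegrable lborel w" using limit_graphon_graphon[OF w] by (simp add: graphon_def)
  have "Lp_le p c lborel w"
  proof (cases "p = \<infinity>")
    case True
    then have c0: "0 \<le> c" using c by simp
    \<comment> \<open>The truncation at \<open>c\<close> vanishes at 0 only because \<open>c\<close>
      is nonnegative, which explains the assumption on \<open>c\<close> for
      \<open>p = \<infinity>\<close>.\<close>
    note T = test_function_max[OF test_function_abs c0]
    have "excess (fst (G n)) (snd (G n)) c \<le> 0" for n
      using AE_bounded_trunc[where M="fst (G n)" and W="snd (G n)" and C=c and B=c] L[of n] True by (simp add: Lp_le_def)
    then have "excess lborel w c \<le> 0"
      by (intro limit_graphon_test[OF w T order_refl])
    then have "AE z in sq lborel. max (\<bar>w (fst z) (snd z)\<bar> - c) 0 = 0"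
      by (rule test_integral_0_AE[OF T wi])
    then have "AE z in sq lborel. \<bar>w (fst z) (snd z)\<bar> \<le> c"
      by eventually_elim (auto simp: max_def split: if_splits)
    then show ?thesis using True by (simp add: Lp_le_def)
  next
    case False
    \<comment> \<open>For finite \<open>p\<close> the sign of \<open>c\<close> is a consequence of
      the norm bound.\<close>
    note b = Lp_finite_bound[OF p False gi L]
    show ?thesis
    proof (rule Lp_le_of_test[OF p False b(2) wi])
      fix B :: real assume B: "0 \<le> B"
      let ?r = "real_of_ereal p"
      have T: "test_function (powr_cut ?r B)" by (rule test_function_powr_cut[OF b(1) B])
      show "(LINT z|sq lborel. powr_cut ?r B (w (fst z) (snd z))) \<le> c powr ?r"
      proof (rule limit_graphon_test[OF w T])
        fix n
        have "(LINT z|sq (fst (G n)). powr_cut ?r B (snd (G n) (fst z) (snd z)))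
          \<le> (LINT z|sq (fst (G n)). \<bar>snd (G n) (fst z) (snd z)\<bar> powr ?r)"
          by (rule integral_mono[OF test_function_integrable[OF T gi] b(3) powr_cut_le_powr[OF b(1) B]])
        also have "\<dots> \<le> c powr ?r" by (rule b(4))
        finally show "(LINT z|sq (fst (G n)). powr_cut ?r B (snd (G n) (fst z) (snd z))) \<le> c powr ?r" .
      qed simp
    qed
  qed
  then show ?thesis using w by blast
qed

lemma Lp_le_cong_AE:
  assumes L: "Lp_le p c M W" and p: "1 < p" and W: "gintegrable M W" and V: "gintegrable M V"
    and le: "AE z in sq M. V (fst z) (snd z) = W (fst z) (snd z)"
  shows "Lp_le p c M V"
proof -
  note [measurable] = borel_measurable_integrable[OF W] borel_measurable_integrable[OF V]
  have "(\<integral>\<^sup>+ z. ennreal (\<bar>V (fst z) (snd z)\<bar> powr r) \<partial>(sq M)) = (\<integral>\<^sup>+ z. ennreal (\<bar>W (fst z) (snd z)\<bar> powr r) \<partial>(sq M))" for r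
      proof (rule nn_integral_cong_AE)
    show "AE z in sq M. ennreal (\<bar>V (fst z) (snd z)\<bar> powr r) = ennreal (\<bar>W (fst z) (snd z)\<bar> powr r)"
      using le by eventually_elim simp
  qed
  moreover have "(LINT z|sq M. \<bar>V (fst z) (snd z)\<bar> powr r) = (LINT z|sq M. \<bar>W (fst z) (snd z)\<bar> powr r)" for r
  proof (rule integral_cong_AE)
    show "AE z in sq M. \<bar>V (fst z) (snd z)\<bar> powr r = \<bar>W (fst z) (snd z)\<bar> powr r"
      using le by eventually_elim simp
  qed measurable
  moreover have "AE z in sq M. \<bar>V (fst z) (snd z)\<bar> \<le> c" if "AE z in sq M. \<bar>W (fst z) (snd z)\<bar> \<le> c"
    using that le by eventually_elim simp
  ultimately show ?thesis using L unfolding Lp_le_def by (auto split: if_splits)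
qed

lemma complete_Lp_nonneg:
  assumes p: "1 < p"
  shows "complete_class (\<lambda>(M::'a measure) W. nonneg_graphon M W \<and> Lp_le p C M W)
                      (\<lambda>M W. nonneg_graphon M W \<and> Lp_le p C M W)"
  unfolding complete_class_def
proof (intro allI impI, elim conjE)
  fix G :: "nat \<Rightarrow> 'a measure \<times> ('a \<Rightarrow> 'a \<Rightarrow> real)"
  assume G: "\<forall>n. graphon (fst (G n)) (snd (G n)) \<and> nonneg_graphon (fst (G n)) (snd (G n)) \<and> Lp_le p C (fst (G n)) (snd (G n))"
    and cau: "cut_cauchy G"
  have g: "graphon (fst (G n)) (snd (G n))" and L: "Lp_le p C (fst (G n)) (snd (G n))" for n using G by auto
  have nonneg: "\<forall>n. nonneg_graphon (fst (G n)) (snd (G n))" using G by simp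
  show "\<exists>(M :: real measure) W. graphon M W \<and> (nonneg_graphon M W \<and> Lp_le p C M W) \<and> cut_converges G M W"
  proof (cases "p = \<infinity> \<and> C < 0")
    \<comment> \<open>The square of the line is not a null set and admits no almost everywhere bound
      by a negative \<open>C\<close>, so the limit lives on the null measure instead.\<close>
    case True
    have L': "Lp_le \<infinity> C (fst (G n)) (snd (G n))" for n using L[of n] True by simp
    show ?thesis using cut_converges_null[OF g L' conjunct2[OF True]] True
      by (intro exI[of _ "null_measure (lborel :: real measure)"] exI[of _ "\<lambda>_ _. 0"]) (simp add: nonneg_graphon_def)
  next
    case False
    then have c: "p = \<infinity> \<longrightarrow> 0 \<le> C" by auto
    obtain w where w: "limit_graphon G w" and Lw: "Lp_le p C lborel w"
      using Lp_cut_cauchy_limit[OF p g cau L c disjI2[OF nonneg]] by blast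
    have wi: "gintegrable lborel w" using limit_graphon_graphon[OF w] by (simp add: graphon_def)
    have "(LINT z|sq (fst (G n)). max (- snd (G n) (fst z) (snd z)) 0) \<le> 0" for n
    proof -
      have "(LINT z|sq (fst (G n)). max (- snd (G n) (fst z) (snd z)) 0) = (LINT z|sq (fst (G n)). 0)"
        by (rule Bochner_Integration.integral_cong[OF refl])
           (use nonneg in \<open>auto simp: nonneg_graphon_def space_pair_measure max_def\<close>)
      then show ?thesis by simp
    qed
    then have "(LINT z|sq lborel. max (- w (fst z) (snd z)) 0) \<le> 0"
      by (intro limit_graphon_test[OF w test_function_negpart order_refl])
    then have AE1: "AE z in sq lborel. max (- w (fst z) (snd z)) 0 = 0"
      by (rule test_integral_0_AE[OF test_function_negpart wi])
    let ?v = "\<lambda>x y. max 0 (w x y)"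
    have v: "graphon lborel ?v" by (rule graphon_clip[OF limit_graphon_graphon[OF w]]) auto
    have AE: "AE z in sq lborel. ?v (fst z) (snd z) = w (fst z) (snd z)"
      using AE1 by eventually_elim (auto simp: max_def split: if_splits)
    have "Lp_le p C lborel ?v"
      by (rule Lp_le_cong_AE[OF Lw p wi _ AE]) (use v in \<open>simp add: graphon_def\<close>)
    moreover have "nonneg_graphon lborel ?v" by (auto simp: nonneg_graphon_def)
    ultimately show ?thesis using v limit_graphon_converges[OF w v AE] by blast
  qed
qed

lemma complete_Lp_L1:
  assumes p: "1 < p"
  shows "complete_class (\<lambda>(M::'a measure) W. Lp_le p C M W \<and> L1_norm M W \<le> C1)
                      (\<lambda>M W. Lp_le p C M W \<and> L1_norm M W \<le> C1)"
  unfolding complete_class_def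
proof (intro allI impI, elim conjE)
  fix G :: "nat \<Rightarrow> 'a measure \<times> ('a \<Rightarrow> 'a \<Rightarrow> real)"
  assume G: "\<forall>n. graphon (fst (G n)) (snd (G n)) \<and> Lp_le p C (fst (G n)) (snd (G n)) \<and> L1_norm (fst (G n)) (snd (G n)) \<le> C1"
    and cau: "cut_cauchy G"
  have g: "graphon (fst (G n)) (snd (G n))" and L: "Lp_le p C (fst (G n)) (snd (G n))"
    and L1: "L1_norm (fst (G n)) (snd (G n)) \<le> C1" for n using G by auto
  \<comment> \<open>Bounds pass to the limit for nonnegative constants; here the sign follows from
    any member of the sequence.\<close>
  have C1: "0 \<le> C1" by (rule order_trans[OF _ L1[of 0]]) (simp add: L1_norm_def)
  show "\<exists>(M :: real measure) W. graphon M W \<and> (Lp_le p C M W \<and> L1_norm M W \<le> C1) \<and> cut_converges G M W"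
  proof (cases "p = \<infinity> \<and> C < 0")
    case True
    have L': "Lp_le \<infinity> C (fst (G n)) (snd (G n))" for n using L[of n] True by simp
    show ?thesis using cut_converges_null[OF g L' conjunct2[OF True]] True C1
      by (intro exI[of _ "null_measure (lborel :: real measure)"] exI[of _ "\<lambda>_ _. 0"]) (simp add: L1_norm_def)
  next
    case False
    then have c: "p = \<infinity> \<longrightarrow> 0 \<le> C" by auto
    have bd: "\<exists>K. \<forall>n. L1_norm (fst (G n)) (snd (G n)) \<le> K" using L1 by blast
    obtain w where w: "limit_graphon G w" and Lw: "Lp_le p C lborel w"
      using Lp_cut_cauchy_limit[OF p g cau L c disjI1[OF bd]] by blast
    have "L1_norm lborel w \<le> C1" unfolding L1_norm_def
      by (rule limit_graphon_test[OF w test_function_abs C1]) (use L1 in \<open>simp add: L1_norm_def\<close>)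
    moreover have "cut_converges G lborel w"
      by (rule limit_graphon_converges[OF w limit_graphon_graphon[OF w]]) simp
    ultimately show ?thesis using limit_graphon_graphon[OF w] Lw by blast
  qed
qed

theorem mainTheorem11:
  shows
  "((\<forall>A :: ('a measure \<times> ('a \<Rightarrow> 'a \<Rightarrow> real)) set.
       (\<forall>G\<in>A. graphon (fst G) (snd G)) \<and> unif_integrable A \<longrightarrow> rel_complete A)
   \<and> (\<forall>A :: ('a measure \<times> ('a \<Rightarrow> 'a \<Rightarrow> real)) set.
       (\<forall>G\<in>A. graphon (fst G) (snd G) \<and> nonneg_graphon (fst G) (snd G))
       \<and> semiunif_integrable A \<longrightarrow> rel_complete A)
   \<and> (\<forall>(p::ereal) (C::real). 1 < p \<longrightarrow>
       complete_class (\<lambda>(M::'a measure) W. nonneg_graphon M W \<and> Lp_le p C M W)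
                      (\<lambda>M W. nonneg_graphon M W \<and> Lp_le p C M W))
   \<and> (\<forall>(p::ereal) (A :: ('a measure \<times> ('a \<Rightarrow> 'a \<Rightarrow> real)) set). 1 < p \<longrightarrow>
       (\<forall>G\<in>A. graphon (fst G) (snd G) \<and> nonneg_graphon (fst G) (snd G))
       \<and> (\<exists>C. \<forall>G\<in>A. Lp_le p C (fst G) (snd G)) \<longrightarrow> rel_complete A)
   \<and> complete_class (\<lambda>(M::'a measure) W. unit_graphon M W) (\<lambda>M W. unit_graphon M W)
   \<and> (\<forall>(p::ereal) (C::real) (C1::real). 1 < p \<longrightarrow>
       complete_class (\<lambda>(M::'a measure) W. Lp_le p C M W \<and> L1_norm M W \<le> C1)
                      (\<lambda>M W. Lp_le p C M W \<and> L1_norm M W \<le> C1))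
   \<and> (\<forall>(p::ereal) (A :: ('a measure \<times> ('a \<Rightarrow> 'a \<Rightarrow> real)) set). 1 < p \<longrightarrow>
       (\<forall>G\<in>A. graphon (fst G) (snd G))
       \<and> (\<exists>C. \<forall>G\<in>A. Lp_le p C (fst G) (snd G))
       \<and> (\<exists>C1. \<forall>G\<in>A. L1_norm (fst G) (snd G) \<le> C1) \<longrightarrow> rel_complete A))"
proof (intro conjI allI impI, goal_cases)
  case (1 A)
  then have G: "\<And>H. H \<in> A \<Longrightarrow> graphon (fst H) (snd H)" and A: "semiunif_integrable A"
    and bd: "\<exists>K. \<forall>H\<in>A. L1_norm (fst H) (snd H) \<le> K" by (auto simp: unif_integrable_def)
  show ?case by (rule rel_complete_trunc[OF G semiunif_integrable_trunc[OF A G] disjI1[OF bd]])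
next
  case (2 A)
  then have G: "\<And>H. H \<in> A \<Longrightarrow> graphon (fst H) (snd H)" and A: "semiunif_integrable A"
    and nn: "\<forall>H\<in>A. nonneg_graphon (fst H) (snd H)" by auto
  show ?case by (rule rel_complete_trunc[OF G semiunif_integrable_trunc[OF A G] disjI2[OF nn]])
next
  case (3 p C)
  then show ?case by (rule complete_Lp_nonneg)
next
  case (4 p A)
  then have p: "1 < p" and G: "\<And>H. H \<in> A \<Longrightarrow> graphon (fst H) (snd H)"
    and nn: "\<forall>H\<in>A. nonneg_graphon (fst H) (snd H)" by auto
  from 4 obtain C where L: "\<And>H. H \<in> A \<Longrightarrow> Lp_le p C (fst H) (snd H)" by auto
  show ?case by (rule rel_complete_trunc[OF G Lp_bounded_trunc[OF p G L] disjI2[OF nn]])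
next
  case 5
  show ?case by (rule complete_unit)
next
  case (6 p C C1)
  then show ?case by (rule complete_Lp_L1)
next
  case (7 p A)
  then have p: "1 < p" and G: "\<And>H. H \<in> A \<Longrightarrow> graphon (fst H) (snd H)"
    and bd: "\<exists>K. \<forall>H\<in>A. L1_norm (fst H) (snd H) \<le> K" by auto
  from 7 obtain C where L: "\<And>H. H \<in> A \<Longrightarrow> Lp_le p C (fst H) (snd H)" by auto
  show ?case by (rule rel_complete_trunc[OF G Lp_bounded_trunc[OF p G L] disjI1[OF bd]])
qed

end
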